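(* Let $W$ be a finite Coxeter group with (complexified) reflection representation $\mathfrak{h}$, let $S$ be the set of reflections in $W$, let $c:S\to\mathbb{C}$ be a conjugation-invariant function, and let $H_c$ be the rational Cherednik algebra over $\mathbb{C}[\hbar]$. Filter $H_c$ by declaring $x\in\mathfrak{h}^*$ and $y\in\mathfrak{h}$ to have degree $1$ and $g\in W$ to have degree $0$. Then the natural surjective homomorphism $$\xi:\mathbb{C}W\ltimes\mathbb{C}[\mathfrak{h}\oplus\mathfrak{h}^*][\hbar]\to\mathrm{gr}(H_c)$$ is an isomorphism.
   Context: For $s\in S$, $\alpha_s\in\mathfrak{h}^*$ is an eigenvector of $s$ with eigenvalue $-1$, and $\alpha_s^\vee\in\mathfrak{h}$ is the $(-1)$-eigenvector with $(\alpha_s,\alpha_s^\vee)=2$. $H_c=H_c(W,\mathfrak{h})$ is the quotient of $\mathbb{C}W\ltimes\mathbf{T}(\mathfrak{h}\oplus\mathfrak{h}^* )[\hbar]$ ($\mathbf{T}$ the tensor algebra) by the ideal generated by the relations $[x,x']=0$, $[y,y']=0$, $[y,x]=\hbar(y,x)-\sum_{s\in S}c_s(y,\alpha_s)(x,\alpha_s^\vee)s$ for $x,x'\in\mathfrak{h}^*$, $y,y'\in\mathfrak{h}$. The filtration is a filtration of $\mathbb{C}[\hbar]$-algebras ($\hbar$ in degree $0$), and $\mathrm{gr}(H_c)$ is the associated graded algebra. *)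

theory Defs
  imports "HOL-Analysis.Finite_Cartesian_Product" "HOL-Algebra.UnivPoly" "HOL-Algebra.QuotRing"
begin

section \<open>Coxeter systems and the reflection representation\<close>

text \<open>The value \<open>0\<close> of a Coxeter matrix encodes \<open>\<infinity>\<close>: then \<open>(s\<^sub>i s\<^sub>j)\<^sup>0 = 1\<close> is no relation,
  and the convention \<open>pi / 0 = 0\<close> gives \<open>-cos (pi / \<infinity>) = -1\<close> below.\<close>

definition coxeter_matrix :: "('i \<Rightarrow> 'i \<Rightarrow> nat) \<Rightarrow> bool" where
  "coxeter_matrix m \<longleftrightarrow>
     (\<forall>i. m i i = 1) \<and> (\<forall>i j. m i j = m j i) \<and> (\<forall>i j. i \<noteq> j \<longrightarrow> m i j \<noteq> 1)"

text \<open>The congruence on words in the simple generators generated by the relations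
  \<open>(s\<^sub>i s\<^sub>j)\<^bsup>m i j\<^esup> = 1\<close>. Because \<open>m i i = 1\<close>, every letter is its own inverse, so
  words without formal inverses present the Coxeter group.\<close>

inductive coxeter_cong :: "('i \<Rightarrow> 'i \<Rightarrow> nat) \<Rightarrow> 'i list \<Rightarrow> 'i list \<Rightarrow> bool" for m where
  relation: "coxeter_cong m (u @ concat (replicate (m i j) [i, j]) @ v) (u @ v)"
| refl: "coxeter_cong m u u"
| sym: "coxeter_cong m u v \<Longrightarrow> coxeter_cong m v u"
| trans: "coxeter_cong m u v \<Longrightarrow> coxeter_cong m v w \<Longrightarrow> coxeter_cong m u w"

definition word_eval :: "('g, 'z) monoid_scheme \<Rightarrow> ('i \<Rightarrow> 'g) \<Rightarrow> 'i list \<Rightarrow> 'g" where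
  "word_eval W r u = foldr (\<lambda>i g. r i \<otimes>\<^bsub>W\<^esub> g) u \<one>\<^bsub>W\<^esub>"

definition coxeter_system ::
    "('g, 'z) monoid_scheme \<Rightarrow> ('i \<Rightarrow> 'i \<Rightarrow> nat) \<Rightarrow> ('i \<Rightarrow> 'g) \<Rightarrow> bool" where
  "coxeter_system W m r \<longleftrightarrow>
     group W \<and> coxeter_matrix m \<and> range r \<subseteq> carrier W \<and>
     carrier W = range (word_eval W r) \<and>
     (\<forall>u v. word_eval W r u = word_eval W r v \<longleftrightarrow> coxeter_cong m u v)"

definition reflections :: "('g, 'z) monoid_scheme \<Rightarrow> ('i \<Rightarrow> 'g) \<Rightarrow> 'g set" where
  "reflections W r = {g \<otimes>\<^bsub>W\<^esub> r i \<otimes>\<^bsub>W\<^esub> inv\<^bsub>W\<^esub> g | g i. g \<in> carrier W}"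

definition coxeter_form :: "('i \<Rightarrow> 'i \<Rightarrow> nat) \<Rightarrow> 'i \<Rightarrow> 'i \<Rightarrow> real" where
  "coxeter_form m i j = - cos (pi / real (m i j))"

text \<open>Matrix, in the basis of simple roots \<open>e\<^sub>j\<close>, of \<open>v \<mapsto> v - 2 B(e\<^sub>i, v) e\<^sub>i\<close>.\<close>

definition simple_reflection :: "('i \<Rightarrow> 'i \<Rightarrow> nat) \<Rightarrow> 'i \<Rightarrow> real ^ 'i ^ 'i::finite" where
  "simple_reflection m i =
     (\<chi> k j. (if k = j then 1 else 0) - (if k = i then 2 * coxeter_form m i j else 0))"

definition real_reflection_rep ::
    "('g, 'z) monoid_scheme \<Rightarrow> ('i \<Rightarrow> 'i \<Rightarrow> nat) \<Rightarrow> ('i \<Rightarrow> 'g)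
      \<Rightarrow> ('g \<Rightarrow> real ^ 'i ^ 'i::finite) \<Rightarrow> bool" where
  "real_reflection_rep W m r \<rho> \<longleftrightarrow>
     \<rho> \<one>\<^bsub>W\<^esub> = mat 1 \<and>
     (\<forall>g\<in>carrier W. \<forall>h\<in>carrier W. \<rho> (g \<otimes>\<^bsub>W\<^esub> h) = \<rho> g ** \<rho> h) \<and>
     (\<forall>i. \<rho> (r i) = simple_reflection m i)"

text \<open>\<open>\<hh>\<close> is \<open>complex ^ 'i\<close>, the complexification of the real reflection representation in the
  basis of simple roots; \<open>\<hh>\<^sup>*\<close> is \<open>complex ^ 'i\<close> in the dual basis, with the contragredient action.\<close>

definition rep :: "('g \<Rightarrow> real ^ 'i ^ 'i) \<Rightarrow> 'g \<Rightarrow> complex ^ 'i ^ 'i::finite" where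
  "rep \<rho> g = map_matrix complex_of_real (\<rho> g)"

definition dual_rep ::
    "('g, 'z) monoid_scheme \<Rightarrow> ('g \<Rightarrow> real ^ 'i ^ 'i) \<Rightarrow> 'g \<Rightarrow> complex ^ 'i ^ 'i::finite" where
  "dual_rep W \<rho> g = transpose (rep \<rho> (inv\<^bsub>W\<^esub> g))"

definition pairing :: "complex ^ 'i \<Rightarrow> complex ^ 'i::finite \<Rightarrow> complex" where
  "pairing y x = (\<Sum>i\<in>UNIV. y $ i * x $ i)"

section \<open>Skew group rings\<close>

text \<open>\<open>\<complex>W \<ltimes> A\<close> for a finite group \<open>W\<close> acting on the algebra \<open>A\<close> by automorphisms:
  the function \<open>f\<close> stands for \<open>\<Sum>h\<in>W. f h \<cdot> h\<close>, and \<open>(a \<cdot> h) (b \<cdot> k) = a h(b) \<cdot> hk\<close>.\<close>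

definition smash_product ::
    "('g, 'z) monoid_scheme \<Rightarrow> ('g \<Rightarrow> 'a \<Rightarrow> 'a) \<Rightarrow> ('a, 'y) ring_scheme \<Rightarrow> ('g \<Rightarrow> 'a) ring" where
  "smash_product W act A =
     \<lparr>carrier = carrier W \<rightarrow>\<^sub>E carrier A,
      mult = (\<lambda>f f'. \<lambda>g\<in>carrier W.
        \<Oplus>\<^bsub>A\<^esub>h\<in>carrier W. f h \<otimes>\<^bsub>A\<^esub> act h (f' (inv\<^bsub>W\<^esub> h \<otimes>\<^bsub>W\<^esub> g))),
      one = (\<lambda>g\<in>carrier W. if g = \<one>\<^bsub>W\<^esub> then \<one>\<^bsub>A\<^esub> else \<zero>\<^bsub>A\<^esub>),
      zero = (\<lambda>g\<in>carrier W. \<zero>\<^bsub>A\<^esub>),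
      add = (\<lambda>f f'. \<lambda>g\<in>carrier W. f g \<oplus>\<^bsub>A\<^esub> f' g)\<rparr>"

definition smash_single ::
    "('g, 'z) monoid_scheme \<Rightarrow> ('a, 'y) ring_scheme \<Rightarrow> 'a \<Rightarrow> 'g \<Rightarrow> 'g \<Rightarrow> 'a" where
  "smash_single W A a g = (\<lambda>h\<in>carrier W. if h = g then a else \<zero>\<^bsub>A\<^esub>)"

section \<open>Tensor algebras\<close>

text \<open>The tensor algebra of \<open>\<complex>\<^sup>B\<close>: a tensor is given by its coordinates, indexed by words in \<open>B\<close>.\<close>

definition tensor_algebra :: "('b list \<Rightarrow> complex) ring" where
  "tensor_algebra =
     \<lparr>carrier = {t. finite {w. t w \<noteq> 0}},
      mult = (\<lambda>t t' w. \<Sum>k\<le>length w. t (take k w) * t' (drop k w)),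
      one = (\<lambda>w. if w = [] then 1 else 0),
      zero = (\<lambda>w. 0),
      add = (\<lambda>t t' w. t w + t' w)\<rparr>"

definition tensor_const :: "complex \<Rightarrow> 'b list \<Rightarrow> complex" where
  "tensor_const k = (\<lambda>w. if w = [] then k else 0)"

text \<open>The algebra automorphism induced by a linear map with matrix \<open>M\<close>; on tensors of degree
  \<open>n\<close> it is \<open>M\<^bsup>\<otimes>n\<^esup>\<close>.\<close>

definition tensor_map ::
    "('b \<Rightarrow> 'b \<Rightarrow> complex) \<Rightarrow> ('b list \<Rightarrow> complex) \<Rightarrow> 'b list \<Rightarrow> complex" where
  "tensor_map M t = (\<lambda>w. \<Sum>u | length u = length w. (\<Prod>k<length w. M (w ! k) (u ! k)) * t u)"

text \<open>For \<open>\<hh> \<oplus> \<hh>\<^sup>*\<close> the letters \<open>Inl i\<close> are the basis of \<open>\<hh>\<close>, the letters \<open>Inr i\<close> the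
  basis of \<open>\<hh>\<^sup>*\<close>.\<close>

definition tensor_y :: "complex ^ 'i \<Rightarrow> ('i + 'i) list \<Rightarrow> complex" where
  "tensor_y y = (\<lambda>w. case w of [Inl i] \<Rightarrow> y $ i | _ \<Rightarrow> 0)"

definition tensor_x :: "complex ^ 'i \<Rightarrow> ('i + 'i) list \<Rightarrow> complex" where
  "tensor_x x = (\<lambda>w. case w of [Inr i] \<Rightarrow> x $ i | _ \<Rightarrow> 0)"

definition double_matrix ::
    "('g, 'z) monoid_scheme \<Rightarrow> ('g \<Rightarrow> real ^ 'i ^ 'i) \<Rightarrow> 'g
      \<Rightarrow> 'i + 'i \<Rightarrow> 'i + 'i::finite \<Rightarrow> complex" where
  "double_matrix W \<rho> g a b =
     (case (a, b) of
        (Inl i, Inl j) \<Rightarrow> rep \<rho> g $ i $ j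
      | (Inr i, Inr j) \<Rightarrow> dual_rep W \<rho> g $ i $ j
      | _ \<Rightarrow> 0)"

definition tensor_act ::
    "('g, 'z) monoid_scheme \<Rightarrow> ('g \<Rightarrow> real ^ 'i ^ 'i) \<Rightarrow> 'g
      \<Rightarrow> (('i + 'i::finite) list \<Rightarrow> complex) \<Rightarrow> ('i + 'i) list \<Rightarrow> complex" where
  "tensor_act W \<rho> g = tensor_map (double_matrix W \<rho> g)"

section \<open>The ring of polynomial functions on \<open>\<hh> \<oplus> \<hh>\<^sup>*\<close>\<close>

inductive_set polyfuns :: "((complex ^ 'i) \<times> (complex ^ 'i::finite) \<Rightarrow> complex) set" where
  const: "(\<lambda>_. k) \<in> polyfuns"
| x: "(\<lambda>(p, q). pairing p x) \<in> polyfuns"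
| y: "(\<lambda>(p, q). pairing y q) \<in> polyfuns"
| add: "f \<in> polyfuns \<Longrightarrow> f' \<in> polyfuns \<Longrightarrow> (\<lambda>v. f v + f' v) \<in> polyfuns"
| mult: "f \<in> polyfuns \<Longrightarrow> f' \<in> polyfuns \<Longrightarrow> (\<lambda>v. f v * f' v) \<in> polyfuns"

definition polyfun_ring :: "((complex ^ 'i) \<times> (complex ^ 'i::finite) \<Rightarrow> complex) ring" where
  "polyfun_ring =
     \<lparr>carrier = polyfuns,
      mult = (\<lambda>f f' v. f v * f' v),
      one = (\<lambda>v. 1),
      zero = (\<lambda>v. 0),
      add = (\<lambda>f f' v. f v + f' v)\<rparr>"

definition polyfun_act ::
    "('g, 'z) monoid_scheme \<Rightarrow> ('g \<Rightarrow> real ^ 'i ^ 'i) \<Rightarrow> 'g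
      \<Rightarrow> ((complex ^ 'i) \<times> (complex ^ 'i::finite) \<Rightarrow> complex)
      \<Rightarrow> (complex ^ 'i) \<times> (complex ^ 'i) \<Rightarrow> complex" where
  "polyfun_act W \<rho> g f =
     (\<lambda>(p, q). f (rep \<rho> (inv\<^bsub>W\<^esub> g) *v p, dual_rep W \<rho> (inv\<^bsub>W\<^esub> g) *v q))"

section \<open>The rational Cherednik algebra\<close>

text \<open>\<open>\<complex>W \<ltimes> T(\<hh> \<oplus> \<hh>\<^sup>*)[\<hbar>]\<close> and \<open>\<complex>W \<ltimes> \<complex>[\<hh> \<oplus> \<hh>\<^sup>*][\<hbar>]\<close>; the polynomial variable of
  \<^const>\<open>UP\<close> is \<open>\<hbar>\<close>.\<close>

abbreviation tensor_smash ::
    "('g, 'z) monoid_scheme \<Rightarrow> ('g \<Rightarrow> real ^ 'i ^ 'i::finite)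
      \<Rightarrow> ('g \<Rightarrow> ('i + 'i) list \<Rightarrow> complex) ring" where
  "tensor_smash W \<rho> \<equiv> smash_product W (tensor_act W \<rho>) tensor_algebra"

abbreviation poly_smash ::
    "('g, 'z) monoid_scheme \<Rightarrow> ('g \<Rightarrow> real ^ 'i ^ 'i::finite)
      \<Rightarrow> ('g \<Rightarrow> (complex ^ 'i) \<times> (complex ^ 'i) \<Rightarrow> complex) ring" where
  "poly_smash W \<rho> \<equiv> smash_product W (polyfun_act W \<rho>) polyfun_ring"

text \<open>\<open>tensor_elt W \<rho> t g n\<close> is \<open>\<hbar>\<^sup>n \<cdot> t \<cdot> g\<close>, and likewise \<open>poly_elt W \<rho> f g n\<close> is
  \<open>\<hbar>\<^sup>n \<cdot> f \<cdot> g\<close>.\<close>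

definition tensor_elt ::
    "('g, 'z) monoid_scheme \<Rightarrow> ('g \<Rightarrow> real ^ 'i ^ 'i::finite)
      \<Rightarrow> (('i + 'i) list \<Rightarrow> complex) \<Rightarrow> 'g \<Rightarrow> nat \<Rightarrow> nat \<Rightarrow> 'g \<Rightarrow> ('i + 'i) list \<Rightarrow> complex" where
  "tensor_elt W \<rho> t g n = monom (UP (tensor_smash W \<rho>)) (smash_single W tensor_algebra t g) n"

definition poly_elt ::
    "('g, 'z) monoid_scheme \<Rightarrow> ('g \<Rightarrow> real ^ 'i ^ 'i::finite)
      \<Rightarrow> ((complex ^ 'i) \<times> (complex ^ 'i) \<Rightarrow> complex) \<Rightarrow> 'g \<Rightarrow> nat
      \<Rightarrow> nat \<Rightarrow> 'g \<Rightarrow> (complex ^ 'i) \<times> (complex ^ 'i) \<Rightarrow> complex" where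
  "poly_elt W \<rho> f g n = monom (UP (poly_smash W \<rho>)) (smash_single W polyfun_ring f g) n"

definition commutator :: "('a, 'z) ring_scheme \<Rightarrow> 'a \<Rightarrow> 'a \<Rightarrow> 'a" where
  "commutator R a b = a \<otimes>\<^bsub>R\<^esub> b \<ominus>\<^bsub>R\<^esub> b \<otimes>\<^bsub>R\<^esub> a"

definition cherednik_relators ::
    "('g, 'z) monoid_scheme \<Rightarrow> ('g \<Rightarrow> real ^ 'i ^ 'i::finite) \<Rightarrow> 'g set
      \<Rightarrow> ('g \<Rightarrow> complex ^ 'i) \<Rightarrow> ('g \<Rightarrow> complex ^ 'i) \<Rightarrow> ('g \<Rightarrow> complex)
      \<Rightarrow> (nat \<Rightarrow> 'g \<Rightarrow> ('i + 'i) list \<Rightarrow> complex) set" where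
  "cherednik_relators W \<rho> S \<alpha> \<alpha>v c =
     (let P = UP (tensor_smash W \<rho>);
          X = (\<lambda>x. tensor_elt W \<rho> (tensor_x x) \<one>\<^bsub>W\<^esub> 0);
          Y = (\<lambda>y. tensor_elt W \<rho> (tensor_y y) \<one>\<^bsub>W\<^esub> 0)
      in {commutator P (X x) (X x') | x x'. True}
         \<union> {commutator P (Y y) (Y y') | y y'. True}
         \<union> {commutator P (Y y) (X x) \<ominus>\<^bsub>P\<^esub>
              (tensor_elt W \<rho> (tensor_const (pairing y x)) \<one>\<^bsub>W\<^esub> 1 \<ominus>\<^bsub>P\<^esub>
               (\<Oplus>\<^bsub>P\<^esub>s\<in>S. tensor_elt W \<rho>
                  (tensor_const (c s * pairing y (\<alpha> s) * pairing (\<alpha>v s) x)) s 0)) | y x. True})"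

definition cherednik_ideal ::
    "('g, 'z) monoid_scheme \<Rightarrow> ('g \<Rightarrow> real ^ 'i ^ 'i::finite) \<Rightarrow> 'g set
      \<Rightarrow> ('g \<Rightarrow> complex ^ 'i) \<Rightarrow> ('g \<Rightarrow> complex ^ 'i) \<Rightarrow> ('g \<Rightarrow> complex)
      \<Rightarrow> (nat \<Rightarrow> 'g \<Rightarrow> ('i + 'i) list \<Rightarrow> complex) set" where
  "cherednik_ideal W \<rho> S \<alpha> \<alpha>v c =
     Idl\<^bsub>UP (tensor_smash W \<rho>)\<^esub> (cherednik_relators W \<rho> S \<alpha> \<alpha>v c)"

definition cherednik_algebra ::
    "('g, 'z) monoid_scheme \<Rightarrow> ('g \<Rightarrow> real ^ 'i ^ 'i::finite) \<Rightarrow> 'g set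
      \<Rightarrow> ('g \<Rightarrow> complex ^ 'i) \<Rightarrow> ('g \<Rightarrow> complex ^ 'i) \<Rightarrow> ('g \<Rightarrow> complex)
      \<Rightarrow> (nat \<Rightarrow> 'g \<Rightarrow> ('i + 'i) list \<Rightarrow> complex) set ring" where
  "cherednik_algebra W \<rho> S \<alpha> \<alpha>v c =
     UP (tensor_smash W \<rho>) Quot cherednik_ideal W \<rho> S \<alpha> \<alpha>v c"

text \<open>The class of \<open>\<hbar>\<^sup>n \<cdot> t \<cdot> g\<close> in \<open>H\<^sub>c\<close>.\<close>

definition cherednik_elt ::
    "('g, 'z) monoid_scheme \<Rightarrow> ('g \<Rightarrow> real ^ 'i ^ 'i::finite) \<Rightarrow> 'g set
      \<Rightarrow> ('g \<Rightarrow> complex ^ 'i) \<Rightarrow> ('g \<Rightarrow> complex ^ 'i) \<Rightarrow> ('g \<Rightarrow> complex)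
      \<Rightarrow> (('i + 'i) list \<Rightarrow> complex) \<Rightarrow> 'g \<Rightarrow> nat
      \<Rightarrow> (nat \<Rightarrow> 'g \<Rightarrow> ('i + 'i) list \<Rightarrow> complex) set" where
  "cherednik_elt W \<rho> S \<alpha> \<alpha>v c t g n =
     cherednik_ideal W \<rho> S \<alpha> \<alpha>v c +>\<^bsub>UP (tensor_smash W \<rho>)\<^esub> tensor_elt W \<rho> t g n"

section \<open>Filtrations and associated graded rings\<close>

text \<open>The smallest increasing multiplicative filtration in which \<open>a\<close> has degree at most \<open>d\<close>
  for every \<open>(a, d) \<in> D\<close>.\<close>

inductive generated_filtration :: "('a, 'z) ring_scheme \<Rightarrow> ('a \<times> nat) set \<Rightarrow> nat \<Rightarrow> 'a \<Rightarrow> bool"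
  for R (structure) and D where
  generator: "(a, d) \<in> D \<Longrightarrow> generated_filtration R D d a"
| zero: "generated_filtration R D 0 \<zero>"
| one: "generated_filtration R D 0 \<one>"
| diff: "generated_filtration R D n a \<Longrightarrow> generated_filtration R D n b
    \<Longrightarrow> generated_filtration R D n (a \<ominus> b)"
| mult: "generated_filtration R D k a \<Longrightarrow> generated_filtration R D n b
    \<Longrightarrow> generated_filtration R D (k + n) (a \<otimes> b)"
| mono: "generated_filtration R D n a \<Longrightarrow> generated_filtration R D (Suc n) a"

text \<open>\<open>F\<^bsub>n - 1\<^esub>\<close>, with \<open>F\<^bsub>-1\<^esub> = 0\<close>.\<close>

definition filt_pred :: "('a, 'z) ring_scheme \<Rightarrow> (nat \<Rightarrow> 'a set) \<Rightarrow> nat \<Rightarrow> 'a set" where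
  "filt_pred R F n = (case n of 0 \<Rightarrow> {\<zero>\<^bsub>R\<^esub>} | Suc k \<Rightarrow> F k)"

text \<open>An element of \<open>\<Oplus>\<^sub>n F\<^sub>n / F\<^bsub>n - 1\<^esub>\<close> is its family of homogeneous components.\<close>

definition assoc_graded :: "('a, 'z) ring_scheme \<Rightarrow> (nat \<Rightarrow> 'a set) \<Rightarrow> (nat \<Rightarrow> 'a set) ring" where
  "assoc_graded R F =
     \<lparr>carrier = {A. (\<forall>n. \<exists>a\<in>F n. A n = filt_pred R F n +>\<^bsub>R\<^esub> a) \<and>
                    finite {n. A n \<noteq> filt_pred R F n}},
      mult = (\<lambda>A B n. \<Union>a\<in>(\<Pi> k\<in>UNIV. A k). \<Union>b\<in>(\<Pi> k\<in>UNIV. B k).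
        filt_pred R F n +>\<^bsub>R\<^esub> (\<Oplus>\<^bsub>R\<^esub>k\<in>{..n}. a k \<otimes>\<^bsub>R\<^esub> b (n - k))),
      one = (\<lambda>n. if n = 0 then filt_pred R F 0 +>\<^bsub>R\<^esub> \<one>\<^bsub>R\<^esub> else filt_pred R F n),
      zero = filt_pred R F,
      add = (\<lambda>A B n. A n <+>\<^bsub>R\<^esub> B n)\<rparr>"

text \<open>The class in degree \<open>d\<close> of an element of \<open>F\<^sub>d\<close>.\<close>

definition graded_symbol ::
    "('a, 'z) ring_scheme \<Rightarrow> (nat \<Rightarrow> 'a set) \<Rightarrow> nat \<Rightarrow> 'a \<Rightarrow> nat \<Rightarrow> 'a set" where
  "graded_symbol R F d a = (\<lambda>n. if n = d then filt_pred R F n +>\<^bsub>R\<^esub> a else filt_pred R F n)"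

definition cherednik_filtration ::
    "('g, 'z) monoid_scheme \<Rightarrow> ('g \<Rightarrow> real ^ 'i ^ 'i::finite) \<Rightarrow> 'g set
      \<Rightarrow> ('g \<Rightarrow> complex ^ 'i) \<Rightarrow> ('g \<Rightarrow> complex ^ 'i) \<Rightarrow> ('g \<Rightarrow> complex)
      \<Rightarrow> nat \<Rightarrow> (nat \<Rightarrow> 'g \<Rightarrow> ('i + 'i) list \<Rightarrow> complex) set set" where
  "cherednik_filtration W \<rho> S \<alpha> \<alpha>v c n =
     (let E = cherednik_elt W \<rho> S \<alpha> \<alpha>v c
      in Collect (generated_filtration (cherednik_algebra W \<rho> S \<alpha> \<alpha>v c)
           ({(E (tensor_const k) \<one>\<^bsub>W\<^esub> 0, 0) | k. True}
            \<union> {(E (tensor_const 1) \<one>\<^bsub>W\<^esub> 1, 0)}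
            \<union> {(E (tensor_const 1) g 0, 0) | g. g \<in> carrier W}
            \<union> {(E (tensor_x x) \<one>\<^bsub>W\<^esub> 0, 1) | x. True}
            \<union> {(E (tensor_y y) \<one>\<^bsub>W\<^esub> 0, 1) | y. True}) n))"

definition gr_cherednik ::
    "('g, 'z) monoid_scheme \<Rightarrow> ('g \<Rightarrow> real ^ 'i ^ 'i::finite) \<Rightarrow> 'g set
      \<Rightarrow> ('g \<Rightarrow> complex ^ 'i) \<Rightarrow> ('g \<Rightarrow> complex ^ 'i) \<Rightarrow> ('g \<Rightarrow> complex)
      \<Rightarrow> (nat \<Rightarrow> (nat \<Rightarrow> 'g \<Rightarrow> ('i + 'i) list \<Rightarrow> complex) set set) ring" where
  "gr_cherednik W \<rho> S \<alpha> \<alpha>v c =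
     assoc_graded (cherednik_algebra W \<rho> S \<alpha> \<alpha>v c) (cherednik_filtration W \<rho> S \<alpha> \<alpha>v c)"

text \<open>The natural map \<open>\<xi>\<close> is the homomorphism of \<open>\<complex>[\<hbar>]\<close>-algebras sending each generator
  \<open>g\<close>, \<open>x\<close>, \<open>y\<close> to the class of the corresponding generator of \<open>H\<^sub>c\<close>.\<close>

definition natural_hom ::
    "('g, 'z) monoid_scheme \<Rightarrow> ('g \<Rightarrow> real ^ 'i ^ 'i::finite) \<Rightarrow> 'g set
      \<Rightarrow> ('g \<Rightarrow> complex ^ 'i) \<Rightarrow> ('g \<Rightarrow> complex ^ 'i) \<Rightarrow> ('g \<Rightarrow> complex)
      \<Rightarrow> ((nat \<Rightarrow> 'g \<Rightarrow> (complex ^ 'i) \<times> (complex ^ 'i) \<Rightarrow> complex)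
           \<Rightarrow> nat \<Rightarrow> (nat \<Rightarrow> 'g \<Rightarrow> ('i + 'i) list \<Rightarrow> complex) set set) \<Rightarrow> bool" where
  "natural_hom W \<rho> S \<alpha> \<alpha>v c \<xi> \<longleftrightarrow>
     (let E = cherednik_elt W \<rho> S \<alpha> \<alpha>v c;
          \<sigma> = graded_symbol (cherednik_algebra W \<rho> S \<alpha> \<alpha>v c) (cherednik_filtration W \<rho> S \<alpha> \<alpha>v c)
      in \<xi> \<in> ring_hom (UP (poly_smash W \<rho>)) (gr_cherednik W \<rho> S \<alpha> \<alpha>v c) \<and>
         (\<forall>k. \<xi> (poly_elt W \<rho> (\<lambda>_. k) \<one>\<^bsub>W\<^esub> 0) = \<sigma> 0 (E (tensor_const k) \<one>\<^bsub>W\<^esub> 0)) \<and>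
         \<xi> (poly_elt W \<rho> (\<lambda>_. 1) \<one>\<^bsub>W\<^esub> 1) = \<sigma> 0 (E (tensor_const 1) \<one>\<^bsub>W\<^esub> 1) \<and>
         (\<forall>g\<in>carrier W. \<xi> (poly_elt W \<rho> (\<lambda>_. 1) g 0) = \<sigma> 0 (E (tensor_const 1) g 0)) \<and>
         (\<forall>x. \<xi> (poly_elt W \<rho> (\<lambda>(p, q). pairing p x) \<one>\<^bsub>W\<^esub> 0) = \<sigma> 1 (E (tensor_x x) \<one>\<^bsub>W\<^esub> 0)) \<and>
         (\<forall>y. \<xi> (poly_elt W \<rho> (\<lambda>(p, q). pairing y q) \<one>\<^bsub>W\<^esub> 0) = \<sigma> 1 (E (tensor_y y) \<one>\<^bsub>W\<^esub> 0)))"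

end

theory Submission
  imports "HOL-Computational_Algebra.Polynomial" "HOL-Analysis.Derivative" Defs
begin

text \<open>For every value of \<open>\<hbar>\<close>, \<open>H\<^sub>c\<close> acts on \<open>\<complex>[\<hh> \<oplus> \<hh>\<^sup>*] \<rtimes> W\<close> by Dunkl operators. A product of \<open>n\<close>
  generators applied to \<open>1\<close> is, up to terms of degree less than \<open>n\<close>, the product of the
  corresponding coordinate functions. Hence an element of degree at most \<open>n\<close> of the defining ideal has
  vanishing component of degree \<open>n\<close> in \<open>\<complex>W \<ltimes> \<complex>[\<hh> \<oplus> \<hh>\<^sup>*][\<hbar>]\<close>, so taking leading components is a
  well-defined homomorphism on \<open>gr(H\<^sub>c)\<close>. It is surjective; it is injective because the
  relations allow one to permute the letters of a word of length \<open>n\<close> modulo words of smaller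
  length, and monomials are linearly independent. Its composition with any natural \<open>\<xi>\<close> fixes
  the generators, so \<open>\<xi>\<close> is its inverse.\<close>

section \<open>Skew group rings\<close>

text \<open>In the usual polynomial representation on functions of \<open>p\<close> alone,
  \<open>y\<close> acts by an operator that lowers degree, so leading terms of products of
  generators could not be read off there. The module used here is modelled on the one induced from
  the subalgebra generated by \<open>W\<close> and the \<open>y\<close>, acting on itself: a second
  variable \<open>q\<close> is added, and \<open>y\<close> becomes multiplication by the linear
  function \<open>y(q)\<close> plus a Dunkl operator in \<open>p\<close>. The multiplication raises
  degree by one and the correction lowers it, so both kinds of generators act to leading order by
  their symbols. Commutativity of the modified operators is proved without any rank-two computation:
  the Jacobi identity reduces it to functions of \<open>q\<close> alone. Vanishing is extracted
  twice by evaluation: a homogeneous function of degree \<open>n\<close> that has degree less than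
  \<open>n\<close> is zero along every line through the origin, and a polynomial in the value
  \<open>z\<close> of hbar that vanishes for all \<open>z\<close> has zero coefficients. A natural
  homomorphism is obtained as the inverse of the symbol map, so the relations of its source are
  never verified in the graded ring.\<close>

lemma (in comm_monoid) finprod_swap:
  assumes "finite A" "finite B" "\<And>x y. x \<in> A \<Longrightarrow> y \<in> B \<Longrightarrow> f x y \<in> carrier G"
  shows "(\<Otimes>x\<in>A. \<Otimes>y\<in>B. f x y) = (\<Otimes>y\<in>B. \<Otimes>x\<in>A. f x y)"
  using assms(1,3)
proof (induction A)
  case empty
  then show ?case by simp
next
  case (insert a A)
  have "(\<Otimes>x\<in>insert a A. \<Otimes>y\<in>B. f x y) = (\<Otimes>y\<in>B. f a y) \<otimes> (\<Otimes>x\<in>A. \<Otimes>y\<in>B. f x y)"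
    using insert by (intro finprod_insert) (auto intro!: finprod_closed)
  also have "\<dots> = (\<Otimes>y\<in>B. f a y) \<otimes> (\<Otimes>y\<in>B. \<Otimes>x\<in>A. f x y)"
    using insert by simp
  also have "\<dots> = (\<Otimes>y\<in>B. f a y \<otimes> (\<Otimes>x\<in>A. f x y))"
    using insert by (intro finprod_multf[symmetric]) (auto intro!: finprod_closed)
  also have "\<dots> = (\<Otimes>y\<in>B. \<Otimes>x\<in>insert a A. f x y)"
    using insert by (intro finprod_cong' refl finprod_insert[symmetric]) (auto intro!: finprod_closed)
  finally show ?case .
qed

lemmas (in abelian_monoid) finsum_swap = add.finprod_swap

text \<open>Instantiated twice over the same group, with the tensor algebra and with polynomial
  functions; the symbol later compares the two.\<close>

locale skew_group_ring = W: group W + A: ring A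
  for W :: "('g, 'z) monoid_scheme" and act :: "'g \<Rightarrow> 'a \<Rightarrow> 'a" and A :: "('a, 'y) ring_scheme" +
  assumes finite_group: "finite (carrier W)"
    and act_hom: "g \<in> carrier W \<Longrightarrow> act g \<in> ring_hom A A"
    and act_one: "a \<in> carrier A \<Longrightarrow> act \<one>\<^bsub>W\<^esub> a = a"
    and act_mult: "g \<in> carrier W \<Longrightarrow> h \<in> carrier W \<Longrightarrow> a \<in> carrier A
      \<Longrightarrow> act (g \<otimes>\<^bsub>W\<^esub> h) a = act g (act h a)"
begin

abbreviation "SG \<equiv> smash_product W act A"

lemma smash_carrier: "carrier SG = carrier W \<rightarrow>\<^sub>E carrier A"
  and smash_zero: "\<zero>\<^bsub>SG\<^esub> = (\<lambda>g\<in>carrier W. \<zero>\<^bsub>A\<^esub>)"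
  and smash_one: "\<one>\<^bsub>SG\<^esub> = smash_single W A \<one>\<^bsub>A\<^esub> \<one>\<^bsub>W\<^esub>"
  and smash_add: "f \<oplus>\<^bsub>SG\<^esub> f' = (\<lambda>g\<in>carrier W. f g \<oplus>\<^bsub>A\<^esub> f' g)"
  and smash_mult: "f \<otimes>\<^bsub>SG\<^esub> f' = (\<lambda>g\<in>carrier W.
        \<Oplus>\<^bsub>A\<^esub>h\<in>carrier W. f h \<otimes>\<^bsub>A\<^esub> act h (f' (inv\<^bsub>W\<^esub> h \<otimes>\<^bsub>W\<^esub> g)))"
  by (simp_all add: smash_product_def smash_single_def)

lemma act_closed [simp]: "g \<in> carrier W \<Longrightarrow> a \<in> carrier A \<Longrightarrow> act g a \<in> carrier A"
  using act_hom ring_hom_closed by metis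

lemma act_ring_hom_ring: "g \<in> carrier W \<Longrightarrow> ring_hom_ring A A (act g)"
  by (rule ring_hom_ringI2[OF A.ring_axioms A.ring_axioms act_hom])

lemma act_zero [simp]: "g \<in> carrier W \<Longrightarrow> act g \<zero>\<^bsub>A\<^esub> = \<zero>\<^bsub>A\<^esub>"
  using ring_hom_zero[OF act_hom A.ring_axioms A.ring_axioms] .

lemma act_times: "g \<in> carrier W \<Longrightarrow> a \<in> carrier A \<Longrightarrow> b \<in> carrier A
    \<Longrightarrow> act g (a \<otimes>\<^bsub>A\<^esub> b) = act g a \<otimes>\<^bsub>A\<^esub> act g b"
  and act_add: "g \<in> carrier W \<Longrightarrow> a \<in> carrier A \<Longrightarrow> b \<in> carrier A
    \<Longrightarrow> act g (a \<oplus>\<^bsub>A\<^esub> b) = act g a \<oplus>\<^bsub>A\<^esub> act g b"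
  and act_unit: "g \<in> carrier W \<Longrightarrow> act g \<one>\<^bsub>A\<^esub> = \<one>\<^bsub>A\<^esub>"
  using act_hom ring_hom_mult ring_hom_add ring_hom_one by metis+

lemma act_finsum:
  assumes "g \<in> carrier W" "f \<in> I \<rightarrow> carrier A"
  shows "act g (finsum A f I) = (\<Oplus>\<^bsub>A\<^esub>i\<in>I. act g (f i))"
proof -
  interpret ring_hom_ring A A "act g" using act_ring_hom_ring assms(1) .
  show ?thesis using hom_finsum[OF assms(2)] by (simp add: o_def)
qed

lemma smash_eqI:
  "f \<in> carrier SG \<Longrightarrow> f' \<in> carrier SG \<Longrightarrow> (\<And>g. g \<in> carrier W \<Longrightarrow> f g = f' g) \<Longrightarrow> f = f'"
  unfolding smash_carrier by (rule PiE_ext)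

lemma smash_closed: "f \<in> carrier SG \<Longrightarrow> g \<in> carrier W \<Longrightarrow> f g \<in> carrier A"
  by (auto simp: smash_carrier)

lemma smash_single_closed [simp]: "a \<in> carrier A \<Longrightarrow> smash_single W A a g \<in> carrier SG"
  by (auto simp: smash_carrier smash_single_def)

lemma smash_add_closed: "f \<in> carrier SG \<Longrightarrow> f' \<in> carrier SG \<Longrightarrow> f \<oplus>\<^bsub>SG\<^esub> f' \<in> carrier SG"
  by (auto simp: smash_carrier smash_add)

lemma smash_mult_closed:
  assumes "f \<in> carrier SG" "f' \<in> carrier SG"
  shows "f \<otimes>\<^bsub>SG\<^esub> f' \<in> carrier SG"
  unfolding smash_mult smash_carrier
  using smash_closed[OF assms(1)] smash_closed[OF assms(2)] by (auto intro!: A.finsum_closed)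

lemma smash_mult_assoc:
  assumes "f \<in> carrier SG" "f' \<in> carrier SG" "f'' \<in> carrier SG"
  shows "(f \<otimes>\<^bsub>SG\<^esub> f') \<otimes>\<^bsub>SG\<^esub> f'' = f \<otimes>\<^bsub>SG\<^esub> (f' \<otimes>\<^bsub>SG\<^esub> f'')"
proof (rule smash_eqI)
  fix g assume g: "g \<in> carrier W"
  note [simp] = smash_closed[OF assms(1)] smash_closed[OF assms(2)] smash_closed[OF assms(3)]
  let ?i = "\<lambda>k. inv\<^bsub>W\<^esub> k"
  have "((f \<otimes>\<^bsub>SG\<^esub> f') \<otimes>\<^bsub>SG\<^esub> f'') g = (\<Oplus>\<^bsub>A\<^esub>h\<in>carrier W. (\<Oplus>\<^bsub>A\<^esub>k\<in>carrier W. f k \<otimes>\<^bsub>A\<^esub> act k (f' (?i k \<otimes>\<^bsub>W\<^esub> h))) \<otimes>\<^bsub>A\<^esub> act h (f'' (?i h \<otimes>\<^bsub>W\<^esub> g)))"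
    using g by (auto simp: smash_mult intro!: A.finsum_cong' A.finsum_closed)
  also have "\<dots> = (\<Oplus>\<^bsub>A\<^esub>h\<in>carrier W. \<Oplus>\<^bsub>A\<^esub>k\<in>carrier W. f k \<otimes>\<^bsub>A\<^esub> act k (f' (?i k \<otimes>\<^bsub>W\<^esub> h)) \<otimes>\<^bsub>A\<^esub> act h (f'' (?i h \<otimes>\<^bsub>W\<^esub> g)))"
    using g by (intro A.finsum_cong' A.finsum_ldistr finite_group) (auto intro!: A.finsum_closed)
  also have "\<dots> = (\<Oplus>\<^bsub>A\<^esub>k\<in>carrier W. \<Oplus>\<^bsub>A\<^esub>h\<in>carrier W. f k \<otimes>\<^bsub>A\<^esub> act k (f' (?i k \<otimes>\<^bsub>W\<^esub> h)) \<otimes>\<^bsub>A\<^esub> act h (f'' (?i h \<otimes>\<^bsub>W\<^esub> g)))"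
    using g by (intro A.finsum_swap finite_group) auto
  also have "\<dots> = (\<Oplus>\<^bsub>A\<^esub>k\<in>carrier W. f k \<otimes>\<^bsub>A\<^esub> act k (\<Oplus>\<^bsub>A\<^esub>j\<in>carrier W. f' j \<otimes>\<^bsub>A\<^esub> act j (f'' (?i j \<otimes>\<^bsub>W\<^esub> (?i k \<otimes>\<^bsub>W\<^esub> g)))))"
  proof (intro A.finsum_cong' refl)
    fix k assume k: "k \<in> carrier W"
    \<comment> \<open>The substitution \<open>h = k j\<close> turns the inner sum into the
      convolution of \<open>f'\<close> and \<open>f''\<close>, transported by
      \<open>k\<close>.\<close>
    have inj: "inj_on (\<lambda>j. k \<otimes>\<^bsub>W\<^esub> j) (carrier W)"
      using k by (simp add: inj_on_def)
    have im: "(\<lambda>j. k \<otimes>\<^bsub>W\<^esub> j) ` carrier W = carrier W"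
      using k by (rule W.surj_const_mult)
    have "(\<Oplus>\<^bsub>A\<^esub>h\<in>carrier W. f k \<otimes>\<^bsub>A\<^esub> act k (f' (?i k \<otimes>\<^bsub>W\<^esub> h)) \<otimes>\<^bsub>A\<^esub> act h (f'' (?i h \<otimes>\<^bsub>W\<^esub> g)))
      = (\<Oplus>\<^bsub>A\<^esub>h\<in>(\<lambda>j. k \<otimes>\<^bsub>W\<^esub> j) ` carrier W. f k \<otimes>\<^bsub>A\<^esub> act k (f' (?i k \<otimes>\<^bsub>W\<^esub> h)) \<otimes>\<^bsub>A\<^esub> act h (f'' (?i h \<otimes>\<^bsub>W\<^esub> g)))"
      by (simp add: im)
    also have "\<dots> = (\<Oplus>\<^bsub>A\<^esub>j\<in>carrier W. f k \<otimes>\<^bsub>A\<^esub> act k (f' (?i k \<otimes>\<^bsub>W\<^esub> (k \<otimes>\<^bsub>W\<^esub> j))) \<otimes>\<^bsub>A\<^esub> act (k \<otimes>\<^bsub>W\<^esub> j) (f'' (?i (k \<otimes>\<^bsub>W\<^esub> j) \<otimes>\<^bsub>W\<^esub> g)))"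
      using k g inj by (subst A.finsum_reindex) auto
    also have "\<dots> = (\<Oplus>\<^bsub>A\<^esub>j\<in>carrier W. f k \<otimes>\<^bsub>A\<^esub> act k (f' j \<otimes>\<^bsub>A\<^esub> act j (f'' (?i j \<otimes>\<^bsub>W\<^esub> (?i k \<otimes>\<^bsub>W\<^esub> g)))))"
    proof (intro A.finsum_cong' refl)
      fix j assume j: "j \<in> carrier W"
      have "?i k \<otimes>\<^bsub>W\<^esub> (k \<otimes>\<^bsub>W\<^esub> j) = j"
        using k j by (simp flip: W.m_assoc)
      moreover have "?i (k \<otimes>\<^bsub>W\<^esub> j) \<otimes>\<^bsub>W\<^esub> g = ?i j \<otimes>\<^bsub>W\<^esub> (?i k \<otimes>\<^bsub>W\<^esub> g)"
        using k j g by (simp add: W.inv_mult_group W.m_assoc)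
      ultimately show "f k \<otimes>\<^bsub>A\<^esub> act k (f' (?i k \<otimes>\<^bsub>W\<^esub> (k \<otimes>\<^bsub>W\<^esub> j))) \<otimes>\<^bsub>A\<^esub> act (k \<otimes>\<^bsub>W\<^esub> j) (f'' (?i (k \<otimes>\<^bsub>W\<^esub> j) \<otimes>\<^bsub>W\<^esub> g))
        = f k \<otimes>\<^bsub>A\<^esub> act k (f' j \<otimes>\<^bsub>A\<^esub> act j (f'' (?i j \<otimes>\<^bsub>W\<^esub> (?i k \<otimes>\<^bsub>W\<^esub> g))))"
        using k j g by (simp add: act_times act_mult A.m_assoc)
    qed (use k g in auto)
    also have "\<dots> = f k \<otimes>\<^bsub>A\<^esub> act k (\<Oplus>\<^bsub>A\<^esub>j\<in>carrier W. f' j \<otimes>\<^bsub>A\<^esub> act j (f'' (?i j \<otimes>\<^bsub>W\<^esub> (?i k \<otimes>\<^bsub>W\<^esub> g))))"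
      using k g by (subst act_finsum) (auto intro!: A.finsum_rdistr[symmetric] finite_group)
    finally show "(\<Oplus>\<^bsub>A\<^esub>h\<in>carrier W. f k \<otimes>\<^bsub>A\<^esub> act k (f' (?i k \<otimes>\<^bsub>W\<^esub> h)) \<otimes>\<^bsub>A\<^esub> act h (f'' (?i h \<otimes>\<^bsub>W\<^esub> g))) = \<dots>" .
  qed (use g in \<open>auto intro!: A.finsum_closed\<close>)
  also have "\<dots> = (f \<otimes>\<^bsub>SG\<^esub> (f' \<otimes>\<^bsub>SG\<^esub> f'')) g"
    using g by (auto simp: smash_mult intro!: A.finsum_cong' A.finsum_closed)
  finally show "((f \<otimes>\<^bsub>SG\<^esub> f') \<otimes>\<^bsub>SG\<^esub> f'') g = (f \<otimes>\<^bsub>SG\<^esub> (f' \<otimes>\<^bsub>SG\<^esub> f'')) g" .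
qed (use assms in \<open>auto intro!: smash_mult_closed\<close>)

section \<open>Elements supported at one group element\<close>

lemma smash_single_mult:
  assumes "a \<in> carrier A" "h \<in> carrier W" "f \<in> carrier SG"
  shows "smash_single W A a h \<otimes>\<^bsub>SG\<^esub> f = (\<lambda>g\<in>carrier W. a \<otimes>\<^bsub>A\<^esub> act h (f (inv\<^bsub>W\<^esub> h \<otimes>\<^bsub>W\<^esub> g)))"
proof -
  note [simp] = smash_closed[OF assms(3)]
  have "(\<Oplus>\<^bsub>A\<^esub>k\<in>carrier W. smash_single W A a h k \<otimes>\<^bsub>A\<^esub> act k (f (inv\<^bsub>W\<^esub> k \<otimes>\<^bsub>W\<^esub> g)))
      = a \<otimes>\<^bsub>A\<^esub> act h (f (inv\<^bsub>W\<^esub> h \<otimes>\<^bsub>W\<^esub> g))" if "g \<in> carrier W" for g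
  proof -
    have "(\<Oplus>\<^bsub>A\<^esub>k\<in>carrier W. smash_single W A a h k \<otimes>\<^bsub>A\<^esub> act k (f (inv\<^bsub>W\<^esub> k \<otimes>\<^bsub>W\<^esub> g)))
      = (\<Oplus>\<^bsub>A\<^esub>k\<in>carrier W. if h = k then a \<otimes>\<^bsub>A\<^esub> act k (f (inv\<^bsub>W\<^esub> k \<otimes>\<^bsub>W\<^esub> g)) else \<zero>\<^bsub>A\<^esub>)"
      using assms that by (intro A.finsum_cong') (auto simp: smash_single_def)
    also have "\<dots> = a \<otimes>\<^bsub>A\<^esub> act h (f (inv\<^bsub>W\<^esub> h \<otimes>\<^bsub>W\<^esub> g))"
      using assms that by (intro A.finsum_singleton finite_group) auto
    finally show ?thesis .
  qed
  then show ?thesis by (auto simp: smash_mult)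
qed

lemma smash_mult_single_one:
  assumes "f \<in> carrier SG"
  shows "f \<otimes>\<^bsub>SG\<^esub> smash_single W A \<one>\<^bsub>A\<^esub> \<one>\<^bsub>W\<^esub> = f"
proof (rule smash_eqI)
  fix g assume g: "g \<in> carrier W"
  note [simp] = smash_closed[OF assms(1)]
  have "(f \<otimes>\<^bsub>SG\<^esub> smash_single W A \<one>\<^bsub>A\<^esub> \<one>\<^bsub>W\<^esub>) g = (\<Oplus>\<^bsub>A\<^esub>k\<in>carrier W. if g = k then f k else \<zero>\<^bsub>A\<^esub>)"
    unfolding smash_mult using g
    by (simp, intro A.finsum_cong')
      (auto simp: smash_single_def act_unit W.inv_solve_left' W.r_inv dest: sym)
  also have "\<dots> = f g" using g by (intro A.finsum_singleton finite_group) auto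
  finally show "(f \<otimes>\<^bsub>SG\<^esub> smash_single W A \<one>\<^bsub>A\<^esub> \<one>\<^bsub>W\<^esub>) g = f g" .
qed (use assms in \<open>auto intro!: smash_mult_closed\<close>)

theorem smash_ring: "ring SG"
proof (rule ringI)
  show "abelian_group SG"
  proof (rule abelian_groupI)
    fix x assume x: "x \<in> carrier SG"
    show "\<exists>y\<in>carrier SG. y \<oplus>\<^bsub>SG\<^esub> x = \<zero>\<^bsub>SG\<^esub>"
      using x by (intro bexI[of _ "\<lambda>g\<in>carrier W. \<ominus>\<^bsub>A\<^esub> x g"])
        (auto simp: smash_carrier smash_add smash_zero PiE_mem intro!: restrict_ext A.l_neg)
    show "\<zero>\<^bsub>SG\<^esub> \<oplus>\<^bsub>SG\<^esub> x = x"
      using x smash_closed[OF x] by (intro smash_eqI smash_add_closed) (auto simp: smash_carrier smash_add smash_zero)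
  next
    fix x y assume c: "x \<in> carrier SG" "y \<in> carrier SG"
    show "x \<oplus>\<^bsub>SG\<^esub> y = y \<oplus>\<^bsub>SG\<^esub> x"
      using smash_closed[OF c(1)] smash_closed[OF c(2)]
      by (auto simp: smash_add intro!: restrict_ext A.a_comm)
  next
    fix x y z assume c: "x \<in> carrier SG" "y \<in> carrier SG" "z \<in> carrier SG"
    show "x \<oplus>\<^bsub>SG\<^esub> y \<oplus>\<^bsub>SG\<^esub> z = x \<oplus>\<^bsub>SG\<^esub> (y \<oplus>\<^bsub>SG\<^esub> z)"
      using smash_closed[OF c(1)] smash_closed[OF c(2)] smash_closed[OF c(3)]
      by (auto simp: smash_add intro!: restrict_ext A.a_assoc)
  qed (auto simp: smash_add_closed, auto simp: smash_carrier smash_zero)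
  show "Group.monoid SG"
  proof (rule monoidI)
    fix x assume x: "x \<in> carrier SG"
    show "\<one>\<^bsub>SG\<^esub> \<otimes>\<^bsub>SG\<^esub> x = x"
      using x unfolding smash_one
      by (subst smash_single_mult) (auto simp: act_one smash_closed fun_eq_iff smash_carrier PiE_def extensional_def Pi_iff)
    show "x \<otimes>\<^bsub>SG\<^esub> \<one>\<^bsub>SG\<^esub> = x" using x unfolding smash_one by (rule smash_mult_single_one)
  qed (auto simp: smash_mult_closed smash_mult_assoc smash_one)
next
  fix x y z assume c: "x \<in> carrier SG" "y \<in> carrier SG" "z \<in> carrier SG"
  note [simp] = smash_closed[OF c(1)] smash_closed[OF c(2)] smash_closed[OF c(3)]
  show "(x \<oplus>\<^bsub>SG\<^esub> y) \<otimes>\<^bsub>SG\<^esub> z = x \<otimes>\<^bsub>SG\<^esub> z \<oplus>\<^bsub>SG\<^esub> y \<otimes>\<^bsub>SG\<^esub> z"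
    unfolding smash_mult smash_add
    by (rule restrict_ext) (auto simp: A.l_distr Pi_iff simp flip: A.finsum_addf intro!: A.finsum_cong')
  show "z \<otimes>\<^bsub>SG\<^esub> (x \<oplus>\<^bsub>SG\<^esub> y) = z \<otimes>\<^bsub>SG\<^esub> x \<oplus>\<^bsub>SG\<^esub> z \<otimes>\<^bsub>SG\<^esub> y"
    unfolding smash_mult smash_add
    by (rule restrict_ext) (auto simp: A.r_distr act_add Pi_iff simp flip: A.finsum_addf intro!: A.finsum_cong')
qed

sublocale S: ring SG by (rule smash_ring)
sublocale P: UP_ring SG "UP SG" by unfold_locales

lemma smash_finsum:
  assumes "finite I" "\<And>i. i \<in> I \<Longrightarrow> f i \<in> carrier SG" "g \<in> carrier W"
  shows "finsum SG f I g = (\<Oplus>\<^bsub>A\<^esub>i\<in>I. f i g)"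
  using assms(1,2)
proof (induction I)
  case (insert i I)
  then have "finsum SG f I \<in> carrier SG" by (auto intro!: S.finsum_closed)
  then show ?case using insert assms(3)
    by (subst S.finsum_insert) (auto simp: smash_add smash_closed Pi_iff)
qed (simp add: smash_zero assms)

section \<open>Reduction to one-term elements\<close>

lemma smash_decomp:
  assumes "f \<in> carrier SG"
  shows "f = (\<Oplus>\<^bsub>SG\<^esub>h\<in>carrier W. smash_single W A (f h) h)"
proof (rule smash_eqI)
  fix g assume g: "g \<in> carrier W"
  note [simp] = smash_closed[OF assms(1)]
  have "(\<Oplus>\<^bsub>SG\<^esub>h\<in>carrier W. smash_single W A (f h) h) g = (\<Oplus>\<^bsub>A\<^esub>h\<in>carrier W. if g = h then f h else \<zero>\<^bsub>A\<^esub>)"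
    using g by (subst smash_finsum) (simp_all add: finite_group, auto simp: smash_single_def intro!: A.finsum_cong')
  also have "\<dots> = f g" using g by (intro A.finsum_singleton finite_group) auto
  finally show "f g = (\<Oplus>\<^bsub>SG\<^esub>h\<in>carrier W. smash_single W A (f h) h) g" by simp
qed (use assms smash_closed in \<open>auto intro!: S.finsum_closed\<close>)

abbreviation elt :: "'a \<Rightarrow> 'g \<Rightarrow> nat \<Rightarrow> nat \<Rightarrow> 'g \<Rightarrow> 'a" where
  "elt a g n \<equiv> monom (UP SG) (smash_single W A a g) n"

lemma elt_closed [simp]: "a \<in> carrier A \<Longrightarrow> elt a g n \<in> carrier (UP SG)"
  by simp

lemma smash_single_times:
  assumes "a \<in> carrier A" "b \<in> carrier A" "g \<in> carrier W" "h \<in> carrier W"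
  shows "smash_single W A a g \<otimes>\<^bsub>SG\<^esub> smash_single W A b h
    = smash_single W A (a \<otimes>\<^bsub>A\<^esub> act g b) (g \<otimes>\<^bsub>W\<^esub> h)"
  unfolding smash_single_mult[OF assms(1,3) smash_single_closed[OF assms(2)]]
  unfolding smash_single_def
proof (rule restrict_ext)
  fix k assume k: "k \<in> carrier W"
  have "inv\<^bsub>W\<^esub> g \<otimes>\<^bsub>W\<^esub> k = h \<longleftrightarrow> k = g \<otimes>\<^bsub>W\<^esub> h"
    using assms k W.inv_solve_left' by blast
  then show "a \<otimes>\<^bsub>A\<^esub> act g ((\<lambda>k\<in>carrier W. if k = h then b else \<zero>\<^bsub>A\<^esub>) (inv\<^bsub>W\<^esub> g \<otimes>\<^bsub>W\<^esub> k))
    = (if k = g \<otimes>\<^bsub>W\<^esub> h then a \<otimes>\<^bsub>A\<^esub> act g b else \<zero>\<^bsub>A\<^esub>)"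
    using assms k by simp
qed

lemma elt_mult:
  assumes "a \<in> carrier A" "b \<in> carrier A" "g \<in> carrier W" "h \<in> carrier W"
  shows "elt a g n \<otimes>\<^bsub>UP SG\<^esub> elt b h k = elt (a \<otimes>\<^bsub>A\<^esub> act g b) (g \<otimes>\<^bsub>W\<^esub> h) (n + k)"
  using assms by (subst P.monom_mult[symmetric]) (auto simp: smash_single_times)

lemma elt_add:
  assumes "a \<in> carrier A" "b \<in> carrier A"
  shows "elt a g n \<oplus>\<^bsub>UP SG\<^esub> elt b g n = elt (a \<oplus>\<^bsub>A\<^esub> b) g n"
proof -
  have "smash_single W A a g \<oplus>\<^bsub>SG\<^esub> smash_single W A b g = smash_single W A (a \<oplus>\<^bsub>A\<^esub> b) g"
    using assms by (auto simp: smash_add smash_single_def intro!: restrict_ext)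
  then show ?thesis using assms P.monom_add[of "smash_single W A a g" "smash_single W A b g"] by simp
qed

text \<open>Factors a one-term element into a coefficient, a group element and a power of hbar. With
  the coefficient on the left no action intervenes, so what is known on generators propagates by
  multiplicativity.\<close>

lemma elt_factor:
  assumes "a \<in> carrier A" "g \<in> carrier W"
  shows "elt a g n = elt a \<one>\<^bsub>W\<^esub> 0 \<otimes>\<^bsub>UP SG\<^esub> elt \<one>\<^bsub>A\<^esub> g 0 \<otimes>\<^bsub>UP SG\<^esub> elt \<one>\<^bsub>A\<^esub> \<one>\<^bsub>W\<^esub> n"
  using assms by (simp add: elt_mult act_one act_unit)

lemma UP_carrier_coeff: "p \<in> carrier (UP SG) \<Longrightarrow> p k \<in> carrier SG"
  by (auto simp: UP_def)

lemma UP_coeff: "p \<in> carrier (UP SG) \<Longrightarrow> coeff (UP SG) p = p"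
  by (auto simp: UP_def)

lemma smash_minus:
  assumes "f \<in> carrier SG" "f' \<in> carrier SG" "g \<in> carrier W"
  shows "(f \<ominus>\<^bsub>SG\<^esub> f') g = f g \<ominus>\<^bsub>A\<^esub> f' g"
proof -
  have "(f \<ominus>\<^bsub>SG\<^esub> f') \<oplus>\<^bsub>SG\<^esub> f' = f"
    using assms by (simp add: S.minus_eq S.a_assoc S.l_neg)
  then have "(f \<ominus>\<^bsub>SG\<^esub> f') g \<oplus>\<^bsub>A\<^esub> f' g = f g"
    using assms(3) by (metis (mono_tags, lifting) restrict_apply' smash_add)
  moreover have "(f \<ominus>\<^bsub>SG\<^esub> f') g \<in> carrier A" "f g \<in> carrier A" "f' g \<in> carrier A"
    using assms by (auto intro!: smash_closed)
  ultimately show ?thesis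
    by (metis A.add.inv_solve_right A.minus_eq)
qed

lemma elt_apply:
  assumes "a \<in> carrier A"
  shows "elt a g n k = (if k = n then smash_single W A a g else \<zero>\<^bsub>SG\<^esub>)"
  using smash_single_closed[OF assms, of g] by (simp add: UP_def)

text \<open>Induction over one-term elements that carries along a property \<open>X\<close> of all
  coefficients of \<open>p\<close>. Later choices of \<open>X\<close> include a length bound and a
  vanishing symbol, which membership in the carrier does not record.\<close>

lemma smash_UP_induct:
  assumes p: "p \<in> carrier (UP SG)"
    and X: "\<And>k g. g \<in> carrier W \<Longrightarrow> p k g \<in> X" "X \<subseteq> carrier A"
    and zero: "Q \<zero>\<^bsub>UP SG\<^esub>"
    and add: "\<And>x y. x \<in> carrier (UP SG) \<Longrightarrow> y \<in> carrier (UP SG) \<Longrightarrow> Q x \<Longrightarrow> Q y \<Longrightarrow> Q (x \<oplus>\<^bsub>UP SG\<^esub> y)"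
    and elt: "\<And>a g n. a \<in> X \<Longrightarrow> g \<in> carrier W \<Longrightarrow> Q (elt a g n)"
  shows "Q p"
proof -
  have sumQ: "(\<And>i. i \<in> I \<Longrightarrow> f i \<in> carrier (UP SG) \<and> Q (f i)) \<Longrightarrow> Q (finsum (UP SG) f I)"
    if "finite I" for I and f :: "'x \<Rightarrow> _"
    using that
  proof (induction I)
    case (insert i I)
    then show ?case by (subst P.finsum_insert) (auto intro!: add P.finsum_closed)
  qed (simp add: zero)
  have single: "Q (monom (UP SG) s n)" if s: "s \<in> carrier SG" "\<And>g. g \<in> carrier W \<Longrightarrow> s g \<in> X" for s n
  proof -
    have c: "smash_single W A (s h) h \<in> carrier SG" if "h \<in> carrier W" for h
      using s that smash_closed by auto
    have m: "monom (UP SG) (finsum SG f I) n = (\<Oplus>\<^bsub>UP SG\<^esub>h\<in>I. monom (UP SG) (f h) n)"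
      if "finite I" "\<And>h. h \<in> I \<Longrightarrow> f h \<in> carrier SG" for f and I :: "'g set"
      using that
    proof (induction I)
      case (insert i I)
      then show ?case by (subst S.finsum_insert)
        (auto simp: P.finsum_insert Pi_iff S.finsum_closed P.monom_add)
    qed simp
    have "monom (UP SG) s n = (\<Oplus>\<^bsub>UP SG\<^esub>h\<in>carrier W. elt (s h) h n)"
      by (subst smash_decomp[OF s(1)], subst m) (auto simp: finite_group c)
    moreover have "Q \<dots>"
      using s smash_closed by (intro sumQ finite_group conjI P.monom_closed c) (auto intro!: elt)
    ultimately show ?thesis by simp
  qed
  have "p = (\<Oplus>\<^bsub>UP SG\<^esub>i\<in>{..deg SG p}. monom (UP SG) (coeff (UP SG) p i) i)"
    using P.up_repr[OF p] by simp
  moreover have "Q \<dots>"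
    using p X(1) by (intro sumQ) (auto simp: UP_coeff UP_carrier_coeff intro!: single)
  ultimately show ?thesis by simp
qed

end

lemma (in abelian_group) minus_eq_zero_iff:
  "x \<in> carrier G \<Longrightarrow> y \<in> carrier G \<Longrightarrow> x \<ominus> y = \<zero> \<longleftrightarrow> x = y"
  by (metis a_minus_def add.inv_closed add.inv_inv minus_equality r_neg)

section \<open>Symbol maps on filtered rings\<close>

text \<open>The sums that symbols are supposed to span, one representative in each degree. Indexing
  by an initial segment lets two sums be brought to a common range by padding with zeros.\<close>

definition symbol_sums ::
    "(nat \<Rightarrow> 'a set) \<Rightarrow> ('a, 'x) ring_scheme \<Rightarrow> ('b, 'y) ring_scheme \<Rightarrow> (nat \<Rightarrow> 'a \<Rightarrow> 'b) \<Rightarrow> 'b set" where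
  "symbol_sums F R B \<phi> = {b. \<exists>h N. (\<forall>n. h n \<in> F n) \<and> (\<forall>n>N. h n = \<zero>\<^bsub>R\<^esub>) \<and> b = (\<Oplus>\<^bsub>B\<^esub>n\<in>{..(N::nat)}. \<phi> n (h n))}"

text \<open>\<open>\<phi> n\<close> plays the role of the principal symbol \<open>F\<^sub>n \<rightarrow> F\<^sub>n / F\<^bsub>n-1\<^esub> \<rightarrow> B\<close>.\<close>

locale symbol_family = R: ring R + B: ring B
  for R :: "('a, 'x) ring_scheme" and F :: "nat \<Rightarrow> 'a set" and B :: "('b, 'y) ring_scheme"
    and \<phi> :: "nat \<Rightarrow> 'a \<Rightarrow> 'b" +
  assumes F_carrier: "x \<in> F n \<Longrightarrow> x \<in> carrier R"
    and F_zero: "\<zero>\<^bsub>R\<^esub> \<in> F n"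
    and F_minus: "x \<in> F n \<Longrightarrow> y \<in> F n \<Longrightarrow> x \<ominus>\<^bsub>R\<^esub> y \<in> F n"
    and F_Suc: "x \<in> F n \<Longrightarrow> x \<in> F (Suc n)"
    and F_one: "\<one>\<^bsub>R\<^esub> \<in> F 0"
    and F_mult: "x \<in> F k \<Longrightarrow> y \<in> F n \<Longrightarrow> x \<otimes>\<^bsub>R\<^esub> y \<in> F (k + n)"
    and sym_closed: "x \<in> F n \<Longrightarrow> \<phi> n x \<in> carrier B"
    and sym_add: "x \<in> F n \<Longrightarrow> y \<in> F n \<Longrightarrow> \<phi> n (x \<oplus>\<^bsub>R\<^esub> y) = \<phi> n x \<oplus>\<^bsub>B\<^esub> \<phi> n y"
    and sym_one: "\<phi> 0 \<one>\<^bsub>R\<^esub> = \<one>\<^bsub>B\<^esub>"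
    and sym_mult: "x \<in> F k \<Longrightarrow> y \<in> F n \<Longrightarrow> \<phi> (k + n) (x \<otimes>\<^bsub>R\<^esub> y) = \<phi> k x \<otimes>\<^bsub>B\<^esub> \<phi> n y"
    and sym_Suc: "x \<in> F n \<Longrightarrow> \<phi> (Suc n) x = \<zero>\<^bsub>B\<^esub>"
begin

lemma F_neg: "x \<in> F n \<Longrightarrow> \<ominus>\<^bsub>R\<^esub> x \<in> F n"
  using F_minus[OF F_zero] F_carrier by (metis R.minus_eq R.add.inv_closed R.l_zero)

lemma F_add: "x \<in> F n \<Longrightarrow> y \<in> F n \<Longrightarrow> x \<oplus>\<^bsub>R\<^esub> y \<in> F n"
  using F_minus[OF _ F_neg] F_carrier by (metis R.minus_eq R.minus_minus)

lemma sym_zero: "\<phi> n \<zero>\<^bsub>R\<^esub> = \<zero>\<^bsub>B\<^esub>"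
proof -
  have "\<phi> n \<zero>\<^bsub>R\<^esub> \<oplus>\<^bsub>B\<^esub> \<phi> n \<zero>\<^bsub>R\<^esub> = \<phi> n \<zero>\<^bsub>R\<^esub>"
    using sym_add[OF F_zero F_zero] by simp
  then show ?thesis using sym_closed[OF F_zero] B.add.l_cancel_one by blast
qed

lemma sym_neg:
  assumes "x \<in> F n" shows "\<phi> n (\<ominus>\<^bsub>R\<^esub> x) = \<ominus>\<^bsub>B\<^esub> \<phi> n x"
proof -
  have "\<phi> n (\<ominus>\<^bsub>R\<^esub> x) \<oplus>\<^bsub>B\<^esub> \<phi> n x = \<zero>\<^bsub>B\<^esub>"
    using sym_add[OF F_neg[OF assms] assms] assms F_carrier by (simp add: R.l_neg sym_zero)
  then show ?thesis using B.minus_equality sym_closed F_neg assms by metis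
qed

lemma sym_minus: "x \<in> F n \<Longrightarrow> y \<in> F n \<Longrightarrow> \<phi> n (x \<ominus>\<^bsub>R\<^esub> y) = \<phi> n x \<ominus>\<^bsub>B\<^esub> \<phi> n y"
  unfolding R.minus_eq B.minus_eq by (simp add: sym_add F_neg sym_neg)

lemma F_finsum_sym_finsum:
  assumes "finite I" "\<And>i. i \<in> I \<Longrightarrow> x i \<in> F n"
  shows "finsum R x I \<in> F n \<and> \<phi> n (finsum R x I) = (\<Oplus>\<^bsub>B\<^esub>i\<in>I. \<phi> n (x i))"
  using assms
proof (induction I)
  case (insert i I)
  then have "finsum R x (insert i I) = x i \<oplus>\<^bsub>R\<^esub> finsum R x I"
    "(\<Oplus>\<^bsub>B\<^esub>i\<in>insert i I. \<phi> n (x i)) = \<phi> n (x i) \<oplus>\<^bsub>B\<^esub> (\<Oplus>\<^bsub>B\<^esub>i\<in>I. \<phi> n (x i))"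
    by (auto intro!: R.finsum_insert B.finsum_insert intro: F_carrier[of _ n] sym_closed)
  then show ?case using insert by (simp add: F_add sym_add)
qed (simp add: F_zero sym_zero)

lemmas F_finsum = F_finsum_sym_finsum[THEN conjunct1]
  and sym_finsum = F_finsum_sym_finsum[THEN conjunct2]

lemma filt_pred_F: "x \<in> filt_pred R F n \<Longrightarrow> x \<in> F n"
  by (auto simp: filt_pred_def F_zero F_Suc split: nat.splits)

lemma sym_filt_pred: "x \<in> filt_pred R F n \<Longrightarrow> \<phi> n x = \<zero>\<^bsub>B\<^esub>"
  by (auto simp: filt_pred_def sym_zero sym_Suc split: nat.splits)

lemma pred_zero: "\<zero>\<^bsub>R\<^esub> \<in> filt_pred R F n"
  by (simp add: filt_pred_def F_zero split: nat.splits)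

lemma pred_minus: "x \<in> filt_pred R F n \<Longrightarrow> y \<in> filt_pred R F n \<Longrightarrow> x \<ominus>\<^bsub>R\<^esub> y \<in> filt_pred R F n"
  by (cases n) (auto simp: filt_pred_def F_minus, simp add: a_minus_def)

lemma pred_add: "x \<in> filt_pred R F n \<Longrightarrow> y \<in> filt_pred R F n \<Longrightarrow> x \<oplus>\<^bsub>R\<^esub> y \<in> filt_pred R F n"
  by (auto simp: filt_pred_def F_add split: nat.splits)

text \<open>\<open>F_mult\<close> is applied at \<open>n - 1\<close>, which is the true predecessor
  only for positive \<open>n\<close>; at \<open>n = 0\<close> the right factor is zero, and zero
  lies in every \<open>filt_pred\<close>.\<close>

lemma pred_mult_left: "x \<in> F k \<Longrightarrow> y \<in> filt_pred R F n \<Longrightarrow> x \<otimes>\<^bsub>R\<^esub> y \<in> filt_pred R F (k + n)"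
  using F_mult[of x k y "n - 1"] F_carrier[of x k] pred_zero[of "k + n"]
  by (cases n) (auto simp: filt_pred_def)

lemma pred_mult_right: "x \<in> filt_pred R F n \<Longrightarrow> y \<in> F k \<Longrightarrow> x \<otimes>\<^bsub>R\<^esub> y \<in> filt_pred R F (n + k)"
  using F_mult[of x "n - 1" y k] F_carrier[of y k] pred_zero[of "n + k"]
  by (cases n) (auto simp: filt_pred_def)

lemma F_pred_Suc: "x \<in> F n \<Longrightarrow> x \<in> filt_pred R F (Suc n)"
  by (simp add: filt_pred_def)

lemma symbol_sums_single:
  assumes x: "x \<in> F d" shows "\<phi> d x \<in> symbol_sums F R B \<phi>"
proof -
  have "(\<Oplus>\<^bsub>B\<^esub>n\<in>{..d}. \<phi> n (if n = d then x else \<zero>\<^bsub>R\<^esub>)) = (\<Oplus>\<^bsub>B\<^esub>n\<in>{..d}. if d = n then \<phi> d x else \<zero>\<^bsub>B\<^esub>)"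
    using x by (intro B.finsum_cong') (auto simp: sym_zero sym_closed)
  also have "\<dots> = \<phi> d x"
    using sym_closed[OF x] B.finsum_singleton[of d "{..d}" "\<lambda>_. \<phi> d x"] by simp
  finally show ?thesis
    unfolding symbol_sums_def
    by (intro CollectI exI[of _ "\<lambda>n. if n = d then x else \<zero>\<^bsub>R\<^esub>"] exI[of _ d]) (simp add: x F_zero)
qed

lemma symbol_sums_add:
  assumes "a \<in> symbol_sums F R B \<phi>" "b \<in> symbol_sums F R B \<phi>"
  shows "a \<oplus>\<^bsub>B\<^esub> b \<in> symbol_sums F R B \<phi>"
proof -
  obtain h N where h: "\<forall>n. h n \<in> F n" "\<forall>n>N. h n = \<zero>\<^bsub>R\<^esub>" "a = (\<Oplus>\<^bsub>B\<^esub>n\<in>{..N}. \<phi> n (h n))"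
    using assms(1) by (auto simp: symbol_sums_def)
  obtain h' M where h': "\<forall>n. h' n \<in> F n" "\<forall>n>M. h' n = \<zero>\<^bsub>R\<^esub>" "b = (\<Oplus>\<^bsub>B\<^esub>n\<in>{..M}. \<phi> n (h' n))"
    using assms(2) by (auto simp: symbol_sums_def)
  \<comment> \<open>Lengthening the range is harmless because the added representatives are zero and
    \<open>\<phi> n\<close> sends zero to zero.\<close>
  have ext: "(\<Oplus>\<^bsub>B\<^esub>n\<in>{..K}. \<phi> n (f n)) = (\<Oplus>\<^bsub>B\<^esub>n\<in>{..L}. \<phi> n (f n))"
    if "\<forall>n. f n \<in> F n" "\<forall>n>K. f n = \<zero>\<^bsub>R\<^esub>" "K \<le> L" for f K L
    using that by (intro B.add.finprod_mono_neutral_cong_left) (auto simp: sym_zero sym_closed)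
  have "a \<oplus>\<^bsub>B\<^esub> b = (\<Oplus>\<^bsub>B\<^esub>n\<in>{..max N M}. \<phi> n (h n)) \<oplus>\<^bsub>B\<^esub> (\<Oplus>\<^bsub>B\<^esub>n\<in>{..max N M}. \<phi> n (h' n))"
    unfolding h(3) h'(3) ext[OF h(1,2) max.cobounded1[of N M]] ext[OF h'(1,2) max.cobounded2[of M N]] ..
  also have "\<dots> = (\<Oplus>\<^bsub>B\<^esub>n\<in>{..max N M}. \<phi> n (h n) \<oplus>\<^bsub>B\<^esub> \<phi> n (h' n))"
    using h h' by (intro B.finsum_addf[symmetric]) (auto simp: sym_closed)
  also have "\<dots> = (\<Oplus>\<^bsub>B\<^esub>n\<in>{..max N M}. \<phi> n (h n \<oplus>\<^bsub>R\<^esub> h' n))"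
    using h h' by (simp add: sym_add)
  finally show ?thesis
    unfolding symbol_sums_def using h h'
    by (intro CollectI exI[of _ "\<lambda>n. h n \<oplus>\<^bsub>R\<^esub> h' n"] exI[of _ "max N M"]) (simp add: F_add)
qed

end

text \<open>Skew multiplication twists the second factor by the group, so a symbol passes through
  the convolution once the action preserves each \<open>F n\<close> and the symbol intertwines the
  two actions.\<close>

lemma symbol_family_smash:
  assumes "skew_group_ring W actA A" "skew_group_ring W actB B" "symbol_family A F B \<phi>"
    and equiv: "\<And>g x n. g \<in> carrier W \<Longrightarrow> x \<in> F n \<Longrightarrow> actA g x \<in> F n"
      "\<And>g x n. g \<in> carrier W \<Longrightarrow> x \<in> F n \<Longrightarrow> \<phi> n (actA g x) = actB g (\<phi> n x)"
  shows "symbol_family (smash_product W actA A) (\<lambda>n. carrier W \<rightarrow>\<^sub>E F n)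
    (smash_product W actB B) (\<lambda>n f. \<lambda>g\<in>carrier W. \<phi> n (f g))"
proof -
  interpret symbol_family A F B \<phi> by fact
  interpret SA: skew_group_ring W actA A by fact
  interpret SB: skew_group_ring W actB B by fact
  show ?thesis
  proof (rule symbol_family.intro[OF SA.smash_ring SB.smash_ring], unfold_locales)
    show c: "x \<in> carrier SA.SG" if "x \<in> carrier W \<rightarrow>\<^sub>E F n" for x n
      using that by (auto simp: SA.smash_carrier PiE_def Pi_iff F_carrier)
    fix x y n k assume x: "x \<in> carrier W \<rightarrow>\<^sub>E F n" and y: "y \<in> carrier W \<rightarrow>\<^sub>E F k"
    have xF: "g \<in> carrier W \<Longrightarrow> x g \<in> F n" and yF: "g \<in> carrier W \<Longrightarrow> y g \<in> F k" for g
      using x y by auto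
    have m: "h \<in> carrier W \<Longrightarrow> g \<in> carrier W \<Longrightarrow>
       x h \<otimes>\<^bsub>A\<^esub> actA h (y (inv\<^bsub>W\<^esub> h \<otimes>\<^bsub>W\<^esub> g)) \<in> F (n + k) \<and>
       \<phi> (n + k) (x h \<otimes>\<^bsub>A\<^esub> actA h (y (inv\<^bsub>W\<^esub> h \<otimes>\<^bsub>W\<^esub> g))) =
       \<phi> n (x h) \<otimes>\<^bsub>B\<^esub> actB h (\<phi> k (y (inv\<^bsub>W\<^esub> h \<otimes>\<^bsub>W\<^esub> g)))" for h g
      by (simp add: xF yF equiv F_mult sym_mult)
    show "x \<otimes>\<^bsub>SA.SG\<^esub> y \<in> carrier W \<rightarrow>\<^sub>E F (n + k)"
      unfolding SA.smash_mult using m SA.finite_group by (auto intro!: F_finsum)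
    show "(\<lambda>g\<in>carrier W. \<phi> (n + k) ((x \<otimes>\<^bsub>SA.SG\<^esub> y) g)) =
       (\<lambda>g\<in>carrier W. \<phi> n (x g)) \<otimes>\<^bsub>SB.SG\<^esub> (\<lambda>g\<in>carrier W. \<phi> k (y g))"
      unfolding SA.smash_mult SB.smash_mult
    proof (rule restrict_ext)
      fix g assume g: "g \<in> carrier W"
      have "\<phi> (n + k) (\<Oplus>\<^bsub>A\<^esub>h\<in>carrier W. x h \<otimes>\<^bsub>A\<^esub> actA h (y (inv\<^bsub>W\<^esub> h \<otimes>\<^bsub>W\<^esub> g)))
        = (\<Oplus>\<^bsub>B\<^esub>h\<in>carrier W. \<phi> (n + k) (x h \<otimes>\<^bsub>A\<^esub> actA h (y (inv\<^bsub>W\<^esub> h \<otimes>\<^bsub>W\<^esub> g))))"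
        using m g SA.finite_group by (intro sym_finsum) auto
      also have "\<dots> = (\<Oplus>\<^bsub>B\<^esub>h\<in>carrier W. \<phi> n (x h) \<otimes>\<^bsub>B\<^esub> actB h (\<phi> k (y (inv\<^bsub>W\<^esub> h \<otimes>\<^bsub>W\<^esub> g))))"
        using m g xF yF by (intro B.finsum_cong') (auto simp: sym_closed)
      finally show "\<phi> (n + k) ((\<lambda>g\<in>carrier W. \<Oplus>\<^bsub>A\<^esub>h\<in>carrier W. x h \<otimes>\<^bsub>A\<^esub> actA h (y (inv\<^bsub>W\<^esub> h \<otimes>\<^bsub>W\<^esub> g))) g)
        = (\<Oplus>\<^bsub>B\<^esub>h\<in>carrier W. (\<lambda>g\<in>carrier W. \<phi> n (x g)) h \<otimes>\<^bsub>B\<^esub> actB h ((\<lambda>g\<in>carrier W. \<phi> k (y g)) (inv\<^bsub>W\<^esub> h \<otimes>\<^bsub>W\<^esub> g)))"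
        using g by (simp cong: B.finsum_cong) (intro B.finsum_cong', auto simp: xF yF sym_closed)
    qed
  next
    fix x y n assume x: "x \<in> carrier W \<rightarrow>\<^sub>E F n" and y: "y \<in> carrier W \<rightarrow>\<^sub>E F n"
    have xF: "g \<in> carrier W \<Longrightarrow> x g \<in> F n" and yF: "g \<in> carrier W \<Longrightarrow> y g \<in> F n" for g
      using x y by auto
    have xc: "x \<in> carrier SA.SG" "y \<in> carrier SA.SG"
      using xF yF x y by (auto simp: SA.smash_carrier PiE_def Pi_iff intro: F_carrier[of _ n])
    have "x \<ominus>\<^bsub>SA.SG\<^esub> y \<in> carrier SA.SG" using xc by (rule SA.S.minus_closed)
    then show "x \<ominus>\<^bsub>SA.SG\<^esub> y \<in> carrier W \<rightarrow>\<^sub>E F n"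
      using SA.smash_minus[OF xc] xF yF by (auto simp: SA.smash_carrier PiE_def Pi_iff F_minus)
    show "x \<in> carrier W \<rightarrow>\<^sub>E F (Suc n)" using x by (auto simp: PiE_def Pi_iff F_Suc)
    show "(\<lambda>g\<in>carrier W. \<phi> n (x g)) \<in> carrier SB.SG"
      using xF by (auto simp: SB.smash_carrier sym_closed)
    show "(\<lambda>g\<in>carrier W. \<phi> n ((x \<oplus>\<^bsub>SA.SG\<^esub> y) g)) =
       (\<lambda>g\<in>carrier W. \<phi> n (x g)) \<oplus>\<^bsub>SB.SG\<^esub> (\<lambda>g\<in>carrier W. \<phi> n (y g))"
      using xF yF by (auto simp: SA.smash_add SB.smash_add sym_add intro!: restrict_ext)
    show "(\<lambda>g\<in>carrier W. \<phi> (Suc n) (x g)) = \<zero>\<^bsub>SB.SG\<^esub>"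
      using xF by (auto simp: SB.smash_zero sym_Suc intro!: restrict_ext)
  next
    show "\<zero>\<^bsub>SA.SG\<^esub> \<in> carrier W \<rightarrow>\<^sub>E F n" for n by (auto simp: SA.smash_zero F_zero)
    show "\<one>\<^bsub>SA.SG\<^esub> \<in> carrier W \<rightarrow>\<^sub>E F 0"
      by (auto simp: SA.smash_one smash_single_def F_zero F_one)
    show "(\<lambda>g\<in>carrier W. \<phi> 0 (\<one>\<^bsub>SA.SG\<^esub> g)) = \<one>\<^bsub>SB.SG\<^esub>"
      by (auto simp: SA.smash_one SB.smash_one smash_single_def sym_one sym_zero intro!: restrict_ext)
  qed
qed

text \<open>Every coefficient is required to lie in the same \<open>F n\<close>, with no shift by
  its index: this is how hbar comes to have degree 0.\<close>

lemma symbol_family_UP: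
  assumes "symbol_family A F B \<phi>"
  shows "symbol_family (UP A) (\<lambda>n. {p \<in> carrier (UP A). \<forall>k. p k \<in> F n})
    (UP B) (\<lambda>n p k. \<phi> n (p k))"
proof -
  interpret symbol_family A F B \<phi> by fact
  interpret PA: UP_ring A "UP A" by unfold_locales
  interpret PB: UP_ring B "UP B" by unfold_locales
  have ca: "p \<in> carrier (UP A) \<longleftrightarrow> p \<in> up A" "p' \<in> carrier (UP B) \<longleftrightarrow> p' \<in> up B" for p p'
    by (simp_all add: UP_def)
  have up: "(\<lambda>k. \<phi> n (p k)) \<in> up B" if "p \<in> up A" "\<forall>k. p k \<in> F n" for p n
  proof -
    obtain N where "bound \<zero>\<^bsub>A\<^esub> N p" using \<open>p \<in> up A\<close> by (auto simp: up_def)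
    then have "bound \<zero>\<^bsub>B\<^esub> N (\<lambda>k. \<phi> n (p k))"
      by (auto simp: bound_def sym_zero)
    moreover have "\<phi> n (p k) \<in> carrier B" for k using that(2) sym_closed by simp
    ultimately show ?thesis by (intro mem_upI exI)
  qed
  have minus: "(p \<ominus>\<^bsub>UP A\<^esub> q) k = p k \<ominus>\<^bsub>A\<^esub> q k" if "p \<in> carrier (UP A)" "q \<in> carrier (UP A)" for p q k
  proof -
    have c: "coeff (UP A) r = r" if "r \<in> carrier (UP A)" for r
      using that by (auto simp: UP_def)
    have "coeff (UP A) (p \<ominus>\<^bsub>UP A\<^esub> q) k = coeff (UP A) p k \<ominus>\<^bsub>A\<^esub> coeff (UP A) q k"
      unfolding a_minus_def using that by (subst PA.coeff_add) auto
    moreover have "p \<ominus>\<^bsub>UP A\<^esub> q \<in> carrier (UP A)" using that by (rule PA.minus_closed)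
    ultimately show ?thesis unfolding c[OF that(1)] c[OF that(2)] using c by metis
  qed
  show ?thesis
  proof (rule symbol_family.intro[OF PA.UP_ring PB.UP_ring], unfold_locales)
    fix x y n k assume "x \<in> {p \<in> carrier (UP A). \<forall>k. p k \<in> F n}" "y \<in> {p \<in> carrier (UP A). \<forall>j. p j \<in> F k}"
    then have x: "x \<in> up A" "\<And>j. x j \<in> F n" and y: "y \<in> up A" "\<And>j. y j \<in> F k"
      by (auto simp: ca)
    have m: "(x \<otimes>\<^bsub>UP A\<^esub> y) j = (\<Oplus>\<^bsub>A\<^esub>i\<in>{..j}. x i \<otimes>\<^bsub>A\<^esub> y (j - i))" for j
      using x y by (simp add: UP_def)
    have "x \<otimes>\<^bsub>UP A\<^esub> y \<in> carrier (UP A)" using x y by (intro PA.UP_mult_closed) (simp_all add: ca)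
    then show "x \<otimes>\<^bsub>UP A\<^esub> y \<in> {p \<in> carrier (UP A). \<forall>j. p j \<in> F (n + k)}"
      by (auto simp: m x y intro!: F_finsum F_mult)
    have "(\<lambda>j. \<phi> n (x j)) \<otimes>\<^bsub>UP B\<^esub> (\<lambda>j. \<phi> k (y j)) = (\<lambda>j. \<Oplus>\<^bsub>B\<^esub>i\<in>{..j}. \<phi> n (x i) \<otimes>\<^bsub>B\<^esub> \<phi> k (y (j - i)))"
      using up x y by (simp add: UP_def)
    also have "\<dots> = (\<lambda>j. \<phi> (n + k) ((x \<otimes>\<^bsub>UP A\<^esub> y) j))"
      unfolding m by (subst sym_finsum) (auto simp: x y F_mult sym_mult)
    finally show "(\<lambda>j. \<phi> (n + k) ((x \<otimes>\<^bsub>UP A\<^esub> y) j)) = (\<lambda>j. \<phi> n (x j)) \<otimes>\<^bsub>UP B\<^esub> (\<lambda>j. \<phi> k (y j))" ..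
  next
    fix x y n assume "x \<in> {p \<in> carrier (UP A). \<forall>k. p k \<in> F n}" "y \<in> {p \<in> carrier (UP A). \<forall>j. p j \<in> F n}"
    then have x: "x \<in> up A" "\<And>j. x j \<in> F n" and y: "y \<in> up A" "\<And>j. y j \<in> F n"
      by (auto simp: ca)
    have "x \<ominus>\<^bsub>UP A\<^esub> y \<in> carrier (UP A)" using x y by (intro PA.minus_closed) (simp_all add: ca)
    then show "x \<ominus>\<^bsub>UP A\<^esub> y \<in> {p \<in> carrier (UP A). \<forall>j. p j \<in> F n}"
      using x y by (auto simp: minus ca F_minus)
    show "x \<in> {p \<in> carrier (UP A). \<forall>j. p j \<in> F (Suc n)}" using x by (auto simp: ca F_Suc)
    show "(\<lambda>j. \<phi> n (x j)) \<in> carrier (UP B)" using x up by (simp add: ca)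
    show "(\<lambda>j. \<phi> (Suc n) (x j)) = \<zero>\<^bsub>UP B\<^esub>" using x by (simp add: UP_def sym_Suc)
    show "(\<lambda>j. \<phi> n ((x \<oplus>\<^bsub>UP A\<^esub> y) j)) = (\<lambda>j. \<phi> n (x j)) \<oplus>\<^bsub>UP B\<^esub> (\<lambda>j. \<phi> n (y j))"
      using x y up by (simp add: UP_def sym_add)
  next
    show "\<zero>\<^bsub>UP A\<^esub> \<in> {p \<in> carrier (UP A). \<forall>j. p j \<in> F n}" for n
      using PA.UP_zero_closed by (auto simp: F_zero UP_def)
    show "\<one>\<^bsub>UP A\<^esub> \<in> {p \<in> carrier (UP A). \<forall>j. p j \<in> F 0}"
      using PA.UP_one_closed by (auto simp: F_zero F_one UP_def)
    show "(\<lambda>k. \<phi> 0 (\<one>\<^bsub>UP A\<^esub> k)) = \<one>\<^bsub>UP B\<^esub>"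
      by (auto simp: UP_def sym_one sym_zero)
  qed auto
qed

text \<open>Evaluates \<open>\<phi> n\<close> on some representative of the coset lying in
  \<open>F n\<close>. Independence of the choice is not automatic; it holds once the symbols vanish
  on the ideal.\<close>

definition quotient_symbol ::
    "('a, 'x) ring_scheme \<Rightarrow> 'a set \<Rightarrow> (nat \<Rightarrow> 'a set) \<Rightarrow> (nat \<Rightarrow> 'a \<Rightarrow> 'b) \<Rightarrow> nat \<Rightarrow> 'a set \<Rightarrow> 'b" where
  "quotient_symbol R I F \<phi> n X = \<phi> n (SOME x. x \<in> F n \<and> X = I +>\<^bsub>R\<^esub> x)"

text \<open>Two representatives in \<open>F n\<close> of one coset differ by an element of
  \<open>F n\<close> that lies in \<open>I\<close>, so vanishing of \<open>\<phi> n\<close> there is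
  exactly what makes the symbol well defined. For the Cherednik algebra this hypothesis is the hard
  part, supplied by the Dunkl operators.\<close>

lemma (in symbol_family) quotient_symbol:
  assumes "ideal I R" and I: "\<And>n x. x \<in> F n \<Longrightarrow> x \<in> I \<Longrightarrow> \<phi> n x = \<zero>\<^bsub>B\<^esub>"
  shows "symbol_family (R Quot I) (\<lambda>n. (+>\<^bsub>R\<^esub>) I ` F n) B (quotient_symbol R I F \<phi>)"
    and "x \<in> F n \<Longrightarrow> quotient_symbol R I F \<phi> n (I +>\<^bsub>R\<^esub> x) = \<phi> n x"
proof -
  interpret I: ideal I R by fact
  interpret hom: ring_hom_ring R "R Quot I" "(+>\<^bsub>R\<^esub>) I" by (rule I.rcos_ring_hom_ring)
  show q: "quotient_symbol R I F \<phi> n (I +>\<^bsub>R\<^esub> x) = \<phi> n x" if x: "x \<in> F n" for x n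
  proof -
    define y where "y = (SOME y. y \<in> F n \<and> I +>\<^bsub>R\<^esub> x = I +>\<^bsub>R\<^esub> y)"
    have y: "y \<in> F n \<and> I +>\<^bsub>R\<^esub> x = I +>\<^bsub>R\<^esub> y"
      unfolding y_def using x by (intro someI) auto
    then have "x \<ominus>\<^bsub>R\<^esub> y \<in> I"
      using R.quotient_eq_iff_same_a_r_cos[OF assms(1)] x F_carrier by blast
    then have "\<phi> n x \<ominus>\<^bsub>B\<^esub> \<phi> n y = \<zero>\<^bsub>B\<^esub>"
      using I[of "x \<ominus>\<^bsub>R\<^esub> y" n] x y by (simp add: F_minus sym_minus)
    then have "\<phi> n x = \<phi> n y" using x y sym_closed by (simp add: B.minus_eq_zero_iff)
    then show ?thesis by (simp add: quotient_symbol_def y_def)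
  qed
  note [simp] = F_carrier
  show "symbol_family (R Quot I) (\<lambda>n. (+>\<^bsub>R\<^esub>) I ` F n) B (quotient_symbol R I F \<phi>)"
  proof (rule symbol_family.intro[OF I.quotient_is_ring B.ring_axioms], unfold_locales)
    show "\<zero>\<^bsub>R Quot I\<^esub> \<in> (+>\<^bsub>R\<^esub>) I ` F n" for n using F_zero hom.hom_zero by (metis imageI)
    show "\<one>\<^bsub>R Quot I\<^esub> \<in> (+>\<^bsub>R\<^esub>) I ` F 0" using F_one hom.hom_one by (metis imageI)
    show "quotient_symbol R I F \<phi> 0 \<one>\<^bsub>R Quot I\<^esub> = \<one>\<^bsub>B\<^esub>"
      using q[OF F_one] hom.hom_one sym_one by simp
    fix X Y n k assume "X \<in> (+>\<^bsub>R\<^esub>) I ` F n" "Y \<in> (+>\<^bsub>R\<^esub>) I ` F k"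
    then obtain x y where xy: "x \<in> F n" "X = I +>\<^bsub>R\<^esub> x" "y \<in> F k" "Y = I +>\<^bsub>R\<^esub> y" by auto
    then have m: "X \<otimes>\<^bsub>R Quot I\<^esub> Y = I +>\<^bsub>R\<^esub> (x \<otimes>\<^bsub>R\<^esub> y)" by (metis hom.hom_mult F_carrier)
    show "X \<otimes>\<^bsub>R Quot I\<^esub> Y \<in> (+>\<^bsub>R\<^esub>) I ` F (n + k)" unfolding m using xy F_mult by blast
    show "quotient_symbol R I F \<phi> (n + k) (X \<otimes>\<^bsub>R Quot I\<^esub> Y)
      = quotient_symbol R I F \<phi> n X \<otimes>\<^bsub>B\<^esub> quotient_symbol R I F \<phi> k Y"
      unfolding m using xy by (simp add: q F_mult sym_mult del: hom.hom_mult)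
  next
    fix X n assume "X \<in> (+>\<^bsub>R\<^esub>) I ` F n"
    then obtain x where x: "x \<in> F n" "X = I +>\<^bsub>R\<^esub> x" by auto
    show "X \<in> carrier (R Quot I)" using x hom.hom_closed F_carrier by blast
    show "X \<in> (+>\<^bsub>R\<^esub>) I ` F (Suc n)" using x F_Suc by blast
    show "quotient_symbol R I F \<phi> n X \<in> carrier B" using x by (simp add: q sym_closed)
    show "quotient_symbol R I F \<phi> (Suc n) X = \<zero>\<^bsub>B\<^esub>" using x by (simp add: q sym_Suc F_Suc)
    fix Y assume "Y \<in> (+>\<^bsub>R\<^esub>) I ` F n"
    then obtain y where y: "y \<in> F n" "Y = I +>\<^bsub>R\<^esub> y" by auto
    have a: "X \<oplus>\<^bsub>R Quot I\<^esub> Y = I +>\<^bsub>R\<^esub> (x \<oplus>\<^bsub>R\<^esub> y)" using x y by (metis hom.hom_add F_carrier)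
    have b: "X \<ominus>\<^bsub>R Quot I\<^esub> Y = I +>\<^bsub>R\<^esub> (x \<ominus>\<^bsub>R\<^esub> y)"
      using x y F_carrier by (simp add: a_minus_def hom.hom_add[symmetric] hom.hom_a_inv[symmetric] del: hom.hom_add hom.hom_a_inv)
    show "quotient_symbol R I F \<phi> n (X \<oplus>\<^bsub>R Quot I\<^esub> Y)
      = quotient_symbol R I F \<phi> n X \<oplus>\<^bsub>B\<^esub> quotient_symbol R I F \<phi> n Y"
      unfolding a using x y by (simp add: q F_add sym_add del: hom.hom_add)
    show "X \<ominus>\<^bsub>R Quot I\<^esub> Y \<in> (+>\<^bsub>R\<^esub>) I ` F n" unfolding b using x y F_minus by blast
  qed
qed

section \<open>Associated graded rings\<close>

text \<open>Elements of the associated graded ring are handled through sequences of representatives;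
  those with \<open>c n\<close> in \<open>F n\<close> and only finitely many nonzero terms yield all
  of them.\<close>

definition coset_family :: "('a, 'x) ring_scheme \<Rightarrow> (nat \<Rightarrow> 'a set) \<Rightarrow> (nat \<Rightarrow> 'a) \<Rightarrow> nat \<Rightarrow> 'a set" where
  "coset_family R F c = (\<lambda>n. filt_pred R F n +>\<^bsub>R\<^esub> c n)"

definition graded_symbol_sum ::
    "('a, 'x) ring_scheme \<Rightarrow> (nat \<Rightarrow> 'a set) \<Rightarrow> ('b, 'y) ring_scheme \<Rightarrow> (nat \<Rightarrow> 'a \<Rightarrow> 'b)
      \<Rightarrow> (nat \<Rightarrow> 'a set) \<Rightarrow> 'b" where
  "graded_symbol_sum R F B \<phi> C = (\<Oplus>\<^bsub>B\<^esub>n\<in>{n. C n \<noteq> filt_pred R F n}. \<phi> n (SOME a. a \<in> C n))"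

text \<open>\<open>\<phi> n\<close> identifies \<open>F\<^sub>n / F\<^bsub>n-1\<^esub>\<close> with a subgroup of \<open>B\<close>, and \<open>B\<close> is the direct sum of
  these subgroups.\<close>

locale graded_symbol_family = symbol_family R F B \<phi>
  for R :: "('a, 'x) ring_scheme" and F :: "nat \<Rightarrow> 'a set" and B :: "('b, 'y) ring_scheme"
    and \<phi> :: "nat \<Rightarrow> 'a \<Rightarrow> 'b" +
  assumes kernel: "x \<in> F n \<Longrightarrow> \<phi> n x = \<zero>\<^bsub>B\<^esub> \<Longrightarrow> x \<in> filt_pred R F n"
    and span: "b \<in> carrier B \<Longrightarrow>
      \<exists>h N. (\<forall>n. h n \<in> F n) \<and> (\<forall>n>N. h n = \<zero>\<^bsub>R\<^esub>) \<and> b = (\<Oplus>\<^bsub>B\<^esub>n\<in>{..N}. \<phi> n (h n))"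
    and indep: "(\<And>n. h n \<in> F n) \<Longrightarrow> (\<Oplus>\<^bsub>B\<^esub>n\<in>{..N}. \<phi> n (h n)) = \<zero>\<^bsub>B\<^esub> \<Longrightarrow> n \<le> N
      \<Longrightarrow> \<phi> n (h n) = \<zero>\<^bsub>B\<^esub>"
begin

abbreviation "Gr \<equiv> assoc_graded R F"
abbreviation "pred \<equiv> filt_pred R F"
abbreviation "cosets \<equiv> coset_family R F"
abbreviation "gr_symbol \<equiv> graded_symbol_sum R F B \<phi>"

lemma kernel_iff: "x \<in> F n \<Longrightarrow> \<phi> n x = \<zero>\<^bsub>B\<^esub> \<longleftrightarrow> x \<in> pred n"
  using kernel sym_filt_pred by blast

lemma pred_subgroup: "abelian_subgroup (pred n) R"
proof (rule abelian_subgroupI3[OF _ R.abelian_group_axioms], unfold_locales)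
  show "pred n \<subseteq> carrier (add_monoid R)" using filt_pred_F F_carrier by auto
  show "\<one>\<^bsub>add_monoid R\<^esub> \<in> pred n" using kernel_iff[OF F_zero] sym_zero by simp
  fix x y assume x: "x \<in> pred n" and y: "y \<in> pred n"
  show "x \<otimes>\<^bsub>add_monoid R\<^esub> y \<in> pred n"
    using x y kernel[of "x \<oplus>\<^bsub>R\<^esub> y" n] by (simp add: filt_pred_F F_add sym_add sym_filt_pred)
  show "inv\<^bsub>add_monoid R\<^esub> x \<in> pred n"
    using x kernel[of "\<ominus>\<^bsub>R\<^esub> x" n] by (simp add: filt_pred_F F_neg sym_neg sym_filt_pred a_inv_def[symmetric])
qed

lemma coset_mem:
  assumes "x \<in> F n" "y \<in> pred n +>\<^bsub>R\<^esub> x"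
  shows "y \<in> F n \<and> \<phi> n y = \<phi> n x"
proof -
  obtain h where h: "h \<in> pred n" "y = h \<oplus>\<^bsub>R\<^esub> x" using assms(2) by (auto simp: a_r_coset_def')
  then show ?thesis using assms(1) by (simp add: filt_pred_F F_add sym_add sym_filt_pred sym_closed)
qed

text \<open>Since \<open>\<phi> n\<close> has kernel exactly the previous filtration step, equality
  of classes can be tested in \<open>B\<close>; the arithmetic of the graded ring is done through
  this test.\<close>

lemma coset_eq_iff:
  assumes "x \<in> F n" "y \<in> F n"
  shows "pred n +>\<^bsub>R\<^esub> x = pred n +>\<^bsub>R\<^esub> y \<longleftrightarrow> \<phi> n x = \<phi> n y"
proof
  interpret P: abelian_subgroup "pred n" R by (rule pred_subgroup)
  have c [simp]: "x \<in> carrier R" "y \<in> carrier R" using assms F_carrier by auto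
  show "\<phi> n x = \<phi> n y" if "pred n +>\<^bsub>R\<^esub> x = pred n +>\<^bsub>R\<^esub> y"
    using coset_mem[OF assms(2), of x] P.a_rcos_self[of x] that by simp
  assume "\<phi> n x = \<phi> n y"
  then have "\<phi> n (x \<ominus>\<^bsub>R\<^esub> y) = \<zero>\<^bsub>B\<^esub>" using assms sym_closed by (simp add: sym_minus B.minus_eq_zero_iff)
  then have "x \<ominus>\<^bsub>R\<^esub> y \<in> pred n" using kernel assms F_minus by blast
  then have "x \<in> pred n +>\<^bsub>R\<^esub> y" using P.a_rcos_module_minus[OF R.ring_axioms, of y x] by simp
  then show "pred n +>\<^bsub>R\<^esub> x = pred n +>\<^bsub>R\<^esub> y"
    by (rule P.a_repr_independence'[symmetric]) simp
qed

lemma coset_zero: "pred n +>\<^bsub>R\<^esub> \<zero>\<^bsub>R\<^esub> = pred n"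
proof (rule R.a_coset_add_zero, rule subsetI)
  fix x assume "x \<in> pred n"
  then show "x \<in> carrier R" by (rule F_carrier[OF filt_pred_F])
qed

lemma coset_eq_pred: "x \<in> F n \<Longrightarrow> pred n +>\<^bsub>R\<^esub> x = pred n \<longleftrightarrow> \<phi> n x = \<zero>\<^bsub>B\<^esub>"
  using coset_eq_iff[OF _ F_zero] by (simp add: coset_zero sym_zero)

lemma cosets_closed:
  assumes "\<And>n. c n \<in> F n" "\<And>n. n > N \<Longrightarrow> c n = \<zero>\<^bsub>R\<^esub>"
  shows "cosets c \<in> carrier Gr"
proof -
  have "{n. cosets c n \<noteq> pred n} \<subseteq> {..N}"
    using assms(2) by (auto simp: coset_family_def coset_zero not_less[symmetric])
  then have "finite {n. cosets c n \<noteq> pred n}" by (rule finite_subset) simp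
  then show ?thesis
    using assms(1) by (auto simp: assoc_graded_def coset_family_def)
qed

lemma cosets_exhaust:
  assumes "C \<in> carrier Gr"
  obtains c N where "\<And>n. c n \<in> F n" "\<And>n. n > N \<Longrightarrow> c n = \<zero>\<^bsub>R\<^esub>" "C = cosets c"
proof -
  have C: "\<forall>n. \<exists>a\<in>F n. C n = pred n +>\<^bsub>R\<^esub> a" "finite {n. C n \<noteq> pred n}"
    using assms by (auto simp: assoc_graded_def)
  then obtain a where a: "\<And>n. a n \<in> F n" "\<And>n. C n = pred n +>\<^bsub>R\<^esub> a n" by metis
  obtain N where N: "{n. C n \<noteq> pred n} \<subseteq> {..N}" using finite_nat_iff_bounded_le C(2) by auto
  show ?thesis
  \<comment> \<open>Past \<open>N\<close> the class is trivial, so zero is an admissible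
    representative; finite support then holds for representatives and not only for classes.\<close>
  proof (rule that[of "\<lambda>n. if n > N then \<zero>\<^bsub>R\<^esub> else a n" N])
    show "C = cosets (\<lambda>n. if n > N then \<zero>\<^bsub>R\<^esub> else a n)"
      using N a(2) by (auto simp: coset_family_def coset_zero fun_eq_iff)
  qed (auto simp: a F_zero)
qed

lemma cosets_self: "c n \<in> F n \<Longrightarrow> c n \<in> cosets c n"
  unfolding coset_family_def by (rule abelian_subgroup.a_rcos_self[OF pred_subgroup F_carrier])

lemma gr_symbol_cosets:
  assumes "\<And>n. c n \<in> F n" "\<And>n. n > N \<Longrightarrow> c n = \<zero>\<^bsub>R\<^esub>"
  shows "gr_symbol (cosets c) = (\<Oplus>\<^bsub>B\<^esub>n\<in>{..N}. \<phi> n (c n))"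
proof -
  have "\<phi> n (SOME a. a \<in> cosets c n) = \<phi> n (c n)" for n
  proof -
    have "c n \<in> cosets c n" by (rule cosets_self[OF assms(1)])
    then have "(SOME a. a \<in> cosets c n) \<in> cosets c n" by (rule someI)
    then show ?thesis using coset_mem[OF assms(1)] by (auto simp: coset_family_def)
  qed
  then have "gr_symbol (cosets c) = (\<Oplus>\<^bsub>B\<^esub>n\<in>{n. cosets c n \<noteq> pred n}. \<phi> n (c n))"
    by (simp add: graded_symbol_sum_def)
  also have "\<dots> = (\<Oplus>\<^bsub>B\<^esub>n\<in>{..N}. \<phi> n (c n))"
    using assms by (intro B.add.finprod_mono_neutral_cong_left)
      (auto simp: coset_family_def coset_zero coset_eq_pred sym_closed sym_zero not_less[symmetric])
  finally show ?thesis .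
qed

lemma cosets_add:
  assumes "\<And>n. c n \<in> F n" "\<And>n. d n \<in> F n"
  shows "cosets c \<oplus>\<^bsub>Gr\<^esub> cosets d = cosets (\<lambda>n. c n \<oplus>\<^bsub>R\<^esub> d n)"
  using abelian_subgroup.a_rcos_sum[OF pred_subgroup F_carrier[OF assms(1)] F_carrier[OF assms(2)]]
  by (auto simp: assoc_graded_def coset_family_def fun_eq_iff)

text \<open>The product in \<open>assoc_graded\<close> is a union over all choices of
  representatives. It collapses to one coset because the symbol of a convolution depends only on the
  symbols of the factors.\<close>

lemma cosets_mult:
  assumes c: "\<And>n. c n \<in> F n" and d: "\<And>n. d n \<in> F n"
  shows "cosets c \<otimes>\<^bsub>Gr\<^esub> cosets d = cosets (\<lambda>n. \<Oplus>\<^bsub>R\<^esub>k\<in>{..n}. c k \<otimes>\<^bsub>R\<^esub> d (n - k))"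
proof
  fix n
  have self: "c n \<in> cosets c n" "d n \<in> cosets d n" for n
    by (rule cosets_self[OF c], rule cosets_self[OF d])
  have prodF: "(\<Oplus>\<^bsub>R\<^esub>k\<in>{..n}. a k \<otimes>\<^bsub>R\<^esub> b (n - k)) \<in> F n \<and>
      \<phi> n (\<Oplus>\<^bsub>R\<^esub>k\<in>{..n}. a k \<otimes>\<^bsub>R\<^esub> b (n - k)) = (\<Oplus>\<^bsub>B\<^esub>k\<in>{..n}. \<phi> k (a k) \<otimes>\<^bsub>B\<^esub> \<phi> (n - k) (b (n - k)))"
    if a: "\<And>k. a k \<in> F k" and b: "\<And>k. b k \<in> F k" for a b
  proof -
    have m: "a k \<otimes>\<^bsub>R\<^esub> b (n - k) \<in> F n \<and> \<phi> n (a k \<otimes>\<^bsub>R\<^esub> b (n - k)) = \<phi> k (a k) \<otimes>\<^bsub>B\<^esub> \<phi> (n - k) (b (n - k))"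
      if "k \<le> n" for k
      using F_mult[OF a[of k] b[of "n - k"]] sym_mult[OF a[of k] b[of "n - k"]] that by simp
    show ?thesis
      using F_finsum_sym_finsum[of "{..n}" "\<lambda>k. a k \<otimes>\<^bsub>R\<^esub> b (n - k)" n] m a b
      by (auto simp: sym_closed intro!: B.finsum_cong')
  qed
  have "pred n +>\<^bsub>R\<^esub> (\<Oplus>\<^bsub>R\<^esub>k\<in>{..n}. a k \<otimes>\<^bsub>R\<^esub> b (n - k)) = pred n +>\<^bsub>R\<^esub> (\<Oplus>\<^bsub>R\<^esub>k\<in>{..n}. c k \<otimes>\<^bsub>R\<^esub> d (n - k))"
    if a: "a \<in> (\<Pi> k\<in>UNIV. cosets c k)" and b: "b \<in> (\<Pi> k\<in>UNIV. cosets d k)" for a b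
  proof -
    have "a k \<in> F k \<and> \<phi> k (a k) = \<phi> k (c k)" "b k \<in> F k \<and> \<phi> k (b k) = \<phi> k (d k)" for k
      using a b coset_mem[OF c, of "a k" k] coset_mem[OF d, of "b k" k]
      by (auto simp: coset_family_def Pi_iff)
    then show ?thesis using prodF[of a b] prodF[of c d] c d by (subst coset_eq_iff) auto
  qed
  \<comment> \<open>Nonemptiness matters: a union of equal cosets over an empty family of choices
    would be empty.\<close>
  moreover have "(\<Pi> k\<in>UNIV. cosets c k) \<noteq> {}" "(\<Pi> k\<in>UNIV. cosets d k) \<noteq> {}"
    using self by (auto simp: Pi_eq_empty)
  ultimately show "(cosets c \<otimes>\<^bsub>Gr\<^esub> cosets d) n = cosets (\<lambda>n. \<Oplus>\<^bsub>R\<^esub>k\<in>{..n}. c k \<otimes>\<^bsub>R\<^esub> d (n - k)) n"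
    by (simp add: assoc_graded_def coset_family_def)
qed

lemma cosets_one: "\<one>\<^bsub>Gr\<^esub> = cosets (\<lambda>n. if n = 0 then \<one>\<^bsub>R\<^esub> else \<zero>\<^bsub>R\<^esub>)"
  by (rule ext) (simp add: assoc_graded_def coset_family_def coset_zero)

lemma convolution_closed:
  assumes "\<And>n. c n \<in> F n" "\<And>n. n > N \<Longrightarrow> c n = \<zero>\<^bsub>R\<^esub>" "\<And>n. d n \<in> F n" "\<And>n. n > M \<Longrightarrow> d n = \<zero>\<^bsub>R\<^esub>"
  shows "(\<Oplus>\<^bsub>R\<^esub>k\<in>{..n}. c k \<otimes>\<^bsub>R\<^esub> d (n - k)) \<in> F n"
    and "\<phi> n (\<Oplus>\<^bsub>R\<^esub>k\<in>{..n}. c k \<otimes>\<^bsub>R\<^esub> d (n - k)) = (\<Oplus>\<^bsub>B\<^esub>k\<in>{..n}. \<phi> k (c k) \<otimes>\<^bsub>B\<^esub> \<phi> (n - k) (d (n - k)))"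
    and "n > N + M \<Longrightarrow> (\<Oplus>\<^bsub>R\<^esub>k\<in>{..n}. c k \<otimes>\<^bsub>R\<^esub> d (n - k)) = \<zero>\<^bsub>R\<^esub>"
proof -
  have m: "c k \<otimes>\<^bsub>R\<^esub> d (n - k) \<in> F n \<and> \<phi> n (c k \<otimes>\<^bsub>R\<^esub> d (n - k)) = \<phi> k (c k) \<otimes>\<^bsub>B\<^esub> \<phi> (n - k) (d (n - k))"
    if "k \<le> n" for k
    using F_mult[OF assms(1)[of k] assms(3)[of "n - k"]] sym_mult[OF assms(1)[of k] assms(3)[of "n - k"]] that by simp
  show "(\<Oplus>\<^bsub>R\<^esub>k\<in>{..n}. c k \<otimes>\<^bsub>R\<^esub> d (n - k)) \<in> F n"
    and "\<phi> n (\<Oplus>\<^bsub>R\<^esub>k\<in>{..n}. c k \<otimes>\<^bsub>R\<^esub> d (n - k)) = (\<Oplus>\<^bsub>B\<^esub>k\<in>{..n}. \<phi> k (c k) \<otimes>\<^bsub>B\<^esub> \<phi> (n - k) (d (n - k)))"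
    using F_finsum_sym_finsum[of "{..n}" "\<lambda>k. c k \<otimes>\<^bsub>R\<^esub> d (n - k)" n] m assms(1,3)
    by (auto simp: sym_closed intro!: B.finsum_cong')
  assume n: "n > N + M"
  have "c k \<otimes>\<^bsub>R\<^esub> d (n - k) = \<zero>\<^bsub>R\<^esub>" if "k \<le> n" for k
    using assms(2,4) n F_carrier[OF assms(1)] F_carrier[OF assms(3)] by (cases "k > N") auto
  then show "(\<Oplus>\<^bsub>R\<^esub>k\<in>{..n}. c k \<otimes>\<^bsub>R\<^esub> d (n - k)) = \<zero>\<^bsub>R\<^esub>"
    by (intro R.add.finprod_one_eqI) auto
qed

lemma gr_closed:
  "\<one>\<^bsub>Gr\<^esub> \<in> carrier Gr"
  "C \<in> carrier Gr \<Longrightarrow> D \<in> carrier Gr \<Longrightarrow> C \<otimes>\<^bsub>Gr\<^esub> D \<in> carrier Gr"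
  "C \<in> carrier Gr \<Longrightarrow> D \<in> carrier Gr \<Longrightarrow> C \<oplus>\<^bsub>Gr\<^esub> D \<in> carrier Gr"
proof -
  show "\<one>\<^bsub>Gr\<^esub> \<in> carrier Gr"
    unfolding cosets_one by (rule cosets_closed[of _ 0]) (auto simp: F_one F_zero)
  assume "C \<in> carrier Gr" "D \<in> carrier Gr"
  then obtain c N d M where c: "\<And>n. c n \<in> F n" "\<And>n. n > N \<Longrightarrow> c n = \<zero>\<^bsub>R\<^esub>" "C = cosets c"
    and d: "\<And>n. d n \<in> F n" "\<And>n. n > M \<Longrightarrow> d n = \<zero>\<^bsub>R\<^esub>" "D = cosets d"
    by (metis cosets_exhaust)
  show "C \<otimes>\<^bsub>Gr\<^esub> D \<in> carrier Gr"
    unfolding c(3) d(3) cosets_mult[OF c(1) d(1)]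
    using convolution_closed[OF c(1,2) d(1,2)] by (intro cosets_closed[of _ "N + M"]) auto
  show "C \<oplus>\<^bsub>Gr\<^esub> D \<in> carrier Gr"
    unfolding c(3) d(3) cosets_add[OF c(1) d(1)]
    by (intro cosets_closed[of _ "max N M"]) (auto simp: c d F_add)
qed

text \<open>Multiplicativity is the Cauchy product of two finite sums of symbols, regrouped by total
  degree. Injectivity comes from \<open>indep\<close> together with \<open>kernel\<close>, and
  surjectivity from \<open>span\<close>.\<close>

lemma gr_symbol_iso: "gr_symbol \<in> ring_iso Gr B"
proof (rule ring_iso_memI)
  show "gr_symbol \<one>\<^bsub>Gr\<^esub> = \<one>\<^bsub>B\<^esub>"
    unfolding cosets_one by (subst gr_symbol_cosets[of _ 0]) (auto simp: F_one F_zero sym_one)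
  fix C D assume C: "C \<in> carrier Gr" and "D \<in> carrier Gr"
  then obtain c N d M where c: "\<And>n. c n \<in> F n" "\<And>n. n > N \<Longrightarrow> c n = \<zero>\<^bsub>R\<^esub>" "C = cosets c"
    and d: "\<And>n. d n \<in> F n" "\<And>n. n > M \<Longrightarrow> d n = \<zero>\<^bsub>R\<^esub>" "D = cosets d"
    by (metis cosets_exhaust)
  note conv = convolution_closed[OF c(1,2) d(1,2)]
  have "gr_symbol (C \<otimes>\<^bsub>Gr\<^esub> D)
    = (\<Oplus>\<^bsub>B\<^esub>n\<in>{..N + M}. \<phi> n (\<Oplus>\<^bsub>R\<^esub>k\<in>{..n}. c k \<otimes>\<^bsub>R\<^esub> d (n - k)))"
    unfolding c(3) d(3) cosets_mult[OF c(1) d(1)] using conv(1,3) by (intro gr_symbol_cosets)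
  also have "\<dots> = (\<Oplus>\<^bsub>B\<^esub>n\<in>{..N + M}. \<Oplus>\<^bsub>B\<^esub>k\<in>{..n}. \<phi> k (c k) \<otimes>\<^bsub>B\<^esub> \<phi> (n - k) (d (n - k)))"
    using conv(2) by simp
  also have "\<dots> = (\<Oplus>\<^bsub>B\<^esub>n\<in>{..N}. \<phi> n (c n)) \<otimes>\<^bsub>B\<^esub> (\<Oplus>\<^bsub>B\<^esub>n\<in>{..M}. \<phi> n (d n))"
    using c d by (intro B.cauchy_product) (auto simp: sym_zero sym_closed)
  also have "\<dots> = gr_symbol C \<otimes>\<^bsub>B\<^esub> gr_symbol D"
    using c d gr_symbol_cosets[OF c(1,2)] gr_symbol_cosets[OF d(1,2)] by simp
  finally show "gr_symbol (C \<otimes>\<^bsub>Gr\<^esub> D) = gr_symbol C \<otimes>\<^bsub>B\<^esub> gr_symbol D" .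
  have bnd: "n > max N M \<Longrightarrow> c n = \<zero>\<^bsub>R\<^esub>" "n > max N M \<Longrightarrow> d n = \<zero>\<^bsub>R\<^esub>" for n
    using c d by auto
  have "gr_symbol (C \<oplus>\<^bsub>Gr\<^esub> D) = (\<Oplus>\<^bsub>B\<^esub>n\<in>{..max N M}. \<phi> n (c n \<oplus>\<^bsub>R\<^esub> d n))"
    unfolding c(3) d(3) cosets_add[OF c(1) d(1)]
    by (rule gr_symbol_cosets) (auto simp: c d F_add)
  also have "\<dots> = (\<Oplus>\<^bsub>B\<^esub>n\<in>{..max N M}. \<phi> n (c n)) \<oplus>\<^bsub>B\<^esub> (\<Oplus>\<^bsub>B\<^esub>n\<in>{..max N M}. \<phi> n (d n))"
    by (subst B.finsum_addf[symmetric]) (auto simp: c d sym_add sym_closed)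
  also have "\<dots> = gr_symbol C \<oplus>\<^bsub>B\<^esub> gr_symbol D"
    unfolding c(3) d(3) gr_symbol_cosets[where N="max N M", OF c(1) bnd(1), simplified]
      gr_symbol_cosets[where N="max N M", OF d(1) bnd(2), simplified] ..
  finally show "gr_symbol (C \<oplus>\<^bsub>Gr\<^esub> D) = gr_symbol C \<oplus>\<^bsub>B\<^esub> gr_symbol D" .
  show "gr_symbol C \<in> carrier B"
    unfolding c(3) gr_symbol_cosets[where N=N, OF c(1,2), simplified] by (intro B.finsum_closed funcsetI sym_closed c(1))
next
  show "bij_betw gr_symbol (carrier Gr) (carrier B)"
  proof (rule bij_betw_imageI)
    show "inj_on gr_symbol (carrier Gr)"
    proof (rule inj_onI)
      fix C D assume "C \<in> carrier Gr" "D \<in> carrier Gr" and eq: "gr_symbol C = gr_symbol D"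
      then obtain c N d M where c: "\<And>n. c n \<in> F n" "\<And>n. n > N \<Longrightarrow> c n = \<zero>\<^bsub>R\<^esub>" "C = cosets c"
        and d: "\<And>n. d n \<in> F n" "\<And>n. n > M \<Longrightarrow> d n = \<zero>\<^bsub>R\<^esub>" "D = cosets d"
        by (metis cosets_exhaust)
      have bnd: "n > max N M \<Longrightarrow> c n = \<zero>\<^bsub>R\<^esub>" "n > max N M \<Longrightarrow> d n = \<zero>\<^bsub>R\<^esub>" for n
        using c d by auto
      have cl: "\<phi> n (c n) \<in> carrier B" "\<phi> n (d n) \<in> carrier B" for n using c d sym_closed by auto
      \<comment> \<open>\<open>indep\<close> speaks of vanishing sums only, so equality of two
        symbol sums is first turned into a vanishing sum of symbols of differences.\<close>
      have add: "(\<Oplus>\<^bsub>B\<^esub>n\<in>{..max N M}. \<phi> n (c n \<ominus>\<^bsub>R\<^esub> d n)) \<oplus>\<^bsub>B\<^esub> (\<Oplus>\<^bsub>B\<^esub>n\<in>{..max N M}. \<phi> n (d n))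
        = (\<Oplus>\<^bsub>B\<^esub>n\<in>{..max N M}. \<phi> n (c n))"
        by (subst B.finsum_addf[symmetric])
          (auto simp: c d sym_minus F_minus sym_closed cl B.minus_eq B.a_assoc B.l_neg intro!: B.finsum_cong')
      have "(\<Oplus>\<^bsub>B\<^esub>n\<in>{..max N M}. \<phi> n (d n)) = (\<Oplus>\<^bsub>B\<^esub>n\<in>{..max N M}. \<phi> n (c n))"
        using eq unfolding c(3) d(3) gr_symbol_cosets[where N="max N M", OF c(1) bnd(1), simplified]
          gr_symbol_cosets[where N="max N M", OF d(1) bnd(2), simplified] by simp
      moreover have "(\<Oplus>\<^bsub>B\<^esub>n\<in>{..max N M}. \<phi> n (c n \<ominus>\<^bsub>R\<^esub> d n)) \<in> carrier B"
        "(\<Oplus>\<^bsub>B\<^esub>n\<in>{..max N M}. \<phi> n (d n)) \<in> carrier B"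
        by (intro B.finsum_closed funcsetI sym_closed F_minus c(1) d(1))+
      ultimately have 0: "(\<Oplus>\<^bsub>B\<^esub>n\<in>{..max N M}. \<phi> n (c n \<ominus>\<^bsub>R\<^esub> d n)) = \<zero>\<^bsub>B\<^esub>"
        using add B.add.r_cancel_one by (metis (no_types, lifting))
      have "\<phi> n (c n) = \<phi> n (d n)" for n
      proof (cases "n \<le> max N M")
        case True
        have "\<phi> n (c n \<ominus>\<^bsub>R\<^esub> d n) = \<zero>\<^bsub>B\<^esub>"
          using indep[OF _ 0 True] c d F_minus by blast
        then show ?thesis using c d cl by (simp add: sym_minus B.minus_eq_zero_iff)
      qed (simp add: bnd not_le)
      then show "C = D" using c d coset_eq_iff by (auto simp: coset_family_def fun_eq_iff)
    qed
    show "gr_symbol ` carrier Gr = carrier B"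
    proof (intro equalityI subsetI)
      fix b assume "b \<in> gr_symbol ` carrier Gr"
      then obtain C where "C \<in> carrier Gr" "b = gr_symbol C" by auto
      then obtain c N where c: "\<And>n. c n \<in> F n" "\<And>n. n > N \<Longrightarrow> c n = \<zero>\<^bsub>R\<^esub>" "b = gr_symbol (cosets c)"
        by (metis cosets_exhaust)
      then show "b \<in> carrier B"
        using gr_symbol_cosets[OF c(1,2)] by (auto intro!: B.finsum_closed sym_closed)
    next
      fix b assume "b \<in> carrier B"
      then obtain h N where h: "\<And>n. h n \<in> F n" "\<And>n. n > N \<Longrightarrow> h n = \<zero>\<^bsub>R\<^esub>" "b = (\<Oplus>\<^bsub>B\<^esub>n\<in>{..N}. \<phi> n (h n))"
        using span by blast
      then have "b = gr_symbol (cosets h)" using gr_symbol_cosets[OF h(1,2)] by simp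
      then show "b \<in> gr_symbol ` carrier Gr" using cosets_closed[OF h(1,2)] by blast
    qed
  qed
qed

lemma graded_symbol_cosets: "graded_symbol R F d a = cosets (\<lambda>n. if n = d then a else \<zero>\<^bsub>R\<^esub>)"
  by (rule ext) (simp add: graded_symbol_def coset_family_def coset_zero)

lemma graded_symbol_closed: "a \<in> F d \<Longrightarrow> graded_symbol R F d a \<in> carrier Gr"
  unfolding graded_symbol_cosets by (rule cosets_closed[of _ d]) (auto simp: F_zero)

lemma gr_symbol_graded_symbol:
  assumes "a \<in> F d" shows "gr_symbol (graded_symbol R F d a) = \<phi> d a"
proof -
  have "gr_symbol (graded_symbol R F d a) = (\<Oplus>\<^bsub>B\<^esub>n\<in>{..d}. \<phi> n (if n = d then a else \<zero>\<^bsub>R\<^esub>))"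
    unfolding graded_symbol_cosets using assms by (intro gr_symbol_cosets) (auto simp: F_zero)
  also have "\<dots> = (\<Oplus>\<^bsub>B\<^esub>n\<in>{..d}. if d = n then \<phi> d a else \<zero>\<^bsub>B\<^esub>)"
    using assms by (intro B.finsum_cong') (auto simp: sym_zero sym_closed)
  also have "\<dots> = \<phi> d a"
    using sym_closed[OF assms] B.finsum_singleton[of d "{..d}" "\<lambda>_. \<phi> d a"] by simp
  finally show ?thesis .
qed

text \<open>Each law is checked after applying the injective \<open>gr_symbol\<close>, for which
  closure of the carrier of \<open>Gr\<close> under the operations suffices.\<close>

lemma inverse_gr_symbol_hom: "inv_into (carrier Gr) gr_symbol \<in> ring_hom B Gr"
proof -
  have bij: "bij_betw gr_symbol (carrier Gr) (carrier B)" and hom: "gr_symbol \<in> ring_hom Gr B"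
    using gr_symbol_iso by (auto simp: ring_iso_def)
  let ?i = "inv_into (carrier Gr) gr_symbol"
  have i: "?i b \<in> carrier Gr" "gr_symbol (?i b) = b" if "b \<in> carrier B" for b
    using that bij by (auto simp: bij_betw_def inv_into_into f_inv_into_f)
  have inj: "C = D" if "C \<in> carrier Gr" "D \<in> carrier Gr" "gr_symbol C = gr_symbol D" for C D
    using that bij by (auto simp: bij_betw_def inj_on_def)
  show ?thesis
    by (rule ring_hom_memI)
      (auto simp: i gr_closed ring_hom_mult[OF hom] ring_hom_add[OF hom] ring_hom_one[OF hom]
        intro!: inj)
qed

text \<open>A section of a bijection is its inverse. Bijectivity of a given \<open>\<xi>\<close> is
  thereby reduced to \<open>gr_symbol\<close> after \<open>\<xi>\<close> being the identity, which
  can be tested on generators.\<close>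

lemma ring_iso_of_section:
  assumes "\<xi> \<in> ring_hom B Gr" "\<And>b. b \<in> carrier B \<Longrightarrow> gr_symbol (\<xi> b) = b"
  shows "\<xi> \<in> ring_iso B Gr"
proof -
  have bij: "bij_betw gr_symbol (carrier Gr) (carrier B)"
    using gr_symbol_iso by (auto simp: ring_iso_def)
  have cl: "b \<in> carrier B \<Longrightarrow> \<xi> b \<in> carrier Gr" for b using assms(1) ring_hom_closed by metis
  have gc: "C \<in> carrier Gr \<Longrightarrow> gr_symbol C \<in> carrier B" for C using bij by (auto simp: bij_betw_def)
  have "\<xi> (gr_symbol C) = C" if "C \<in> carrier Gr" for C
    using that bij assms(2)[OF gc] cl[OF gc] by (auto simp: bij_betw_def inj_on_def)
  then have "bij_betw \<xi> (carrier B) (carrier Gr)"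
    using assms(2) cl gc by (intro bij_betw_byWitness[where f'=gr_symbol]) auto
  then show ?thesis using assms(1) by (simp add: ring_iso_def)
qed

end

section \<open>Tensor algebras\<close>

text \<open>A tensor is determined by the linear functionals \<open>w \<mapsto> F w\<close> on the word basis; in terms of
  these the ring structure becomes concatenation of words.\<close>

definition word_sum :: "('b list \<Rightarrow> complex) \<Rightarrow> ('b list \<Rightarrow> complex) \<Rightarrow> complex" where
  "word_sum t F = (\<Sum>w | t w \<noteq> 0. t w * F w)"

definition tensor_word :: "complex \<Rightarrow> 'b list \<Rightarrow> 'b list \<Rightarrow> complex" where
  "tensor_word k u = (\<lambda>w. if w = u then k else 0)"

lemma tensor_carrier: "t \<in> carrier tensor_algebra \<longleftrightarrow> finite {w. t w \<noteq> 0}"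
  and tensor_add: "t \<oplus>\<^bsub>tensor_algebra\<^esub> t' = (\<lambda>w. t w + t' w)"
  and tensor_zero: "\<zero>\<^bsub>tensor_algebra\<^esub> = (\<lambda>w. 0)"
  and tensor_one: "\<one>\<^bsub>tensor_algebra\<^esub> = tensor_word 1 []"
  by (simp_all add: tensor_algebra_def tensor_word_def)

lemma word_sum_superset:
  assumes "finite A" "{w. t w \<noteq> 0} \<subseteq> A"
  shows "word_sum t F = (\<Sum>w\<in>A. t w * F w)"
  unfolding word_sum_def using assms by (intro sum.mono_neutral_left) auto

lemma word_sum_cong: "(\<And>w. t w \<noteq> 0 \<Longrightarrow> F w = F' w) \<Longrightarrow> word_sum t F = word_sum t F'"
  by (simp add: word_sum_def)

lemma word_sum_delta: "t \<in> carrier tensor_algebra \<Longrightarrow> word_sum t (\<lambda>w. if w = u then 1 else 0) = t u"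
  by (simp add: word_sum_def tensor_carrier if_distrib cong: if_cong)

lemma tensor_eqI: "t \<in> carrier tensor_algebra \<Longrightarrow> t' \<in> carrier tensor_algebra \<Longrightarrow>
    (\<And>F. word_sum t F = word_sum t' F) \<Longrightarrow> t = t'"
  by (rule ext) (metis word_sum_delta)

lemma word_sum_add:
  assumes "t \<in> carrier tensor_algebra" "t' \<in> carrier tensor_algebra"
  shows "word_sum (\<lambda>w. t w + t' w) F = word_sum t F + word_sum t' F"
proof -
  let ?A = "{w. t w \<noteq> 0} \<union> {w. t' w \<noteq> 0}"
  have fin: "finite ?A" using assms by (simp add: tensor_carrier)
  show ?thesis
    by (subst (1 2 3) word_sum_superset[OF fin]) (auto simp: algebra_simps sum.distrib)
qed

lemma word_sum_zero [simp]: "word_sum (\<lambda>w. 0) F = 0"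
  by (simp add: word_sum_def)

lemma word_sum_word [simp]: "word_sum (tensor_word k u) F = k * F u"
  by (subst word_sum_superset[of "{u}"]) (auto simp: tensor_word_def split: if_splits)

lemma tensor_word_closed [simp]: "tensor_word k u \<in> carrier tensor_algebra"
  unfolding tensor_carrier by (rule finite_subset[of _ "{u}"]) (auto simp: tensor_word_def)

lemma word_sum_func_add: "word_sum t (\<lambda>w. F w + F' w) = word_sum t F + word_sum t F'"
  and word_sum_func_scale: "word_sum t (\<lambda>w. c * F w) = c * word_sum t F"
  and word_sum_func_zero [simp]: "word_sum t (\<lambda>w. 0) = 0"
  by (simp_all add: word_sum_def algebra_simps sum.distrib sum_distrib_left)

text \<open>Replaces the cut positions of \<open>w\<close>, which depend on \<open>w\<close>, by
  pairs of support words, an index set common to all \<open>w\<close>; this permits exchanging sums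
  in \<open>word_sum_mult\<close>. Both index sets sit in their union, where the extra terms
  vanish.\<close>

lemma tensor_mult_pairs:
  assumes "t \<in> carrier tensor_algebra" "t' \<in> carrier tensor_algebra"
  shows "(t \<otimes>\<^bsub>tensor_algebra\<^esub> t') w
    = (\<Sum>(u, u')\<in>{w. t w \<noteq> 0} \<times> {w. t' w \<noteq> 0}. if u @ u' = w then t u * t' u' else 0)"
proof -
  let ?S = "{w. t w \<noteq> 0} \<times> {w. t' w \<noteq> 0}"
  let ?P = "(\<lambda>k. (take k w, drop k w)) ` {..length w}"
  have fin: "finite ?S" using assms by (simp add: tensor_carrier)
  have P: "p \<in> ?P" if "fst p @ snd p = w" for p
    using that by (intro image_eqI[of _ _ "length (fst p)"]) auto
  have inj: "inj_on (\<lambda>k. (take k w, drop k w)) {..length w}"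
    by (rule inj_onI) (metis atMost_iff length_take min.absorb2 prod.inject)
  have "(t \<otimes>\<^bsub>tensor_algebra\<^esub> t') w = (\<Sum>k\<le>length w. t (take k w) * t' (drop k w))"
    by (simp add: tensor_algebra_def)
  also have "\<dots> = (\<Sum>(u, u')\<in>?P. t u * t' u')"
    by (subst sum.reindex[OF inj]) (simp add: o_def)
  also have "\<dots> = (\<Sum>(u, u')\<in>?P. if u @ u' = w then t u * t' u' else 0)"
    by (intro sum.cong) auto
  also have "\<dots> = (\<Sum>(u, u')\<in>?P \<union> ?S. if u @ u' = w then t u * t' u' else 0)"
    using fin P by (intro sum.mono_neutral_left) (auto split: if_splits)
  also have "\<dots> = (\<Sum>(u, u')\<in>?S. if u @ u' = w then t u * t' u' else 0)"
    using fin by (intro sum.mono_neutral_right) (auto split: if_splits)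
  finally show ?thesis .
qed

lemma tensor_mult_support:
  assumes "t \<in> carrier tensor_algebra" "t' \<in> carrier tensor_algebra"
    and "(t \<otimes>\<^bsub>tensor_algebra\<^esub> t') w \<noteq> 0"
  shows "\<exists>u u'. t u \<noteq> 0 \<and> t' u' \<noteq> 0 \<and> w = u @ u'"
proof -
  obtain p where "p \<in> {w. t w \<noteq> 0} \<times> {w. t' w \<noteq> 0}"
    "(case p of (u, u') \<Rightarrow> if u @ u' = w then t u * t' u' else 0) \<noteq> 0"
    using assms(3) unfolding tensor_mult_pairs[OF assms(1,2)] by (rule sum.not_neutral_contains_not_neutral)
  then show ?thesis by (cases p) (auto split: if_splits)
qed

lemma tensor_mult_closed:
  assumes "t \<in> carrier tensor_algebra" "t' \<in> carrier tensor_algebra"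
  shows "t \<otimes>\<^bsub>tensor_algebra\<^esub> t' \<in> carrier tensor_algebra"
proof -
  have "{w. (t \<otimes>\<^bsub>tensor_algebra\<^esub> t') w \<noteq> 0} \<subseteq> (\<lambda>(u, u'). u @ u') ` ({w. t w \<noteq> 0} \<times> {w. t' w \<noteq> 0})"
    by (auto simp: image_iff dest!: tensor_mult_support[OF assms])
  from finite_subset[OF this] show ?thesis using assms by (simp add: tensor_carrier)
qed

lemma word_sum_mult:
  assumes "t \<in> carrier tensor_algebra" "t' \<in> carrier tensor_algebra"
  shows "word_sum (t \<otimes>\<^bsub>tensor_algebra\<^esub> t') F = word_sum t (\<lambda>u. word_sum t' (\<lambda>u'. F (u @ u')))"
proof -
  let ?S = "{w. t w \<noteq> 0} \<times> {w. t' w \<noteq> 0}"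
  let ?A = "(\<lambda>(u, u'). u @ u') ` ?S"
  have fin: "finite ?S" using assms by (simp add: tensor_carrier)
  have "word_sum (t \<otimes>\<^bsub>tensor_algebra\<^esub> t') F = (\<Sum>w\<in>?A. (t \<otimes>\<^bsub>tensor_algebra\<^esub> t') w * F w)"
    using fin by (intro word_sum_superset) (auto simp: image_iff dest!: tensor_mult_support[OF assms])
  also have "\<dots> = (\<Sum>w\<in>?A. \<Sum>p\<in>?S. if fst p @ snd p = w then t (fst p) * t' (snd p) * F w else 0)"
    by (auto simp: tensor_mult_pairs[OF assms] sum_distrib_right case_prod_unfold intro!: sum.cong)
  also have "\<dots> = (\<Sum>p\<in>?S. \<Sum>w\<in>?A. if fst p @ snd p = w then t (fst p) * t' (snd p) * F w else 0)"
    by (rule sum.swap)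
  also have "\<dots> = (\<Sum>p\<in>?S. t (fst p) * t' (snd p) * F (fst p @ snd p))"
  proof (rule sum.cong[OF HOL.refl])
    fix p assume "p \<in> ?S"
    then have "fst p @ snd p \<in> ?A" by (intro image_eqI[of _ _ p]) (simp_all add: case_prod_unfold)
    then show "(\<Sum>w\<in>?A. if fst p @ snd p = w then t (fst p) * t' (snd p) * F w else 0)
      = t (fst p) * t' (snd p) * F (fst p @ snd p)"
      using fin by (subst sum.delta') simp_all
  qed
  also have "\<dots> = word_sum t (\<lambda>u. word_sum t' (\<lambda>u'. F (u @ u')))"
    by (simp add: word_sum_def sum_distrib_left sum.cartesian_product case_prod_unfold mult.assoc)
  finally show ?thesis .
qed

lemma tensor_ring: "ring (tensor_algebra :: ('b list \<Rightarrow> complex) ring)"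
proof (rule ringI)
  let ?T = "tensor_algebra :: ('b list \<Rightarrow> complex) ring"
  have add: "t \<oplus>\<^bsub>?T\<^esub> t' \<in> carrier ?T" if "t \<in> carrier ?T" "t' \<in> carrier ?T" for t t'
    unfolding tensor_add tensor_carrier
    by (rule finite_subset[of _ "{w. t w \<noteq> 0} \<union> {w. t' w \<noteq> 0}"])
      (use that in \<open>auto simp: tensor_carrier\<close>)
  show "abelian_group ?T"
  proof (rule abelian_groupI)
    fix t assume "t \<in> carrier ?T"
    then show "\<exists>y\<in>carrier ?T. y \<oplus>\<^bsub>?T\<^esub> t = \<zero>\<^bsub>?T\<^esub>"
      by (intro bexI[of _ "\<lambda>w. - t w"]) (auto simp: tensor_carrier tensor_add tensor_zero)
  qed (auto simp: add, auto simp: tensor_carrier tensor_add tensor_zero algebra_simps)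
  show "Group.monoid ?T"
    by (rule monoidI)
      (auto simp: tensor_mult_closed tensor_one word_sum_mult intro!: tensor_eqI)
  fix x y z assume c: "x \<in> carrier ?T" "y \<in> carrier ?T" "z \<in> carrier ?T"
  show "(x \<oplus>\<^bsub>?T\<^esub> y) \<otimes>\<^bsub>?T\<^esub> z = x \<otimes>\<^bsub>?T\<^esub> z \<oplus>\<^bsub>?T\<^esub> y \<otimes>\<^bsub>?T\<^esub> z"
    using c add[OF c(1,2)]
    by (intro tensor_eqI add tensor_mult_closed)
      (simp_all add: word_sum_mult tensor_mult_closed, simp_all add: tensor_add word_sum_add tensor_mult_closed word_sum_mult)
  show "z \<otimes>\<^bsub>?T\<^esub> (x \<oplus>\<^bsub>?T\<^esub> y) = z \<otimes>\<^bsub>?T\<^esub> x \<oplus>\<^bsub>?T\<^esub> z \<otimes>\<^bsub>?T\<^esub> y"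
    using c add[OF c(1,2)]
    by (intro tensor_eqI add tensor_mult_closed)
      (simp_all add: word_sum_mult tensor_mult_closed, simp_all add: tensor_add word_sum_add tensor_mult_closed word_sum_mult word_sum_func_add)
qed

lemma tensor_minus:
  assumes "t \<in> carrier tensor_algebra" "t' \<in> carrier tensor_algebra"
  shows "t \<ominus>\<^bsub>tensor_algebra\<^esub> t' = (\<lambda>w. t w - t' w)"
proof -
  interpret ring tensor_algebra by (rule tensor_ring)
  have "\<ominus>\<^bsub>tensor_algebra\<^esub> t' = (\<lambda>w. - t' w)"
    by (rule minus_equality) (use assms in \<open>auto simp: tensor_add tensor_zero tensor_carrier\<close>)
  then show ?thesis by (simp add: a_minus_def tensor_add)
qed

lemma tensor_word_mult:
  "tensor_word k u \<otimes>\<^bsub>tensor_algebra\<^esub> tensor_word k' u' = tensor_word (k * k') (u @ u')"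
  by (rule tensor_eqI) (auto simp: tensor_mult_closed word_sum_mult)

lemma tensor_finsum:
  assumes "finite I" "\<And>i. i \<in> I \<Longrightarrow> f i \<in> carrier tensor_algebra"
  shows "finsum tensor_algebra f I = (\<lambda>w. \<Sum>i\<in>I. f i w)"
proof -
  interpret ring tensor_algebra by (rule tensor_ring)
  show ?thesis using assms
  proof (induction I)
    case (insert i I)
    then show ?case by (subst finsum_insert) (auto simp: tensor_add)
  qed (simp add: tensor_zero)
qed

lemma tensor_decomp:
  assumes "t \<in> carrier tensor_algebra"
  shows "t = (\<Oplus>\<^bsub>tensor_algebra\<^esub>w\<in>{w. t w \<noteq> 0}. tensor_word (t w) w)"
  using assms by (subst tensor_finsum) (auto simp: tensor_carrier tensor_word_def fun_eq_iff)

text \<open>The last case concerns only words in the support of \<open>t\<close>, each with its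
  actual coefficient, so that a length bound on \<open>t\<close> can be used there.\<close>

lemma tensor_induct:
  assumes "t \<in> carrier tensor_algebra"
    and zero: "Q (\<lambda>w. 0)"
    and add: "\<And>t t'. t \<in> carrier tensor_algebra \<Longrightarrow> t' \<in> carrier tensor_algebra
      \<Longrightarrow> Q t \<Longrightarrow> Q t' \<Longrightarrow> Q (\<lambda>w. t w + t' w)"
    and word: "\<And>w. t w \<noteq> 0 \<Longrightarrow> Q (tensor_word (t w) w)"
  shows "Q t"
proof -
  interpret ring tensor_algebra by (rule tensor_ring)
  have "Q (\<Oplus>\<^bsub>tensor_algebra\<^esub>w\<in>I. tensor_word (t w) w)" if "finite I" "I \<subseteq> {w. t w \<noteq> 0}" for I
    using that
  proof (induction I)
    case (insert i I)
    then show ?case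
      by (subst finsum_insert) (auto simp: tensor_add[symmetric] intro!: add[folded tensor_add] word finsum_closed)
  qed (simp add: zero tensor_zero)
  then have "Q (\<Oplus>\<^bsub>tensor_algebra\<^esub>w\<in>{w. t w \<noteq> 0}. tensor_word (t w) w)"
    using assms(1) by (simp add: tensor_carrier)
  then show ?thesis using tensor_decomp[OF assms(1)] by simp
qed

subsection \<open>Automorphisms induced by matrices\<close>

text \<open>The transpose of \<^const>\<open>tensor_map\<close>, acting on functionals.\<close>

primrec word_map :: "('b \<Rightarrow> 'b \<Rightarrow> complex) \<Rightarrow> ('b::finite list \<Rightarrow> complex) \<Rightarrow> 'b list \<Rightarrow> complex" where
  "word_map M F [] = F []"
| "word_map M F (b # u) = (\<Sum>l\<in>UNIV. M l b * word_map M (\<lambda>w. F (l # w)) u)"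

lemma finite_words [simp]: "finite {w :: 'b::finite list. length w = n}" "finite {w :: 'b list. length w \<le> n}"
  using finite_lists_length_eq[of "UNIV :: 'b set" n] finite_lists_length_le[of "UNIV :: 'b set" n] by auto

text \<open>The sum over words of a fixed length factors letter by letter. The recursive side is the
  form in which inductions over words can be carried out.\<close>

lemma word_map_sum:
  "(\<Sum>w | length w = length u. (\<Prod>k<length w. M (w ! k) (u ! k)) * F w) = word_map M F u"
proof (induction u arbitrary: F)
  case (Cons b u)
  have im: "{w. length w = length (b # u)} = (\<lambda>(l, w). l # w) ` (UNIV \<times> {w. length w = length u})"
    by (auto simp: image_iff length_Suc_conv)
  have inj: "inj_on (\<lambda>(l, w). l # w) (UNIV \<times> {w. length w = length u})" by (auto simp: inj_on_def)
  have "(\<Sum>w | length w = length (b # u). (\<Prod>k<length w. M (w ! k) ((b # u) ! k)) * F w)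
    = (\<Sum>(l, w)\<in>UNIV \<times> {w. length w = length u}. M l b * ((\<Prod>k<length w. M (w ! k) (u ! k)) * F (l # w)))"
    unfolding im by (subst sum.reindex[OF inj])
      (simp add: case_prod_unfold o_def prod.lessThan_Suc_shift mult.assoc del: prod.lessThan_Suc)
  also have "\<dots> = (\<Sum>l\<in>UNIV. M l b * (\<Sum>w | length w = length u. (\<Prod>k<length w. M (w ! k) (u ! k)) * F (l # w)))"
    by (simp only: sum.cartesian_product[symmetric] sum_distrib_left)
  finally show ?case unfolding Cons.IH by simp
qed (simp cong: conj_cong)

lemma word_map_add: "word_map M (\<lambda>w. F w + G w) u = word_map M F u + word_map M G u"
  by (induction u arbitrary: F G) (simp_all add: algebra_simps sum.distrib)

lemma word_map_scale: "word_map M (\<lambda>w. c * F w) u = c * word_map M F u"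
  by (induction u arbitrary: F) (simp_all add: sum_distrib_left mult_ac)

lemma word_map_func_sum:
  "finite I \<Longrightarrow> word_map M (\<lambda>w. \<Sum>i\<in>I. F i w) u = (\<Sum>i\<in>I. word_map M (F i) u)"
proof (induction I rule: finite_induct)
  case empty
  show ?case using word_map_scale[of M 0 "\<lambda>_. 0" u] by simp
qed (simp add: word_map_add)

lemma word_map_append: "word_map M F (u @ u') = word_map M (\<lambda>w. word_map M (\<lambda>w'. F (w @ w')) u') u"
  by (induction u arbitrary: F) simp_all

text \<open>Functionals are pulled back, so \<open>N\<close> applied outside \<open>M\<close> gives
  the product \<open>M N\<close>. On tensors this is \<open>tensor_map M\<close> after
  \<open>tensor_map N\<close>, which is what a left action requires.\<close>

lemma word_map_comp: "word_map N (word_map M F) u = word_map (\<lambda>a b. \<Sum>l\<in>UNIV. M a l * N l b) F u"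
proof (induction u arbitrary: F)
  case (Cons b u)
  have "word_map N (word_map M F) (b # u)
      = (\<Sum>l\<in>UNIV. N l b * (\<Sum>a\<in>UNIV. M a l * word_map N (word_map M (\<lambda>w. F (a # w))) u))"
    by (simp add: word_map_func_sum word_map_scale)
  also have "\<dots> = (\<Sum>l\<in>UNIV. \<Sum>a\<in>UNIV. M a l * N l b * word_map N (word_map M (\<lambda>w. F (a # w))) u)"
    by (simp add: sum_distrib_left mult_ac)
  also have "\<dots> = (\<Sum>a\<in>UNIV. \<Sum>l\<in>UNIV. M a l * N l b * word_map N (word_map M (\<lambda>w. F (a # w))) u)"
    by (rule sum.swap)
  finally show ?case by (simp add: Cons.IH sum_distrib_right)
qed simp

lemma word_map_id: "word_map (\<lambda>a b. if a = b then 1 else 0) F = F"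
proof
  show "word_map (\<lambda>a b. if a = b then 1 else 0) F u = F u" for u
    by (induction u arbitrary: F) (simp_all add: if_distrib[of "\<lambda>x. x * _"] cong: if_cong)
qed

lemma tensor_map_support:
  fixes t :: "'b::finite list \<Rightarrow> complex"
  assumes "tensor_map M t w \<noteq> 0"
  obtains u where "t u \<noteq> 0" "length u = length w"
proof -
  have "(\<Sum>u | length u = length w. (\<Prod>k<length w. M (w ! k) (u ! k)) * t u) \<noteq> 0"
    using assms by (simp add: tensor_map_def)
  then obtain u where "u \<in> {u. length u = length w}" "(\<Prod>k<length w. M (w ! k) (u ! k)) * t u \<noteq> 0"
    by (rule sum.not_neutral_contains_not_neutral)
  then show ?thesis by (intro that[of u]) auto
qed

lemma tensor_map_closed_word_sum:
  fixes t :: "'b::finite list \<Rightarrow> complex"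
  assumes "t \<in> carrier tensor_algebra"
  shows "tensor_map M t \<in> carrier tensor_algebra \<and> word_sum (tensor_map M t) F = word_sum t (word_map M F)"
proof -
  obtain N where N: "\<And>w. t w \<noteq> 0 \<Longrightarrow> length w \<le> N"
    using assms finite_maxlen[of "{w. t w \<noteq> 0}"] unfolding tensor_carrier by (auto intro: less_imp_le)
  \<comment> \<open>A finite set containing both supports: the alphabet is finite, and
    \<open>tensor_map\<close> preserves length.\<close>
  let ?A = "{w :: 'b list. length w \<le> N}"
  have sub: "{w. tensor_map M t w \<noteq> 0} \<subseteq> ?A"
    by (auto elim!: tensor_map_support dest!: N)
  have "word_sum (tensor_map M t) F = (\<Sum>w\<in>?A. tensor_map M t w * F w)"
    by (rule word_sum_superset[OF finite_words(2) sub])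
  also have "\<dots> = (\<Sum>w\<in>?A. \<Sum>u\<in>?A. if length u = length w then (\<Prod>k<length w. M (w ! k) (u ! k)) * t u * F w else 0)"
  proof (rule sum.cong[OF HOL.refl])
    fix w :: "'b list" assume "w \<in> ?A"
    then have "{u. length u = length w} = {u \<in> ?A. length u = length w}" by auto
    then show "tensor_map M t w * F w = (\<Sum>u\<in>?A. if length u = length w then (\<Prod>k<length w. M (w ! k) (u ! k)) * t u * F w else 0)"
      by (simp add: tensor_map_def sum.inter_filter[symmetric] sum_distrib_right)
  qed
  also have "\<dots> = (\<Sum>u\<in>?A. \<Sum>w\<in>?A. if length w = length u then t u * ((\<Prod>k<length w. M (w ! k) (u ! k)) * F w) else 0)"
    by (subst sum.swap) (auto intro!: sum.cong)
  also have "\<dots> = (\<Sum>u\<in>?A. t u * word_map M F u)"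
  proof (rule sum.cong[OF HOL.refl])
    fix u :: "'b list" assume "u \<in> ?A"
    then have "{w. length w = length u} = {w \<in> ?A. length w = length u}" by auto
    then show "(\<Sum>w\<in>?A. if length w = length u then t u * ((\<Prod>k<length w. M (w ! k) (u ! k)) * F w) else 0) = t u * word_map M F u"
      by (simp add: word_map_sum[symmetric] sum.inter_filter[symmetric] sum_distrib_left)
  qed
  also have "\<dots> = word_sum t (word_map M F)"
    by (rule word_sum_superset[symmetric]) (auto dest: N)
  finally show ?thesis using sub finite_subset[OF sub] by (simp add: tensor_carrier)
qed

lemmas tensor_map_closed = tensor_map_closed_word_sum[THEN conjunct1]
  and word_sum_tensor_map = tensor_map_closed_word_sum[THEN conjunct2]

lemma tensor_map_hom:
  fixes M :: "'b::finite \<Rightarrow> 'b \<Rightarrow> complex"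
  shows "tensor_map M \<in> ring_hom tensor_algebra tensor_algebra"
proof (rule ring_hom_memI)
  interpret ring "tensor_algebra :: ('b list \<Rightarrow> complex) ring" by (rule tensor_ring)
  fix x y :: "'b list \<Rightarrow> complex" assume c: "x \<in> carrier tensor_algebra" "y \<in> carrier tensor_algebra"
  show "tensor_map M (x \<otimes>\<^bsub>tensor_algebra\<^esub> y) = tensor_map M x \<otimes>\<^bsub>tensor_algebra\<^esub> tensor_map M y"
  proof (intro tensor_eqI tensor_map_closed m_closed c)
    fix F
    have "word_sum x (\<lambda>u. word_sum y (\<lambda>u'. word_map M F (u @ u')))
       = word_sum x (word_map M (\<lambda>w. word_sum y (word_map M (\<lambda>w'. F (w @ w')))))"
      by (simp add: word_map_append word_sum_def word_map_func_sum word_map_scale c[unfolded tensor_carrier])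
    then show "word_sum (tensor_map M (x \<otimes>\<^bsub>tensor_algebra\<^esub> y)) F
      = word_sum (tensor_map M x \<otimes>\<^bsub>tensor_algebra\<^esub> tensor_map M y) F"
      using c by (simp add: word_sum_tensor_map word_sum_mult tensor_map_closed)
  qed
  show "tensor_map M (x \<oplus>\<^bsub>tensor_algebra\<^esub> y) = tensor_map M x \<oplus>\<^bsub>tensor_algebra\<^esub> tensor_map M y"
    by (simp add: tensor_map_def tensor_add algebra_simps sum.distrib)
next
  show "tensor_map M \<one>\<^bsub>tensor_algebra\<^esub> = \<one>\<^bsub>tensor_algebra\<^esub>"
    by (rule tensor_eqI) (simp_all add: tensor_one tensor_map_closed word_sum_tensor_map)
qed (rule tensor_map_closed)

section \<open>Linear independence of monomials\<close>

definition monomial :: "('b \<Rightarrow> complex) \<Rightarrow> 'b list \<Rightarrow> complex" where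
  "monomial v w = prod_list (map v w)"

lemma monomial_append: "monomial v (u @ u') = monomial v u * monomial v u'"
  and monomial_Cons: "monomial v (b # u) = v b * monomial v u"
  and monomial_Nil [simp]: "monomial v [] = 1"
  by (simp_all add: monomial_def)

lemma monomial_mult: "monomial (\<lambda>b. v b * v' b) w = monomial v w * monomial v' w"
  by (induction w) (simp_all add: monomial_Cons mult_ac)

lemma monomial_mset: "mset u = mset u' \<Longrightarrow> monomial v u = monomial v u'"
  by (simp add: monomial_def flip: prod_mset_prod_list)

lemma word_map_monomial: "word_map M (monomial v) u = monomial (\<lambda>b. \<Sum>l\<in>UNIV. M l b * v l) u"
proof (induction u)
  case (Cons b u)
  have "word_map M (monomial v) (b # u) = (\<Sum>l\<in>UNIV. M l b * (v l * word_map M (monomial v) u))"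
    by (simp only: word_map.simps monomial_Cons word_map_scale)
  also have "\<dots> = (\<Sum>l\<in>UNIV. M l b * v l) * word_map M (monomial v) u"
    by (simp only: sum_distrib_right mult.assoc)
  finally show ?case by (simp only: Cons.IH monomial_Cons)
qed simp

lemma monomial_separates:
  assumes "mset u \<noteq> mset u'"
  obtains v where "monomial v u \<noteq> monomial v u'"
proof -
  obtain b where b: "count (mset u) b \<noteq> count (mset u') b"
    using assms by (auto simp: multiset_eq_iff)
  \<comment> \<open>The value 2 at one letter and 1 at all others turns a monomial into a power of 2
    whose exponent is the multiplicity of that letter.\<close>
  have "monomial (\<lambda>c. if c = b then 2 else 1) w = 2 ^ count (mset w) b" for w
    by (induction w) (auto simp: monomial_Cons)
  moreover have "(2::complex) ^ i \<noteq> 2 ^ j" if "i \<noteq> j" for i j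
    using that of_nat_eq_iff[of "2 ^ i" "2 ^ j", where ?'a=complex] by simp
  ultimately show ?thesis using b by (intro that[of "\<lambda>c. if c = b then 2 else 1"]) simp
qed

text \<open>Dedekind's argument: monomials are characters of the multiplicative monoid of coordinate
  vectors.\<close>

lemma monomials_independent:
  assumes "finite U" "inj_on mset U" "\<And>v. (\<Sum>u\<in>U. c u * monomial v u) = 0" "u \<in> U"
  shows "c u = 0"
  using assms
proof (induction U arbitrary: c u)
  case (insert a U)
  have z: "c x = 0" if "x \<in> U" for x
  proof -
    have "mset x \<noteq> mset a" using that insert.prems(1) insert.hyps(2) by (auto simp: inj_on_def)
    then obtain v' where v': "monomial v' x \<noteq> monomial v' a" by (rule monomial_separates)
    \<comment> \<open>The relation at the pointwise product of \<open>v'\<close> and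
      \<open>v\<close>, minus \<open>monomial v' a\<close> times the relation at \<open>v\<close>:
      the term of \<open>a\<close> cancels.\<close>
    have "(\<Sum>u\<in>U. c u * (monomial v' u - monomial v' a) * monomial v u) = 0" for v
    proof -
      have "(\<Sum>u\<in>insert a U. c u * (monomial v' u - monomial v' a) * monomial v u)
        = (\<Sum>u\<in>insert a U. c u * (monomial v' u * monomial v u)) - monomial v' a * (\<Sum>u\<in>insert a U. c u * monomial v u)"
        by (simp only: sum_distrib_left sum_subtractf[symmetric]) (simp add: algebra_simps)
      also have "\<dots> = 0"
        using insert.prems(2)[of "\<lambda>b. v' b * v b"] insert.prems(2)[of v] by (simp only: monomial_mult mult_zero_right diff_self)
      finally have "(\<Sum>u\<in>insert a U. c u * (monomial v' u - monomial v' a) * monomial v u) = 0" .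
      then show ?thesis using insert.hyps by simp
    qed
    then have "c x * (monomial v' x - monomial v' a) = 0"
      using insert.IH[of "\<lambda>u. c u * (monomial v' u - monomial v' a)" x] insert.prems(1) that by simp
    then show ?thesis using v' by simp
  qed
  \<comment> \<open>With all other coefficients zero, the relation at the all-ones point, where
    every monomial equals 1, leaves \<open>c a\<close>.\<close>
  have "c a * monomial (\<lambda>_. 1) a = 0"
    using insert.prems(2)[of "\<lambda>_. 1"] insert.hyps z by simp
  moreover have "monomial (\<lambda>_. 1) a = 1" by (induction a) (simp_all add: monomial_Cons)
  ultimately show ?case using z insert.prems by auto
qed simp

section \<open>Polynomial functions and the symbol of a tensor\<close>

lemma polyfun_ops:
  "carrier polyfun_ring = polyfuns"
  "f \<oplus>\<^bsub>polyfun_ring\<^esub> f' = (\<lambda>v. f v + f' v)" "f \<otimes>\<^bsub>polyfun_ring\<^esub> f' = (\<lambda>v. f v * f' v)"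
  "\<zero>\<^bsub>polyfun_ring\<^esub> = (\<lambda>v. 0)" "\<one>\<^bsub>polyfun_ring\<^esub> = (\<lambda>v. 1)"
  by (simp_all add: polyfun_ring_def)

lemma polyfun_uminus: "f \<in> polyfuns \<Longrightarrow> (\<lambda>v. - f v) \<in> polyfuns"
  using polyfuns.mult[OF polyfuns.const[of "-1"]] by simp

lemma polyfun_sum: "(\<And>i. i \<in> I \<Longrightarrow> f i \<in> polyfuns) \<Longrightarrow> (\<lambda>v. \<Sum>i\<in>I. f i v) \<in> polyfuns"
  by (induction I rule: infinite_finite_induct) (auto intro: polyfuns.const polyfuns.add)

lemma polyfun_ring: "ring (polyfun_ring :: ((complex ^ 'i::finite) \<times> (complex ^ 'i) \<Rightarrow> complex) ring)"
proof (rule ringI)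
  let ?P = "polyfun_ring :: ((complex ^ 'i) \<times> (complex ^ 'i) \<Rightarrow> complex) ring"
  show "abelian_group ?P"
  proof (rule abelian_groupI)
    fix f :: "(complex ^ 'i) \<times> (complex ^ 'i) \<Rightarrow> complex" assume "f \<in> carrier ?P"
    then show "\<exists>y\<in>carrier ?P. y \<oplus>\<^bsub>?P\<^esub> f = \<zero>\<^bsub>?P\<^esub>"
      by (intro bexI[of _ "\<lambda>v. - f v"]) (auto simp: polyfun_ops polyfun_uminus)
  qed (auto simp: polyfun_ops algebra_simps intro: polyfuns.intros)
  show "Group.monoid ?P"
    by (rule monoidI) (auto simp: polyfun_ops algebra_simps intro: polyfuns.intros)
qed (auto simp: polyfun_ops algebra_simps)

lemma polyfun_finsum:
  assumes "finite I" "\<And>i. i \<in> I \<Longrightarrow> f i \<in> polyfuns"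
  shows "finsum polyfun_ring f I = (\<lambda>v. \<Sum>i\<in>I. f i v)"
proof -
  interpret ring polyfun_ring by (rule polyfun_ring)
  show ?thesis using assms
  proof (induction I)
    case (insert i I)
    then show ?case by (subst finsum_insert) (auto simp: polyfun_ops)
  qed (simp add: polyfun_ops)
qed

lemma pairing_matrix: "pairing (A *v y) x = pairing y (Finite_Cartesian_Product.transpose A *v x)"
proof -
  have "pairing (A *v y) x = (\<Sum>i\<in>UNIV. \<Sum>j\<in>UNIV. A $ i $ j * y $ j * x $ i)"
    by (simp add: pairing_def matrix_vector_mult_def sum_distrib_right)
  also have "\<dots> = (\<Sum>j\<in>UNIV. \<Sum>i\<in>UNIV. A $ i $ j * y $ j * x $ i)" by (rule sum.swap)
  finally show ?thesis
    by (simp add: pairing_def matrix_vector_mult_def sum_distrib_left Finite_Cartesian_Product.transpose_def mult_ac)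
qed

lemma pairing_linear:
  "pairing (y + y') x = pairing y x + pairing y' x" "pairing y (x + x') = pairing y x + pairing y x'"
  "pairing (k *s y) x = k * pairing y x" "pairing y (k *s x) = k * pairing y x"
  "pairing 0 x = 0" "pairing y 0 = 0" "pairing (- y) x = - pairing y x" "pairing y (- x) = - pairing y x"
  "pairing (y - y') x = pairing y x - pairing y' x" "pairing y (x - x') = pairing y x - pairing y x'"
  by (simp_all add: pairing_def algebra_simps sum.distrib sum_distrib_left sum_negf sum_subtractf)

lemma pairing_axis: "pairing (axis i 1) x = x $ i" "pairing y (axis i 1) = y $ i"
  by (simp_all add: pairing_def axis_def if_distrib[of "\<lambda>c. c * _"] if_distrib[of "(*) _"] cong: if_cong)

section \<open>Group actions on vectors, functions and tensors\<close>

locale real_rep = W: group W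
  for W :: "('g, 'z) monoid_scheme" +
  fixes \<rho> :: "'g \<Rightarrow> real ^ 'i ^ 'i::finite"
  assumes finite_W: "finite (carrier W)"
    and rho_one: "\<rho> \<one>\<^bsub>W\<^esub> = mat 1"
    and rho_mult: "g \<in> carrier W \<Longrightarrow> h \<in> carrier W \<Longrightarrow> \<rho> (g \<otimes>\<^bsub>W\<^esub> h) = \<rho> g ** \<rho> h"
begin

lemma rep_one: "rep \<rho> \<one>\<^bsub>W\<^esub> = mat 1"
  by (simp add: rep_def rho_one vec_eq_iff mat_def map_matrix_def)

lemma rep_mult: "g \<in> carrier W \<Longrightarrow> h \<in> carrier W \<Longrightarrow> rep \<rho> (g \<otimes>\<^bsub>W\<^esub> h) = rep \<rho> g ** rep \<rho> h"
  by (simp add: rep_def rho_mult vec_eq_iff matrix_matrix_mult_def map_matrix_def)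

lemma dual_rep_one: "dual_rep W \<rho> \<one>\<^bsub>W\<^esub> = mat 1"
  by (simp add: dual_rep_def rep_one transpose_mat)

lemma dual_rep_mult:
  "g \<in> carrier W \<Longrightarrow> h \<in> carrier W \<Longrightarrow> dual_rep W \<rho> (g \<otimes>\<^bsub>W\<^esub> h) = dual_rep W \<rho> g ** dual_rep W \<rho> h"
  by (simp add: dual_rep_def W.inv_mult_group rep_mult matrix_transpose_mul)

lemma rep_inv: "g \<in> carrier W \<Longrightarrow> rep \<rho> (inv\<^bsub>W\<^esub> g) *v (rep \<rho> g *v y) = y"
    "g \<in> carrier W \<Longrightarrow> rep \<rho> g *v (rep \<rho> (inv\<^bsub>W\<^esub> g) *v y) = y"
  by (simp_all add: matrix_vector_mul_assoc rep_mult[symmetric] rep_one)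

lemma dual_rep_inv: "g \<in> carrier W \<Longrightarrow> dual_rep W \<rho> (inv\<^bsub>W\<^esub> g) *v (dual_rep W \<rho> g *v x) = x"
    "g \<in> carrier W \<Longrightarrow> dual_rep W \<rho> g *v (dual_rep W \<rho> (inv\<^bsub>W\<^esub> g) *v x) = x"
  by (simp_all add: matrix_vector_mul_assoc dual_rep_mult[symmetric] dual_rep_one)

lemma pairing_rep:
  "g \<in> carrier W \<Longrightarrow> pairing (rep \<rho> (inv\<^bsub>W\<^esub> g) *v y) x = pairing y (dual_rep W \<rho> g *v x)"
  "g \<in> carrier W \<Longrightarrow> pairing y (dual_rep W \<rho> (inv\<^bsub>W\<^esub> g) *v x) = pairing (rep \<rho> g *v y) x"
  by (simp_all add: pairing_matrix dual_rep_def)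

text \<open>A right action on points, because of the inverses; precomposition with it is therefore a
  left action on functions, namely \<open>polyfun_act\<close>.\<close>

definition point_act :: "'g \<Rightarrow> (complex ^ 'i) \<times> (complex ^ 'i) \<Rightarrow> (complex ^ 'i) \<times> (complex ^ 'i)" where
  "point_act g v = (rep \<rho> (inv\<^bsub>W\<^esub> g) *v fst v, dual_rep W \<rho> (inv\<^bsub>W\<^esub> g) *v snd v)"

lemma polyfun_act_point: "polyfun_act W \<rho> g f = (\<lambda>v. f (point_act g v))"
  by (simp add: polyfun_act_def point_act_def case_prod_unfold)

lemma polyfun_act_closed:
  assumes "f \<in> polyfuns" "g \<in> carrier W"
  shows "polyfun_act W \<rho> g f \<in> polyfuns"
  using assms(1)
proof induction
  case (x x)
  then show ?case using polyfuns.x[of "dual_rep W \<rho> g *v x"] assms(2)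
    by (simp add: polyfun_act_def pairing_rep)
next
  case (y y)
  then show ?case using polyfuns.y[of "rep \<rho> g *v y"] assms(2)
    by (simp add: polyfun_act_def pairing_rep)
qed (simp_all add: polyfun_act_point polyfuns.intros)

lemma polyfun_skew: "skew_group_ring W (polyfun_act W \<rho>) (polyfun_ring :: ((complex ^ 'i) \<times> (complex ^ 'i) \<Rightarrow> complex) ring)"
proof (intro skew_group_ring.intro skew_group_ring_axioms.intro W.group_axioms polyfun_ring finite_W)
  fix g h and f :: "(complex ^ 'i) \<times> (complex ^ 'i) \<Rightarrow> complex"
  assume g: "g \<in> carrier W"
  show "polyfun_act W \<rho> g \<in> ring_hom polyfun_ring polyfun_ring"
    by (rule ring_hom_memI) (use g in \<open>auto simp: polyfun_ops polyfun_act_closed\<close>, auto simp: polyfun_act_def)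
  assume h: "h \<in> carrier W"
  show "polyfun_act W \<rho> (g \<otimes>\<^bsub>W\<^esub> h) f = polyfun_act W \<rho> g (polyfun_act W \<rho> h f)"
    using g h by (simp add: polyfun_act_def case_prod_unfold fun_eq_iff W.inv_mult_group rep_mult
      dual_rep_mult matrix_vector_mul_assoc)
qed (simp add: polyfun_act_def rep_one dual_rep_one)

lemma sum_UNIV_Plus: "(\<Sum>l\<in>UNIV. f l) = (\<Sum>i\<in>UNIV. f (Inl i)) + (\<Sum>i\<in>UNIV. f (Inr i))"
  for f :: "'i + 'i \<Rightarrow> complex"
  by (subst UNIV_Plus_UNIV[symmetric], subst sum.Plus) simp_all

lemma double_matrix_one: "double_matrix W \<rho> \<one>\<^bsub>W\<^esub> = (\<lambda>a b. if a = b then 1 else 0)"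
  by (auto simp: double_matrix_def rep_one dual_rep_one mat_def fun_eq_iff split: sum.splits)

lemma double_matrix_mult: "g \<in> carrier W \<Longrightarrow> h \<in> carrier W \<Longrightarrow>
    double_matrix W \<rho> (g \<otimes>\<^bsub>W\<^esub> h) = (\<lambda>a b. \<Sum>l\<in>UNIV. double_matrix W \<rho> g a l * double_matrix W \<rho> h l b)"
  by (auto simp: double_matrix_def rep_mult dual_rep_mult matrix_matrix_mult_def fun_eq_iff sum_UNIV_Plus split: sum.splits)

lemma tensor_skew: "skew_group_ring W (tensor_act W \<rho>) tensor_algebra"
proof (intro skew_group_ring.intro skew_group_ring_axioms.intro W.group_axioms tensor_ring finite_W)
  fix g assume g: "g \<in> carrier W"
  show "tensor_act W \<rho> g \<in> ring_hom tensor_algebra tensor_algebra"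
    unfolding tensor_act_def by (rule tensor_map_hom)
next
  fix t :: "('i + 'i) list \<Rightarrow> complex" assume t: "t \<in> carrier tensor_algebra"
  show "tensor_act W \<rho> \<one>\<^bsub>W\<^esub> t = t"
    by (rule tensor_eqI)
      (simp_all add: tensor_act_def t tensor_map_closed word_sum_tensor_map double_matrix_one word_map_id)
  fix g h assume g: "g \<in> carrier W" and h: "h \<in> carrier W"
  show "tensor_act W \<rho> (g \<otimes>\<^bsub>W\<^esub> h) t = tensor_act W \<rho> g (tensor_act W \<rho> h t)"
  proof (rule tensor_eqI)
    fix F
    have "word_map (double_matrix W \<rho> h) (word_map (double_matrix W \<rho> g) F) = word_map (double_matrix W \<rho> (g \<otimes>\<^bsub>W\<^esub> h)) F"
      using g h by (auto simp: word_map_comp double_matrix_mult)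
    then show "word_sum (tensor_act W \<rho> (g \<otimes>\<^bsub>W\<^esub> h) t) F = word_sum (tensor_act W \<rho> g (tensor_act W \<rho> h t)) F"
      using g h t by (simp add: tensor_act_def tensor_map_closed word_sum_tensor_map)
  qed (simp_all add: tensor_act_def t tensor_map_closed)
qed

end

text \<open>The crossing is intended: a letter \<open>Inl i\<close> is a vector of
  \<open>\<hh>\<close>, hence a function of the second component in the dual space, and a letter
  \<open>Inr i\<close> is a covector, hence a function of the first component in
  \<open>\<hh>\<close>.\<close>

definition coord :: "(complex ^ 'i) \<times> (complex ^ 'i) \<Rightarrow> 'i + 'i::finite \<Rightarrow> complex" where
  "coord v l = (case l of Inl i \<Rightarrow> snd v $ i | Inr i \<Rightarrow> fst v $ i)"

lemma coord_scale: "coord (u *s fst v, u *s snd v) l = u * coord v l"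
  by (simp add: coord_def split: sum.splits)

lemma monomial_scale: "monomial (coord (u *s fst v, u *s snd v)) w = u ^ length w * monomial (coord v) w"
  by (induction w) (simp_all add: monomial_Cons coord_scale)

lemma monomial_polyfun: "(\<lambda>v. monomial (coord v) w) \<in> polyfuns"
proof (induction w)
  case (Cons l w)
  have "(\<lambda>v. coord v l) \<in> polyfuns"
  proof (cases l)
    case (Inl i)
    then show ?thesis using polyfuns.y[of "axis i 1"] by (simp add: coord_def pairing_axis case_prod_unfold)
  next
    case (Inr i)
    then show ?thesis using polyfuns.x[of "axis i 1"] by (simp add: coord_def pairing_axis case_prod_unfold)
  qed
  then show ?case using Cons by (simp add: monomial_Cons polyfuns.mult)
qed (simp add: polyfuns.const)

definition tensor_filt :: "nat \<Rightarrow> ('b list \<Rightarrow> complex) set" where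
  "tensor_filt n = {t \<in> carrier tensor_algebra. \<forall>w. t w \<noteq> 0 \<longrightarrow> length w \<le> n}"

text \<open>The length-\<open>n\<close> part of a tensor, mapped to the symmetric algebra by letting
  the letters commute and then read as a function.\<close>

definition tensor_symbol ::
    "nat \<Rightarrow> (('i + 'i::finite) list \<Rightarrow> complex) \<Rightarrow> (complex ^ 'i) \<times> (complex ^ 'i) \<Rightarrow> complex" where
  "tensor_symbol n t v = word_sum t (\<lambda>w. if length w = n then monomial (coord v) w else 0)"

text \<open>Scaling the point is the device that separates degrees: it isolates the top degree in
  the action of the ideal, and later the summands of a sum of symbols.\<close>

lemma tensor_symbol_homogeneous: "tensor_symbol n t (u *s fst v, u *s snd v) = u ^ n * tensor_symbol n t v"
  unfolding tensor_symbol_def word_sum_func_scale[symmetric]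
  by (intro word_sum_cong) (simp add: monomial_scale)

lemma word_sum_monomial_mult:
  assumes "t \<in> carrier tensor_algebra" "t' \<in> carrier tensor_algebra"
  shows "word_sum (t \<otimes>\<^bsub>tensor_algebra\<^esub> t') (monomial c) = word_sum t (monomial c) * word_sum t' (monomial c)"
proof -
  have "word_sum t (\<lambda>u. monomial c u * word_sum t' (monomial c)) = word_sum t (\<lambda>u. word_sum t' (monomial c) * monomial c u)"
    by (simp only: mult.commute)
  then show ?thesis
    unfolding word_sum_mult[OF assms] monomial_append word_sum_func_scale by (simp only: mult.commute)
qed

lemma word_tensor_filt: "length w \<le> n \<Longrightarrow> tensor_word k w \<in> tensor_filt n"
  by (auto simp: tensor_filt_def) (auto simp: tensor_word_def split: if_splits)

lemma tensor_symbol_word: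
  "tensor_symbol n (tensor_word k w) = (\<lambda>v. if length w = n then k * monomial (coord v) w else 0)"
  by (auto simp: tensor_symbol_def)

lemma tensor_symbol_polyfun: "tensor_symbol n t \<in> polyfuns"
  unfolding tensor_symbol_def word_sum_def
proof (intro polyfun_sum polyfuns.mult polyfuns.const)
  show "(\<lambda>v. if length w = n then monomial (coord v) w else 0) \<in> polyfuns" for w :: "('a + 'a) list"
    by (cases "length w = n") (simp_all add: monomial_polyfun polyfuns.const)
qed

lemma tensor_symbol_family: "symbol_family tensor_algebra tensor_filt polyfun_ring
    (tensor_symbol :: nat \<Rightarrow> (('i + 'i::finite) list \<Rightarrow> complex) \<Rightarrow> _)"
proof (rule symbol_family.intro[OF tensor_ring polyfun_ring], unfold_locales)
  let ?T = "tensor_algebra :: (('i + 'i) list \<Rightarrow> complex) ring"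
  show "\<zero>\<^bsub>?T\<^esub> \<in> tensor_filt n" for n by (simp add: tensor_filt_def tensor_zero tensor_carrier)
  show "\<one>\<^bsub>?T\<^esub> \<in> tensor_filt 0" unfolding tensor_one by (rule word_tensor_filt) simp
  show "tensor_symbol 0 \<one>\<^bsub>?T\<^esub> = \<one>\<^bsub>polyfun_ring\<^esub>"
    by (simp add: tensor_one tensor_symbol_word polyfun_ops)
  fix x y :: "('i + 'i) list \<Rightarrow> complex" and n k assume x: "x \<in> tensor_filt n"
  then have xc: "x \<in> carrier ?T" and xn: "\<And>w. x w \<noteq> 0 \<Longrightarrow> length w \<le> n" by (auto simp: tensor_filt_def)
  show "x \<in> carrier ?T" by fact
  show "x \<in> tensor_filt (Suc n)" using x by (auto simp: tensor_filt_def le_Suc_eq)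
  show "tensor_symbol n x \<in> carrier polyfun_ring"
    by (simp add: polyfun_ops tensor_symbol_polyfun)
  show "tensor_symbol (Suc n) x = \<zero>\<^bsub>polyfun_ring\<^esub>"
  proof
    fix v :: "(complex ^ 'i) \<times> (complex ^ 'i)"
    have "tensor_symbol (Suc n) x v = word_sum x (\<lambda>w. 0)"
      unfolding tensor_symbol_def using xn by (intro word_sum_cong) force
    then show "tensor_symbol (Suc n) x v = \<zero>\<^bsub>polyfun_ring\<^esub> v" by (simp add: polyfun_ops)
  qed
  { assume y: "y \<in> tensor_filt n"
    then have yc: "y \<in> carrier ?T" by (auto simp: tensor_filt_def)
    have "x \<ominus>\<^bsub>?T\<^esub> y \<in> carrier ?T" using ring.ring_simprules(4)[OF tensor_ring xc yc] .
    moreover have "length w \<le> n" if "x w - y w \<noteq> 0" for w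
      using x y that by (cases "x w = 0") (auto simp: tensor_filt_def)
    ultimately show "x \<ominus>\<^bsub>?T\<^esub> y \<in> tensor_filt n" by (auto simp: tensor_filt_def tensor_minus xc yc)
    show "tensor_symbol n (x \<oplus>\<^bsub>?T\<^esub> y) = tensor_symbol n x \<oplus>\<^bsub>polyfun_ring\<^esub> tensor_symbol n y"
      by (simp add: tensor_symbol_def polyfun_ops tensor_add word_sum_add xc yc fun_eq_iff) }
  assume "y \<in> tensor_filt k"
  then have yc: "y \<in> carrier ?T" and yk: "\<And>w. y w \<noteq> 0 \<Longrightarrow> length w \<le> k" by (auto simp: tensor_filt_def)
  show "x \<otimes>\<^bsub>?T\<^esub> y \<in> tensor_filt (n + k)"
    using tensor_mult_closed[OF xc yc] tensor_mult_support[OF xc yc] xn yk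
    by (fastforce simp: tensor_filt_def intro: add_mono)
  show "tensor_symbol (n + k) (x \<otimes>\<^bsub>?T\<^esub> y) = tensor_symbol n x \<otimes>\<^bsub>polyfun_ring\<^esub> tensor_symbol k y"
  proof
    fix v :: "(complex ^ 'i) \<times> (complex ^ 'i)"
    let ?m = "\<lambda>n w. if length w = n then monomial (coord v) w else 0"
    have "tensor_symbol (n + k) (x \<otimes>\<^bsub>?T\<^esub> y) v = word_sum x (\<lambda>u. word_sum y (\<lambda>u'. ?m n u * ?m k u'))"
      unfolding tensor_symbol_def word_sum_mult[OF xc yc]
    proof (intro word_sum_cong)
      fix u u' assume "x u \<noteq> 0" "y u' \<noteq> 0"
      then have "length u \<le> n" "length u' \<le> k" using xn yk by auto
      \<comment> \<open>Within the supports the lengths are at most \<open>n\<close> and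
        \<open>k\<close>, so the total \<open>n + k\<close> is reached only when both bounds are
        attained.\<close>
      then show "?m (n + k) (u @ u') = ?m n u * ?m k u'" by (auto simp: monomial_append)
    qed
    also have "\<dots> = word_sum x (\<lambda>u. tensor_symbol k y v * ?m n u)"
      by (simp only: word_sum_func_scale tensor_symbol_def mult.commute)
    also have "\<dots> = tensor_symbol k y v * tensor_symbol n x v"
      by (simp only: word_sum_func_scale) (simp add: tensor_symbol_def)
    finally show "tensor_symbol (n + k) (x \<otimes>\<^bsub>?T\<^esub> y) v = (tensor_symbol n x \<otimes>\<^bsub>polyfun_ring\<^esub> tensor_symbol k y) v"
      by (simp add: polyfun_ops mult.commute)
  qed
qed

lemma word_sum_tensor_x: "word_sum (tensor_x x) F = (\<Sum>i\<in>UNIV. x $ i * F [Inr i])"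
  and tensor_x_filt: "tensor_x x \<in> tensor_filt 1"
proof -
  have sub: "{w. tensor_x x w \<noteq> 0} \<subseteq> (\<lambda>i. [Inr i]) ` UNIV"
  proof
    fix w assume "w \<in> {w. tensor_x x w \<noteq> 0}"
    then show "w \<in> (\<lambda>i. [Inr i]) ` UNIV"
      by (cases w; cases "hd w"; cases "tl w") (auto simp: tensor_x_def)
  qed
  have "word_sum (tensor_x x) F = (\<Sum>w\<in>(\<lambda>i. [Inr i]) ` UNIV. tensor_x x w * F w)"
    by (rule word_sum_superset[OF _ sub]) simp
  also have "\<dots> = (\<Sum>i\<in>UNIV. x $ i * F [Inr i])"
    by (subst sum.reindex) (auto simp: inj_on_def tensor_x_def)
  finally show "word_sum (tensor_x x) F = (\<Sum>i\<in>UNIV. x $ i * F [Inr i])" .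
  show "tensor_x x \<in> tensor_filt 1"
    using sub finite_subset[OF sub] by (auto simp: tensor_filt_def tensor_carrier)
qed

lemma word_sum_tensor_y: "word_sum (tensor_y y) F = (\<Sum>i\<in>UNIV. y $ i * F [Inl i])"
  and tensor_y_filt: "tensor_y y \<in> tensor_filt 1"
proof -
  have sub: "{w. tensor_y y w \<noteq> 0} \<subseteq> (\<lambda>i. [Inl i]) ` UNIV"
  proof
    fix w assume "w \<in> {w. tensor_y y w \<noteq> 0}"
    then show "w \<in> (\<lambda>i. [Inl i]) ` UNIV"
      by (cases w; cases "hd w"; cases "tl w") (auto simp: tensor_y_def)
  qed
  have "word_sum (tensor_y y) F = (\<Sum>w\<in>(\<lambda>i. [Inl i]) ` UNIV. tensor_y y w * F w)"
    by (rule word_sum_superset[OF _ sub]) simp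
  also have "\<dots> = (\<Sum>i\<in>UNIV. y $ i * F [Inl i])"
    by (subst sum.reindex) (auto simp: inj_on_def tensor_y_def)
  finally show "word_sum (tensor_y y) F = (\<Sum>i\<in>UNIV. y $ i * F [Inl i])" .
  show "tensor_y y \<in> tensor_filt 1"
    using sub finite_subset[OF sub] by (auto simp: tensor_filt_def tensor_carrier)
qed

lemma tensor_xy_closed: "tensor_x x \<in> carrier tensor_algebra" "tensor_y y \<in> carrier tensor_algebra"
  using tensor_x_filt tensor_y_filt by (auto simp: tensor_filt_def)

text \<open>Lifts a polynomial function to a tensor, hence to a combination of monomials; this is
  what makes the symbols span. The lift is one of many, since letters commute after
  evaluation.\<close>

lemma polyfun_tensor:
  assumes "f \<in> polyfuns"
  shows "\<exists>t\<in>carrier tensor_algebra. \<forall>v. f v = word_sum t (monomial (coord v))"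
  using assms
proof induction
  case (const k)
  then show ?case by (intro bexI[of _ "tensor_word k []"]) auto
next
  case (x x)
  show ?case by (intro bexI[of _ "tensor_x x"])
    (auto simp: tensor_xy_closed word_sum_tensor_x pairing_def monomial_Cons coord_def mult.commute)
next
  case (y y)
  show ?case by (intro bexI[of _ "tensor_y y"])
    (auto simp: tensor_xy_closed word_sum_tensor_y pairing_def monomial_Cons coord_def)
next
  case (add f f')
  then obtain t t' where "t \<in> carrier tensor_algebra" "\<forall>v. f v = word_sum t (monomial (coord v))"
    "t' \<in> carrier tensor_algebra" "\<forall>v. f' v = word_sum t' (monomial (coord v))" by blast
  then show ?case using ring.ring_simprules(1)[OF tensor_ring, of t t']
    by (intro bexI[of _ "t \<oplus>\<^bsub>tensor_algebra\<^esub> t'"]) (simp_all add: tensor_add word_sum_add)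
next
  case (mult f f')
  then obtain t t' where "t \<in> carrier tensor_algebra" "\<forall>v. f v = word_sum t (monomial (coord v))"
    "t' \<in> carrier tensor_algebra" "\<forall>v. f' v = word_sum t' (monomial (coord v))" by blast
  then show ?case
    by (intro bexI[of _ "t \<otimes>\<^bsub>tensor_algebra\<^esub> t'"]) (simp_all add: tensor_mult_closed word_sum_monomial_mult)
qed

lemma coord_surj: "\<exists>v. coord v = c"
  by (rule exI[of _ "(\<chi> i. c (Inr i), \<chi> i. c (Inl i))"]) (auto simp: coord_def fun_eq_iff split: sum.splits)

text \<open>Modulo words of lower length, a tensor with vanishing symbol is a combination of
  differences of rearranged words.\<close>

lemma tensor_symbol_kernel_induct:
  fixes t :: "('i + 'i::finite) list \<Rightarrow> complex"
  assumes t: "t \<in> tensor_filt n" "tensor_symbol n t = (\<lambda>v. 0)"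
    and zero: "J (\<lambda>w. 0)"
    and add: "\<And>t t'. t \<in> carrier tensor_algebra \<Longrightarrow> t' \<in> carrier tensor_algebra
      \<Longrightarrow> J t \<Longrightarrow> J t' \<Longrightarrow> J (\<lambda>w. t w + t' w)"
    and lower: "\<And>w k. length w < n \<Longrightarrow> J (tensor_word k w)"
    and perm: "\<And>w w' k. length w = n \<Longrightarrow> mset w = mset w'
      \<Longrightarrow> J (\<lambda>u. tensor_word k w u - tensor_word k w' u)"
  shows "J t"
proof -
  interpret ring "tensor_algebra :: (('i + 'i) list \<Rightarrow> complex) ring" by (rule tensor_ring)
  let ?S = "{w. t w \<noteq> 0 \<and> length w = n}"
  \<comment> \<open>One chosen word in each rearrangement class, so that words can be compared with
    a common representative.\<close>
  define canon where "canon w = (SOME u. mset u = mset w)" for w :: "('i + 'i) list"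
  have canon: "mset (canon w) = mset w" for w unfolding canon_def by (rule someI) simp
  have canon_eq: "canon w = canon w' \<longleftrightarrow> mset w = mset w'" for w w'
    using canon unfolding canon_def by metis
  have finS: "finite ?S" using t(1) by (auto simp: tensor_filt_def tensor_carrier)
  \<comment> \<open>Summed over a rearrangement class, the coefficients of \<open>t\<close> give the
    coefficient of one monomial in the symbol. The symbol is zero and distinct monomials are
    independent.\<close>
  have "(\<Sum>w\<in>?S. if canon w = u then t w else 0) = 0" for u
  proof (cases "u \<in> canon ` ?S")
    case True
    have "inj_on mset (canon ` ?S)" by (auto simp: inj_on_def canon canon_eq)
    moreover have "(\<Sum>u\<in>canon ` ?S. (\<Sum>w\<in>?S. if canon w = u then t w else 0) * monomial c u) = 0" for c
    proof -
      obtain v where v: "coord v = c" using coord_surj by blast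
      have "(\<Sum>u\<in>canon ` ?S. (\<Sum>w\<in>?S. if canon w = u then t w else 0) * monomial c u)
        = (\<Sum>u\<in>canon ` ?S. \<Sum>w\<in>?S. if canon w = u then t w * monomial c u else 0)"
        by (auto simp: sum_distrib_right intro!: sum.cong)
      also have "\<dots> = (\<Sum>w\<in>?S. \<Sum>u\<in>canon ` ?S. if canon w = u then t w * monomial c u else 0)" by (rule sum.swap)
      also have "\<dots> = (\<Sum>w\<in>?S. t w * monomial c (canon w))"
        using finS by (intro sum.cong HOL.refl) (simp add: sum.delta')
      also have "\<dots> = (\<Sum>w\<in>?S. t w * monomial c w)"
        by (intro sum.cong HOL.refl) (simp add: monomial_mset[OF canon])
      also have "\<dots> = tensor_symbol n t v"
        unfolding tensor_symbol_def word_sum_def v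
        using t(1) by (intro sum.mono_neutral_cong_left) (auto simp: tensor_filt_def tensor_carrier)
      finally show ?thesis using t(2) by simp
    qed
    ultimately show ?thesis
      using finS True by (intro monomials_independent[of "canon ` ?S" "\<lambda>u. \<Sum>w\<in>?S. if canon w = u then t w else 0"]) auto
  next
    case False
    then show ?thesis by (intro sum.neutral) auto
  qed
  then have top: "(\<Sum>w\<in>?S. tensor_word (t w) (canon w) u) = 0" for u
    by (simp add: tensor_word_def eq_commute[of _ "canon _"])
  let ?L = "{w. t w \<noteq> 0 \<and> length w < n}"
  \<comment> \<open>Top words are replaced by their difference from the canonical word. The
    subtracted terms cancel in total by \<open>top\<close>, so the sum of all \<open>?f w\<close> is
    still \<open>t\<close>.\<close>
  let ?f = "\<lambda>w u. if length w = n then tensor_word (t w) w u - tensor_word (t w) (canon w) u else tensor_word (t w) w u"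
  have f: "?f w \<in> carrier tensor_algebra" for w
    by (cases "length w = n") (simp_all flip: tensor_minus)
  have decomp: "t = (\<lambda>u. \<Sum>w\<in>{w. t w \<noteq> 0}. ?f w u)"
  proof
    fix u
    have fin: "finite {w. t w \<noteq> 0}" using t(1) by (auto simp: tensor_filt_def tensor_carrier)
    have "(\<Sum>w\<in>{w. t w \<noteq> 0}. ?f w u) = (\<Sum>w\<in>{w. t w \<noteq> 0}. tensor_word (t w) w u)
        - (\<Sum>w\<in>{w. t w \<noteq> 0}. if length w = n then tensor_word (t w) (canon w) u else 0)"
      by (subst sum_subtractf[symmetric]) (auto intro!: sum.cong)
    also have "(\<Sum>w\<in>{w. t w \<noteq> 0}. if length w = n then tensor_word (t w) (canon w) u else 0) = 0"
      using top[of u] fin by (simp add: sum.inter_filter[symmetric])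
    also have "(\<Sum>w\<in>{w. t w \<noteq> 0}. tensor_word (t w) w u) = t u"
      using fin by (simp add: tensor_word_def)
    finally show "t u = (\<Sum>w\<in>{w. t w \<noteq> 0}. ?f w u)" by simp
  qed
  have "J (\<lambda>u. \<Sum>w\<in>I. ?f w u) \<and> (\<lambda>u. \<Sum>w\<in>I. ?f w u) \<in> carrier tensor_algebra" if "finite I" "I \<subseteq> {w. t w \<noteq> 0}" for I
    using that
  proof (induction I)
    case empty
    then show ?case using zero zero_closed by (simp add: tensor_zero)
  next
    case (insert w I)
    have "length w \<le> n" using insert.prems t(1) by (auto simp: tensor_filt_def)
    then have "J (?f w)" using lower perm[OF _ canon[symmetric]] by (cases "length w = n") auto
    then show ?case using insert add[OF f _ _, of "\<lambda>u. \<Sum>w\<in>I. ?f w u" w] a_closed[OF f, of "\<lambda>u. \<Sum>w\<in>I. ?f w u" w]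
      by (simp add: tensor_add)
  qed
  moreover have "finite {w. t w \<noteq> 0}" using t(1) by (simp add: tensor_filt_def tensor_carrier)
  ultimately have "J (\<lambda>u. \<Sum>w\<in>{w. t w \<noteq> 0}. ?f w u)" by blast
  then show ?thesis by (subst decomp)
qed

section \<open>Equivariance of the symbol\<close>

context real_rep
begin

text \<open>A basis vector transforms by a column of its matrix, while as a function it is
  precomposed with the inverse action; the transpose in \<open>dual_rep\<close> makes the two
  agree.\<close>

lemma coord_point_act:
  assumes "g \<in> carrier W"
  shows "(\<Sum>l\<in>UNIV. double_matrix W \<rho> g l b * coord v l) = coord (point_act g v) b"
  using assms by (cases b)
    (simp_all add: sum_UNIV_Plus double_matrix_def coord_def point_act_def matrix_vector_mult_def dual_rep_def Finite_Cartesian_Product.transpose_def)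

lemma word_map_monomial_coord:
  "g \<in> carrier W \<Longrightarrow> word_map (double_matrix W \<rho> g) (monomial (coord v)) u = monomial (coord (point_act g v)) u"
  by (simp add: word_map_monomial coord_point_act)

lemma word_map_length:
  "word_map M (\<lambda>w. if length w = n then F w else 0) u = (if length u = n then word_map M F u else 0)"
  unfolding word_map_sum[symmetric] by (auto intro!: sum.cong sum.neutral)

lemma tensor_symbol_equivariant:
  assumes "g \<in> carrier W" "t \<in> tensor_filt n"
  shows "tensor_act W \<rho> g t \<in> tensor_filt n"
    and "tensor_symbol n (tensor_act W \<rho> g t) = polyfun_act W \<rho> g (tensor_symbol n t)"
proof -
  have t: "t \<in> carrier tensor_algebra" using assms by (simp add: tensor_filt_def)
  show "tensor_act W \<rho> g t \<in> tensor_filt n"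
    using assms tensor_map_closed[OF t]
    by (auto simp: tensor_filt_def tensor_act_def elim!: tensor_map_support)
  show "tensor_symbol n (tensor_act W \<rho> g t) = polyfun_act W \<rho> g (tensor_symbol n t)"
  proof
    fix v
    have "word_map (double_matrix W \<rho> g) (\<lambda>w. if length w = n then monomial (coord v) w else 0)
      = (\<lambda>w. if length w = n then monomial (coord (point_act g v)) w else 0)"
      using assms by (simp add: fun_eq_iff word_map_length word_map_monomial_coord)
    then show "tensor_symbol n (tensor_act W \<rho> g t) v = polyfun_act W \<rho> g (tensor_symbol n t) v"
      using t by (simp add: polyfun_act_point tensor_symbol_def tensor_act_def word_sum_tensor_map)
  qed
qed

end

section \<open>Degrees of polynomial functions\<close>

text \<open>A degree bound certified by the way a function is built, so that estimates for operators
  go by rule induction. It is compared with an honest polynomial degree in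
  \<open>degree_le_poly\<close>.\<close>

inductive degree_le :: "nat \<Rightarrow> ((complex ^ 'i) \<times> (complex ^ 'i::finite) \<Rightarrow> complex) \<Rightarrow> bool" where
  const: "degree_le 0 (\<lambda>_. k)"
| x: "degree_le 1 (\<lambda>v. pairing (fst v) x)"
| y: "degree_le 1 (\<lambda>v. pairing y (snd v))"
| add: "degree_le n f \<Longrightarrow> degree_le n f' \<Longrightarrow> degree_le n (\<lambda>v. f v + f' v)"
| mult: "degree_le k f \<Longrightarrow> degree_le n f' \<Longrightarrow> degree_le (k + n) (\<lambda>v. f v * f' v)"
| Suc: "degree_le n f \<Longrightarrow> degree_le (Suc n) f"

lemma degree_le_polyfun: "degree_le n f \<Longrightarrow> f \<in> polyfuns"
proof (induction rule: degree_le.induct)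
  case (x x)
  show ?case using polyfuns.x[of x] by (simp add: case_prod_unfold)
next
  case (y y)
  show ?case using polyfuns.y[of y] by (simp add: case_prod_unfold)
qed (auto intro: polyfuns.intros)

lemma degree_le_mono: "m \<le> n \<Longrightarrow> degree_le m f \<Longrightarrow> degree_le n f"
  by (induction n rule: dec_induct) (auto intro: degree_le.Suc)

lemma polyfun_degree_le: "f \<in> polyfuns \<Longrightarrow> \<exists>n. degree_le n f"
proof (induction rule: polyfuns.induct)
  case (x x)
  show ?case using degree_le.x[of x] by (auto simp: case_prod_unfold)
next
  case (y y)
  show ?case using degree_le.y[of y] by (auto simp: case_prod_unfold)
next
  case (add f f')
  then obtain k n where "degree_le k f" "degree_le n f'" by blast
  then have "degree_le (max k n) f" "degree_le (max k n) f'" by (auto intro: degree_le_mono[rotated])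
  then show ?case using degree_le.add by blast
qed (blast intro: degree_le.intros)+

lemma degree_le_scale: "degree_le n f \<Longrightarrow> degree_le n (\<lambda>v. k * f v)"
  using degree_le.mult[OF degree_le.const] by fastforce

lemma degree_le_zero: "degree_le n (\<lambda>_. 0)"
  by (rule degree_le_mono[OF le0 degree_le.const])

lemma degree_le_subst:
  assumes "degree_le n f"
    and "\<And>x. \<exists>x'. \<forall>v. pairing (fst (T v)) x = pairing (fst v) x'"
    and "\<And>y. \<exists>y'. \<forall>v. pairing y (snd (T v)) = pairing y' (snd v)"
  shows "degree_le n (\<lambda>v. f (T v))"
  using assms(1)
proof induction
  case (x x)
  obtain x' where "\<forall>v. pairing (fst (T v)) x = pairing (fst v) x'" using assms(2) by blast
  then show ?case using degree_le.x[of x'] by (simp del: split_paired_All)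
next
  case (y y)
  obtain y' where "\<forall>v. pairing y (snd (T v)) = pairing y' (snd v)" using assms(3) by blast
  then show ?case using degree_le.y[of y'] by (simp del: split_paired_All)
qed (auto intro: degree_le.intros)

text \<open>Along the line through the origin and \<open>v\<close> the bound becomes the degree of a
  polynomial in one variable, where coefficients can be compared.\<close>

lemma degree_le_poly:
  assumes "degree_le n f"
  shows "\<exists>p. degree p \<le> n \<and> (\<forall>u. f (u *s fst v, u *s snd v) = poly p u)"
  using assms
proof induction
  case (const k)
  show ?case by (rule exI[of _ "[:k:]"]) simp
next
  case (x x)
  show ?case by (rule exI[of _ "[:0, pairing (fst v) x:]"]) (simp add: pairing_linear)
next
  case (y y)
  show ?case by (rule exI[of _ "[:0, pairing y (snd v):]"]) (simp add: pairing_linear)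
next
  case (add n f f')
  then obtain p p' where "degree p \<le> n" "\<forall>u. f (u *s fst v, u *s snd v) = poly p u"
    "degree p' \<le> n" "\<forall>u. f' (u *s fst v, u *s snd v) = poly p' u" by blast
  then show ?case by (intro exI[of _ "p + p'"]) (simp add: degree_add_le)
next
  case (mult k f n f')
  then obtain p p' where "degree p \<le> k" "\<forall>u. f (u *s fst v, u *s snd v) = poly p u"
    "degree p' \<le> n" "\<forall>u. f' (u *s fst v, u *s snd v) = poly p' u" by blast
  then show ?case using degree_mult_le[of p p'] by (intro exI[of _ "p * p'"]) simp
next
  case (Suc n f)
  then show ?case using le_SucI by blast
qed

text \<open>At \<open>n = 0\<close> only the zero function qualifies. This is the convention of
  \<open>filt_pred\<close>, where the step before degree 0 is zero.\<close>

definition degree_less :: "nat \<Rightarrow> ((complex ^ 'i) \<times> (complex ^ 'i::finite) \<Rightarrow> complex) \<Rightarrow> bool" where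
  "degree_less n f = (case n of 0 \<Rightarrow> f = (\<lambda>_. 0) | Suc k \<Rightarrow> degree_le k f)"

lemma degree_less_zero: "degree_less n (\<lambda>_. 0)"
  by (simp add: degree_less_def degree_le_zero split: nat.splits)

lemma degree_less_add: "degree_less n f \<Longrightarrow> degree_less n f' \<Longrightarrow> degree_less n (\<lambda>v. f v + f' v)"
  by (auto simp: degree_less_def intro: degree_le.add split: nat.splits)

lemma degree_less_scale: "degree_less n f \<Longrightarrow> degree_less n (\<lambda>v. k * f v)"
  by (auto simp: degree_less_def intro: degree_le_scale split: nat.splits)

lemma degree_less_diff: "degree_less n f \<Longrightarrow> degree_less n f' \<Longrightarrow> degree_less n (\<lambda>v. f v - f' v)"
  using degree_less_add[of n f, OF _ degree_less_scale[of n f' "-1"]] by simp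

lemma degree_less_sum: "(\<And>i. i \<in> I \<Longrightarrow> degree_less n (f i)) \<Longrightarrow> degree_less n (\<lambda>v. \<Sum>i\<in>I. f i v)"
  by (induction I rule: infinite_finite_induct) (auto intro: degree_less_zero degree_less_add)

lemma degree_less_mult: "degree_le k f \<Longrightarrow> degree_less n f' \<Longrightarrow> degree_less (k + n) (\<lambda>v. f v * f' v)"
  using degree_less_zero[of k] by (cases n) (auto simp: degree_less_def intro: degree_le.mult)

lemma degree_less_imp_le: "degree_less n f \<Longrightarrow> degree_le n f"
  by (cases n) (auto simp: degree_less_def degree_le_zero intro: degree_le.Suc)

lemma degree_less_mono: "m \<le> n \<Longrightarrow> degree_less m f \<Longrightarrow> degree_less n f"
proof (induction n rule: dec_induct)
  case (step n)
  then show ?case using degree_less_imp_le by (simp add: degree_less_def)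
qed

text \<open>On the line through \<open>v\<close> the function is \<open>u ^ n * f v\<close>, yet it
  is given by a polynomial in \<open>u\<close> of degree less than \<open>n\<close>; the coefficient
  of \<open>u ^ n\<close> is therefore zero.\<close>

lemma degree_less_homogeneous:
  assumes "degree_less n f" and hom: "\<And>u v. f (u *s fst v, u *s snd v) = u ^ n * f v"
  shows "f v = 0"
proof (cases n)
  case 0
  then show ?thesis using assms(1) by (simp add: degree_less_def)
next
  case (Suc k)
  then obtain p where p: "degree p \<le> k" "\<forall>u. f (u *s fst v, u *s snd v) = poly p u"
    using assms(1) degree_le_poly by (fastforce simp: degree_less_def)
  then have "poly (Polynomial.monom (f v) n) = poly p" by (auto simp: hom poly_monom fun_eq_iff mult.commute)
  then have "Polynomial.monom (f v) n = p" by (simp add: poly_eq_poly_eq_iff)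
  then have "Polynomial.coeff (Polynomial.monom (f v) n) n = Polynomial.coeff p n" by simp
  then show ?thesis using p(1) Suc by (simp add: coeff_eq_0)
qed

lemma monomial_degree: "degree_le (length w) (\<lambda>v. monomial (coord v) w)"
proof (induction w)
  case (Cons l w)
  have "degree_le 1 (\<lambda>v. coord v l)"
  proof (cases l)
    case (Inl i)
    then show ?thesis using degree_le.y[of "axis i 1"] by (simp add: coord_def pairing_axis)
  next
    case (Inr i)
    then show ?thesis using degree_le.x[of "axis i 1"] by (simp add: coord_def pairing_axis)
  qed
  from degree_le.mult[OF this Cons.IH] show ?case by (simp add: monomial_Cons)
qed (simp add: degree_le.const)

section \<open>Difference quotients\<close>

text \<open>\<open>(f - f \<circ> s) / a\<close> for the reflection \<open>s p = p - (p, a) b\<close>, extended to the hyperplane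
  \<open>a = 0\<close> by the derivative along \<open>b\<close>; for \<open>a = 0\<close> it is this derivative everywhere.\<close>

definition diff_quot ::
    "complex ^ 'i \<Rightarrow> complex ^ 'i \<Rightarrow> ((complex ^ 'i) \<times> (complex ^ 'i::finite) \<Rightarrow> complex)
      \<Rightarrow> (complex ^ 'i) \<times> (complex ^ 'i) \<Rightarrow> complex" where
  "diff_quot a b f v =
     (if pairing (fst v) a = 0 then deriv (\<lambda>t. f (fst v + t *s b, snd v)) 0
      else (f v - f (fst v - pairing (fst v) a *s b, snd v)) / pairing (fst v) a)"

lemma polyfun_has_derivative:
  assumes "f \<in> polyfuns"
  shows "((\<lambda>t. f (p + t *s b, q)) has_field_derivative deriv (\<lambda>t. f (p + t *s b, q)) 0) (at 0)"
proof -
  have "\<exists>D. ((\<lambda>t. f (p + t *s b, q)) has_field_derivative D) (at 0)"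
    using assms
  proof induction
    case (x x)
    show ?case by (rule exI[of _ "pairing b x"]) (auto simp: pairing_linear intro!: derivative_eq_intros)
  next
    case (add f f')
    then show ?case using DERIV_add by blast
  next
    case (mult f f')
    then show ?case using DERIV_mult' by blast
  qed (auto intro: DERIV_const)
  then show ?thesis using DERIV_imp_deriv by blast
qed

lemma diff_quot_const: "diff_quot a b (\<lambda>v. k) = (\<lambda>_. 0)"
  by (simp add: diff_quot_def fun_eq_iff)

lemma diff_quot_x: "diff_quot a b (\<lambda>v. pairing (fst v) x) = (\<lambda>_. pairing b x)"
proof -
  have "((\<lambda>t. pairing (p + t *s b) x) has_field_derivative pairing b x) (at 0)" for p
    by (auto simp: pairing_linear intro!: derivative_eq_intros)
  then have "deriv (\<lambda>t. pairing (p + t *s b) x) 0 = pairing b x" for p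
    by (rule DERIV_imp_deriv)
  then show ?thesis by (auto simp: diff_quot_def fun_eq_iff pairing_linear)
qed

lemma diff_quot_indep:
  assumes "\<And>p p' q. f (p, q) = f (p', q)"
  shows "diff_quot a b f = (\<lambda>_. 0)"
proof -
  have *: "f (p, q) = f (0, q)" for p q by (rule assms)
  have "f v = f (fst v - k *s b, snd v)" for v k
    using *[of "fst v" "snd v"] *[of "fst v - k *s b" "snd v"] by simp
  moreover have "deriv (\<lambda>t. f (fst v + t *s b, snd v)) 0 = 0" for v
  proof -
    have "(\<lambda>t. f (fst v + t *s b, snd v)) = (\<lambda>t. f (0, snd v))" by (rule ext) (rule *)
    then show ?thesis by simp
  qed
  ultimately show ?thesis unfolding diff_quot_def by (intro ext) simp
qed

lemma diff_quot_add:
  assumes "f \<in> polyfuns" "f' \<in> polyfuns"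
  shows "diff_quot a b (\<lambda>v. f v + f' v) = (\<lambda>v. diff_quot a b f v + diff_quot a b f' v)"
proof
  fix v
  have "deriv (\<lambda>t. f (fst v + t *s b, snd v) + f' (fst v + t *s b, snd v)) 0
    = deriv (\<lambda>t. f (fst v + t *s b, snd v)) 0 + deriv (\<lambda>t. f' (fst v + t *s b, snd v)) 0"
    by (intro DERIV_imp_deriv DERIV_add polyfun_has_derivative assms)
  then show "diff_quot a b (\<lambda>v. f v + f' v) v = diff_quot a b f v + diff_quot a b f' v"
    by (simp add: diff_quot_def diff_divide_distrib add_divide_distrib)
qed

text \<open>The twisted Leibniz rule: with \<open>s p = p - (p, a) b\<close>, the difference
  \<open>f f' - (f o s) (f' o s)\<close> equals
  \<open>(f - f o s) f' + (f o s) (f' - f' o s)\<close>. On the hyperplane \<open>s\<close> fixes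
  the point, so the ordinary product rule for \<open>deriv\<close> has the same shape and one
  formula covers both cases.\<close>

lemma diff_quot_mult:
  assumes "f \<in> polyfuns" "f' \<in> polyfuns"
  shows "diff_quot a b (\<lambda>v. f v * f' v) v
    = diff_quot a b f v * f' v + f (fst v - pairing (fst v) a *s b, snd v) * diff_quot a b f' v"
proof -
  have "((\<lambda>t. f (fst v + t *s b, snd v) * f' (fst v + t *s b, snd v)) has_field_derivative
      f (fst v + 0 *s b, snd v) * deriv (\<lambda>t. f' (fst v + t *s b, snd v)) 0
      + deriv (\<lambda>t. f (fst v + t *s b, snd v)) 0 * f' (fst v + 0 *s b, snd v)) (at 0)"
    by (intro DERIV_mult' polyfun_has_derivative assms)
  then have "deriv (\<lambda>t. f (fst v + t *s b, snd v) * f' (fst v + t *s b, snd v)) 0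
    = deriv (\<lambda>t. f (fst v + t *s b, snd v)) 0 * f' v + f v * deriv (\<lambda>t. f' (fst v + t *s b, snd v)) 0"
    by (auto dest!: DERIV_imp_deriv)
  then show ?thesis by (simp add: diff_quot_def field_simps)
qed

text \<open>Instead of showing that the linear form of \<open>a\<close> divides
  \<open>f - f o s\<close>, the twisted Leibniz rule is applied along the construction of
  \<open>f\<close>. That the quotient is again polynomial comes out as a by-product.\<close>

lemma degree_less_diff_quot: "degree_le n f \<Longrightarrow> degree_less n (diff_quot a b f)"
proof (induction rule: degree_le.induct)
  case (const k)
  show ?case by (simp add: diff_quot_const degree_less_zero)
next
  case (x x)
  show ?case by (simp add: diff_quot_x degree_less_def degree_le.const)
next
  case (y y)
  have "diff_quot a b (\<lambda>v. pairing y (snd v)) = (\<lambda>_. 0)" by (rule diff_quot_indep) simp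
  then show ?case by (simp add: degree_less_zero)
next
  case (add n f f')
  then show ?case
    by (simp add: diff_quot_add degree_le_polyfun[OF add.hyps(1)] degree_le_polyfun[OF add.hyps(2)] degree_less_add)
next
  case (mult k f n f')
  have "degree_le k (\<lambda>v. f (fst v - pairing (fst v) a *s b, snd v))"
  proof (rule degree_le_subst[OF mult.hyps(1)])
    \<comment> \<open>The witness is the image of \<open>x\<close> under the transpose of
      \<open>p - (p, a) b\<close>.\<close>
    show "\<exists>x'. \<forall>v. pairing (fst (fst v - pairing (fst v) a *s b, snd v)) x = pairing (fst v) x'" for x
      by (rule exI[of _ "x - pairing b x *s a"]) (simp add: pairing_linear mult.commute)
  qed auto
  moreover have "degree_less (k + n) (\<lambda>v. diff_quot a b f v * f' v)"
    using degree_less_mult[OF mult.hyps(2) mult.IH(1)] by (simp add: add.commute mult.commute)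
  ultimately have "degree_less (k + n) (\<lambda>v. diff_quot a b f v * f' v
    + f (fst v - pairing (fst v) a *s b, snd v) * diff_quot a b f' v)"
    using degree_less_mult mult.IH(2) degree_less_add by blast
  then show ?case
    unfolding diff_quot_mult[OF degree_le_polyfun[OF mult.hyps(1)] degree_le_polyfun[OF mult.hyps(2)]] .
next
  case (Suc n f)
  then show ?case using degree_less_mono[of n "Suc n"] by simp
qed

lemma diff_quot_polyfun: "f \<in> polyfuns \<Longrightarrow> diff_quot a b f \<in> polyfuns"
  using polyfun_degree_le degree_less_diff_quot degree_less_imp_le degree_le_polyfun by blast

lemma diff_quot_scale:
  assumes "f \<in> polyfuns"
  shows "diff_quot a b (\<lambda>v. k * f v) = (\<lambda>v. k * diff_quot a b f v)"
  using diff_quot_mult[OF polyfuns.const assms, of a b k] by (simp add: fun_eq_iff diff_quot_const)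

lemma deriv_chain_scale:
  assumes "f \<in> polyfuns"
  shows "deriv (\<lambda>t. f (p + t *s (k *s b), q)) 0 = k * deriv (\<lambda>t. f (p + t *s b, q)) 0"
proof -
  have "((\<lambda>t. f (p + t *s b, q)) has_field_derivative deriv (\<lambda>t. f (p + t *s b, q)) 0) (at (k * 0))"
    using polyfun_has_derivative[OF assms] by simp
  from DERIV_chain2[where g = "\<lambda>t. k * t" and x = 0 and s = UNIV and Db = k, OF this]
  have "((\<lambda>t. f (p + (k * t) *s b, q)) has_field_derivative deriv (\<lambda>t. f (p + t *s b, q)) 0 * k) (at 0)"
    by (auto intro: derivative_eq_intros)
  then show ?thesis by (auto simp: vector_smult_assoc mult.commute dest!: DERIV_imp_deriv)
qed

text \<open>A reflection determines its root and coroot only up to inverse scalars. The scalar by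
  which the difference quotient changes is compensated by the factor \<open>pairing w a\<close>, so
  a term of the Dunkl operator depends on the reflection alone.\<close>

lemma diff_quot_rank_one:
  assumes f: "f \<in> polyfuns" and eq: "\<And>v. pairing v a *s b = pairing v a' *s b'"
    and nz: "a \<noteq> 0" "b \<noteq> 0" "b' \<noteq> 0"
  shows "pairing w a * diff_quot a b f v = pairing w a' * diff_quot a' b' f v"
proof -
  obtain i where i: "a $ i \<noteq> 0" using nz(1) by (auto simp: vec_eq_iff)
  obtain j where j: "b' $ j \<noteq> 0" using nz(3) by (auto simp: vec_eq_iff)
  \<comment> \<open>Comparing the two rank-one maps at a nonzero coordinate of \<open>a\<close>
    gives \<open>b = k b'\<close>; comparison at a nonzero coordinate of \<open>b'\<close> then
    shows that \<open>a'\<close> pairs as \<open>k a\<close>.\<close>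
  define k where "k = a' $ i / a $ i"
  have "a $ i *s b = a' $ i *s b'" using eq[of "axis i 1"] by (simp add: pairing_axis)
  then have "(1 / a $ i) *s (a $ i *s b) = (1 / a $ i) *s (a' $ i *s b')" by simp
  then have b: "b = k *s b'" using i by (simp add: k_def vector_smult_assoc)
  have k: "k \<noteq> 0" using b nz(2) by auto
  have a: "pairing u a' = k * pairing u a" for u
  proof -
    have "pairing u a * k * b' $ j = pairing u a' * b' $ j"
      using arg_cong[OF eq[of u], of "\<lambda>x. x $ j"] b by simp
    then show ?thesis using j by (simp add: mult.commute)
  qed
  have "diff_quot a b f v = k * diff_quot a' b' f v"
  proof (cases "pairing (fst v) a = 0")
    case True
    then show ?thesis using deriv_chain_scale[OF f] by (simp add: diff_quot_def a b)
  next
    case False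
    then show ?thesis using k by (simp add: diff_quot_def a b vector_smult_assoc mult.commute)
  qed
  then show ?thesis by (simp add: a)
qed

text \<open>For \<open>a = 0\<close> the quotient is the derivative along the second argument, hence
  linear in it. The combination is the one a reflection produces; with the sign of \<open>k\<close>
  reversed it also serves for sums.\<close>

lemma diff_quot_zero_linear:
  assumes "f \<in> polyfuns"
  shows "diff_quot 0 (y - k *s b) f v = diff_quot 0 y f v - k * diff_quot 0 b f v"
  using assms
proof (induction arbitrary: v)
  case (const k)
  then show ?case by (simp add: diff_quot_const)
next
  case (x x)
  then show ?case by (simp add: case_prod_unfold diff_quot_x pairing_linear)
next
  case (y y)
  have "diff_quot a b (\<lambda>v. pairing y (snd v)) = (\<lambda>_. 0)" for a b by (rule diff_quot_indep) simp
  then show ?case by (simp add: case_prod_unfold)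
next
  case (add f f')
  then show ?case by (simp add: diff_quot_add algebra_simps)
next
  case (mult f f')
  show ?case
    unfolding diff_quot_mult[OF mult.hyps] mult.IH by (simp add: pairing_linear algebra_simps)
qed

section \<open>Dunkl operators\<close>

type_synonym ('g, 'i) twisted_fun = "'g \<Rightarrow> (complex ^ 'i) \<times> (complex ^ 'i) \<Rightarrow> complex"

text \<open>\<open>z\<close> is a value for \<open>\<hbar>\<close>.\<close>

locale dunkl = real_rep W \<rho>
  for W :: "('g, 'z) monoid_scheme" and \<rho> :: "'g \<Rightarrow> real ^ 'i ^ 'i::finite" +
  fixes S :: "'g set" and \<alpha> \<alpha>v :: "'g \<Rightarrow> complex ^ 'i" and c :: "'g \<Rightarrow> complex" and z :: complex
  assumes S_subset: "S \<subseteq> carrier W"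
    and S_conj: "g \<in> carrier W \<Longrightarrow> s \<in> S \<Longrightarrow> g \<otimes>\<^bsub>W\<^esub> s \<otimes>\<^bsub>W\<^esub> inv\<^bsub>W\<^esub> g \<in> S"
    and c_conj: "g \<in> carrier W \<Longrightarrow> s \<in> S \<Longrightarrow> c (g \<otimes>\<^bsub>W\<^esub> s \<otimes>\<^bsub>W\<^esub> inv\<^bsub>W\<^esub> g) = c s"
    and roots_nonzero: "s \<in> S \<Longrightarrow> \<alpha> s \<noteq> 0" "s \<in> S \<Longrightarrow> \<alpha>v s \<noteq> 0"
    and reflection: "s \<in> S \<Longrightarrow> rep \<rho> s *v y = y - pairing y (\<alpha> s) *s \<alpha>v s"
      "s \<in> S \<Longrightarrow> rep \<rho> (inv\<^bsub>W\<^esub> s) *v y = y - pairing y (\<alpha> s) *s \<alpha>v s"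
begin

text \<open>The function \<open>m\<close> stands for \<open>\<Sum>h\<in>W. m h \<cdot> h\<close> in \<open>\<complex>[\<hh> \<oplus> \<hh>\<^sup>*] \<rtimes> W\<close>, on which \<open>W\<close> acts by left
  multiplication.\<close>

definition U :: "('g, 'i) twisted_fun set" where
  "U = {m. (\<forall>h. m h \<in> polyfuns) \<and> (\<forall>h. h \<notin> carrier W \<longrightarrow> m h = (\<lambda>_. 0))}"

definition XX :: "complex ^ 'i \<Rightarrow> ('g, 'i) twisted_fun \<Rightarrow> ('g, 'i) twisted_fun" where
  "XX x m = (\<lambda>h v. pairing (fst v) x * m h v)"

definition GG :: "'g \<Rightarrow> ('g, 'i) twisted_fun \<Rightarrow> ('g, 'i) twisted_fun" where
  "GG g m = (\<lambda>h v. if h \<in> carrier W then m (inv\<^bsub>W\<^esub> g \<otimes>\<^bsub>W\<^esub> h) (point_act g v) else 0)"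

text \<open>\<open>JJ s\<close> commutes with multiplication by the coordinates of \<open>\<hh>\<close> and differs from \<open>GG s\<close> by the
  reflection \<open>s\<close> in the variable \<open>p \<in> \<hh>\<close>, so that \<open>diff_quot (\<alpha> s) (\<alpha>v s) \<circ> JJ s\<close> is
  \<open>(JJ s - GG s) / \<alpha>\<^sub>s\<close>.\<close>

definition JJ :: "'g \<Rightarrow> ('g, 'i) twisted_fun \<Rightarrow> ('g, 'i) twisted_fun" where
  "JJ g m = (\<lambda>h v. if h \<in> carrier W
     then m (inv\<^bsub>W\<^esub> g \<otimes>\<^bsub>W\<^esub> h) (fst v, dual_rep W \<rho> (inv\<^bsub>W\<^esub> g) *v snd v) else 0)"

text \<open>A Dunkl operator in \<open>p\<close>, with \<open>z\<close> in front of the derivative,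
  plus multiplication by the linear function \<open>pairing y (snd v)\<close>. The added term
  carries the symbol of \<open>y\<close>: the derivative and the difference quotients only lower
  degree.\<close>

definition YY :: "complex ^ 'i \<Rightarrow> ('g, 'i) twisted_fun \<Rightarrow> ('g, 'i) twisted_fun" where
  "YY y m = (\<lambda>h v. z * diff_quot 0 y (m h) v + pairing y (snd v) * m h v
     - (\<Sum>s\<in>S. c s * pairing y (\<alpha> s) * diff_quot (\<alpha> s) (\<alpha>v s) (JJ s m h) v))"

text \<open>Linearity is claimed on \<open>U\<close> only, because \<open>deriv\<close> is additive
  only where the derivatives are known to exist.\<close>

definition linear_op :: "(('g, 'i) twisted_fun \<Rightarrow> ('g, 'i) twisted_fun) \<Rightarrow> bool" where
  "linear_op T \<longleftrightarrow> (\<forall>m\<in>U. T m \<in> U)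
     \<and> (\<forall>m\<in>U. \<forall>n\<in>U. T (\<lambda>h v. m h v + n h v) = (\<lambda>h v. T m h v + T n h v))
     \<and> (\<forall>k. \<forall>m\<in>U. T (\<lambda>h v. k * m h v) = (\<lambda>h v. k * T m h v))"

section \<open>Linearity and degree of the operators\<close>

lemma U_polyfun: "m \<in> U \<Longrightarrow> m h \<in> polyfuns"
  by (simp add: U_def)

lemma U_add: "m \<in> U \<Longrightarrow> n \<in> U \<Longrightarrow> (\<lambda>h v. m h v + n h v) \<in> U"
  and U_scale: "m \<in> U \<Longrightarrow> (\<lambda>h v. k * m h v) \<in> U"
  and U_zero: "(\<lambda>h v. 0) \<in> U"
  unfolding U_def by (simp_all add: polyfuns.const polyfuns.add polyfuns.mult[OF polyfuns.const])

lemma U_sum: "(\<And>i. i \<in> I \<Longrightarrow> m i \<in> U) \<Longrightarrow> (\<lambda>h v. \<Sum>i\<in>I. m i h v) \<in> U"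
  by (induction I rule: infinite_finite_induct) (auto simp: U_zero U_add)

lemma linear_opD:
  assumes "linear_op T"
  shows "m \<in> U \<Longrightarrow> T m \<in> U"
    and "m \<in> U \<Longrightarrow> n \<in> U \<Longrightarrow> T (\<lambda>h v. m h v + n h v) = (\<lambda>h v. T m h v + T n h v)"
    and "m \<in> U \<Longrightarrow> T (\<lambda>h v. k * m h v) = (\<lambda>h v. k * T m h v)"
  using assms by (auto simp: linear_op_def)

lemma linear_op_sum:
  assumes "linear_op T" "\<And>i. i \<in> I \<Longrightarrow> m i \<in> U"
  shows "T (\<lambda>h v. \<Sum>i\<in>I. k i * m i h v) = (\<lambda>h v. \<Sum>i\<in>I. k i * T (m i) h v)"
proof -
  have z: "T (\<lambda>h v. 0) = (\<lambda>h v. 0)" using linear_opD(3)[OF assms(1) U_zero, of 0] by simp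
  show ?thesis using assms(2)
  proof (induction I rule: infinite_finite_induct)
    case (insert i I)
    have "T (\<lambda>h v. k i * m i h v + (\<Sum>i\<in>I. k i * m i h v))
      = (\<lambda>h v. T (\<lambda>h v. k i * m i h v) h v + T (\<lambda>h v. \<Sum>i\<in>I. k i * m i h v) h v)"
      using insert.prems by (intro linear_opD(2)[OF assms(1)] U_scale U_sum) auto
    then show ?case
      using insert linear_opD(3)[OF assms(1), of "m i" "k i"] by simp
  qed (simp_all add: z)
qed

lemma degree_le_point_act:
  assumes "g \<in> carrier W" "degree_le n f"
  shows "degree_le n (\<lambda>v. f (point_act g v))"
proof (rule degree_le_subst[OF assms(2)])
  show "\<exists>x'. \<forall>v. pairing (fst (point_act g v)) x = pairing (fst v) x'" for x
    using assms(1) by (intro exI[of _ "dual_rep W \<rho> g *v x"]) (simp add: point_act_def pairing_rep)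
  show "\<exists>y'. \<forall>v. pairing y (snd (point_act g v)) = pairing y' (snd v)" for y
    using assms(1) by (intro exI[of _ "rep \<rho> g *v y"]) (simp add: point_act_def pairing_rep)
qed

lemma degree_le_snd_act:
  assumes "g \<in> carrier W" "degree_le n f"
  shows "degree_le n (\<lambda>v. f (fst v, dual_rep W \<rho> (inv\<^bsub>W\<^esub> g) *v snd v))"
proof (rule degree_le_subst[OF assms(2)])
  show "\<exists>y'. \<forall>v. pairing y (snd (fst v, dual_rep W \<rho> (inv\<^bsub>W\<^esub> g) *v snd v)) = pairing y' (snd v)" for y
    using assms(1) by (intro exI[of _ "rep \<rho> g *v y"]) (simp add: pairing_rep)
qed auto

lemma degree_le_JJ:
  assumes "g \<in> carrier W" "\<And>h. degree_le n (m h)"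
  shows "degree_le n (JJ g m h)"
  using degree_le_snd_act[OF assms(1) assms(2)[of "inv\<^bsub>W\<^esub> g \<otimes>\<^bsub>W\<^esub> h"]]
  unfolding JJ_def by (cases "h \<in> carrier W") (simp_all add: degree_le_zero)

lemma GG_closed: "g \<in> carrier W \<Longrightarrow> m \<in> U \<Longrightarrow> GG g m \<in> U"
proof -
  assume g: "g \<in> carrier W" and m: "m \<in> U"
  have "GG g m h \<in> polyfuns" for h
  proof -
    obtain n where "degree_le n (m (inv\<^bsub>W\<^esub> g \<otimes>\<^bsub>W\<^esub> h))" using polyfun_degree_le[OF U_polyfun[OF m]] by blast
    from degree_le_polyfun[OF degree_le_point_act[OF g this]] show ?thesis
      by (cases "h \<in> carrier W") (simp_all add: GG_def polyfuns.const)
  qed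
  then show ?thesis by (simp add: U_def) (simp add: GG_def)
qed

lemma JJ_closed: "g \<in> carrier W \<Longrightarrow> m \<in> U \<Longrightarrow> JJ g m \<in> U"
proof -
  assume g: "g \<in> carrier W" and m: "m \<in> U"
  have "JJ g m h \<in> polyfuns" for h
  proof -
    obtain n where "degree_le n (m (inv\<^bsub>W\<^esub> g \<otimes>\<^bsub>W\<^esub> h))" using polyfun_degree_le[OF U_polyfun[OF m]] by blast
    from degree_le_polyfun[OF degree_le_snd_act[OF g this]] show ?thesis
      by (cases "h \<in> carrier W") (simp_all add: JJ_def polyfuns.const)
  qed
  then show ?thesis by (simp add: U_def) (simp add: JJ_def)
qed

lemma S_carrier [simp]: "s \<in> S \<Longrightarrow> s \<in> carrier W"
  using S_subset by auto

lemma linear_op_GG: "g \<in> carrier W \<Longrightarrow> linear_op (GG g)"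
  unfolding linear_op_def by (auto simp: GG_closed) (auto simp: GG_def fun_eq_iff)

lemma linear_op_XX: "linear_op (XX x)"
proof -
  have "XX x m \<in> U" if "m \<in> U" for m
    using that polyfuns.mult[OF degree_le_polyfun[OF degree_le.x[of x]] U_polyfun[OF that]]
    by (simp add: U_def XX_def)
  then show ?thesis
    unfolding linear_op_def by auto (auto simp: XX_def fun_eq_iff algebra_simps)
qed

lemma JJ_add: "JJ g (\<lambda>h v. m h v + n h v) h = (\<lambda>v. JJ g m h v + JJ g n h v)"
  and JJ_scale: "JJ g (\<lambda>h v. k * m h v) h = (\<lambda>v. k * JJ g m h v)"
  by (auto simp: JJ_def)

lemma YY_closed: "m \<in> U \<Longrightarrow> YY y m \<in> U"
proof -
  assume m: "m \<in> U"
  have "YY y m h \<in> polyfuns" for h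
  proof -
    have 1: "(\<lambda>v. z * diff_quot 0 y (m h) v) \<in> polyfuns"
      using m by (intro polyfuns.mult polyfuns.const diff_quot_polyfun) (simp add: U_polyfun)
    have 2: "(\<lambda>v. pairing y (snd v) * m h v) \<in> polyfuns"
      using m by (intro polyfuns.mult degree_le_polyfun[OF degree_le.y]) (simp add: U_polyfun)
    have 3: "(\<lambda>v. \<Sum>s\<in>S. c s * pairing y (\<alpha> s) * diff_quot (\<alpha> s) (\<alpha>v s) (JJ s m h) v) \<in> polyfuns"
      using m by (intro polyfun_sum polyfuns.mult polyfuns.const diff_quot_polyfun) (simp add: JJ_closed U_polyfun)
    show ?thesis
      using polyfuns.add[OF polyfuns.add[OF 1 2] polyfun_uminus[OF 3]] by (simp add: YY_def)
  qed
  moreover have "YY y m h = (\<lambda>_. 0)" if "h \<notin> carrier W" for h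
    using that m by (simp add: YY_def JJ_def U_def diff_quot_const)
  ultimately show ?thesis by (simp add: U_def)
qed

lemma linear_op_YY: "linear_op (YY y)"
  unfolding linear_op_def
proof (intro conjI ballI allI)
  fix m n k assume m: "m \<in> U"
  show "YY y m \<in> U" using m by (rule YY_closed)
  show "YY y (\<lambda>h v. k * m h v) = (\<lambda>h v. k * YY y m h v)"
    using m by (simp add: YY_def JJ_scale diff_quot_scale U_polyfun JJ_closed fun_eq_iff algebra_simps sum_distrib_left)
  assume n: "n \<in> U"
  show "YY y (\<lambda>h v. m h v + n h v) = (\<lambda>h v. YY y m h v + YY y n h v)"
    using m n by (simp add: YY_def JJ_add diff_quot_add U_polyfun JJ_closed fun_eq_iff algebra_simps sum.distrib)
qed

section \<open>Commutation relations of the operators\<close>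

lemma GG_mult:
  assumes "g \<in> carrier W" "h \<in> carrier W"
  shows "GG (g \<otimes>\<^bsub>W\<^esub> h) m = GG g (GG h m)"
proof -
  have "point_act (g \<otimes>\<^bsub>W\<^esub> h) v = point_act h (point_act g v)" for v
    using assms by (simp add: point_act_def W.inv_mult_group rep_mult dual_rep_mult matrix_vector_mul_assoc)
  then show ?thesis
    using assms by (auto simp: GG_def fun_eq_iff W.inv_mult_group W.m_assoc)
qed

lemma GG_XX: "g \<in> carrier W \<Longrightarrow> GG g (XX x m) = XX (dual_rep W \<rho> g *v x) (GG g m)"
  by (auto simp: GG_def XX_def fun_eq_iff point_act_def pairing_rep)

text \<open>The defining relation for \<open>[y, x]\<close>. In the twisted Leibniz rule for
  \<open>JJ s m\<close> times the linear function \<open>x\<close>, the second term is the reflected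
  \<open>JJ s m\<close>, which is \<open>GG s m\<close>, times the constant
  \<open>pairing (\<alpha>v s) x\<close>; the derivative contributes the term with
  \<open>z\<close>.\<close>

lemma YY_XX:
  assumes m: "m \<in> U"
  shows "YY y (XX x m) h v = XX x (YY y m) h v + z * pairing y x * m h v
    - (\<Sum>s\<in>S. c s * pairing y (\<alpha> s) * pairing (\<alpha>v s) x * GG s m h v)"
proof -
  have dx: "degree_le 1 (\<lambda>v. pairing (fst v) x)" by (rule degree_le.x)
  have a: "diff_quot 0 y (XX x m h) v = diff_quot 0 y (m h) v * pairing (fst v) x + m h v * pairing y x"
    using diff_quot_mult[OF U_polyfun[OF m] degree_le_polyfun[OF dx], of 0 y h v]
    by (simp add: XX_def mult.commute pairing_linear diff_quot_x)
  have b: "diff_quot (\<alpha> s) (\<alpha>v s) (JJ s (XX x m) h) v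
      = diff_quot (\<alpha> s) (\<alpha>v s) (JJ s m h) v * pairing (fst v) x + GG s m h v * pairing (\<alpha>v s) x"
    if s: "s \<in> S" for s
  proof -
    have "JJ s (XX x m) h = (\<lambda>v. JJ s m h v * pairing (fst v) x)"
      by (auto simp: JJ_def XX_def)
    moreover have "JJ s m h (fst v - pairing (fst v) (\<alpha> s) *s \<alpha>v s, snd v) = GG s m h v"
      using s by (simp add: JJ_def GG_def point_act_def reflection)
    ultimately show ?thesis
      using diff_quot_mult[OF U_polyfun[OF JJ_closed[OF S_carrier[OF s] m]] degree_le_polyfun[OF dx], of "\<alpha> s" "\<alpha>v s" h v]
      by (simp add: diff_quot_x)
  qed
  have "(\<Sum>s\<in>S. c s * pairing y (\<alpha> s) * diff_quot (\<alpha> s) (\<alpha>v s) (JJ s (XX x m) h) v)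
    = pairing (fst v) x * (\<Sum>s\<in>S. c s * pairing y (\<alpha> s) * diff_quot (\<alpha> s) (\<alpha>v s) (JJ s m h) v)
      + (\<Sum>s\<in>S. c s * pairing y (\<alpha> s) * pairing (\<alpha>v s) x * GG s m h v)"
    unfolding sum_distrib_left sum.distrib[symmetric] by (intro sum.cong HOL.refl) (simp add: b algebra_simps)
  then show ?thesis by (simp add: YY_def a) (simp add: XX_def algebra_simps)
qed

lemma diff_quot_point_act:
  assumes g: "g \<in> carrier W"
  shows "diff_quot a b f (point_act g v)
    = diff_quot (dual_rep W \<rho> g *v a) (rep \<rho> g *v b) (\<lambda>v. f (point_act g v)) v"
proof -
  have "rep \<rho> (inv\<^bsub>W\<^esub> g) *v (p + t *s (rep \<rho> g *v b)) = rep \<rho> (inv\<^bsub>W\<^esub> g) *v p + t *s b" for p t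
    using g by (simp add: matrix_vector_right_distrib vector_scalar_commute rep_inv)
  moreover have "rep \<rho> (inv\<^bsub>W\<^esub> g) *v (p - t *s (rep \<rho> g *v b)) = rep \<rho> (inv\<^bsub>W\<^esub> g) *v p - t *s b" for p t
    using g by (simp add: matrix_vector_mult_diff_distrib vector_scalar_commute rep_inv)
  ultimately show ?thesis
    using g by (simp add: diff_quot_def point_act_def pairing_rep)
qed

lemma conj_bij:
  assumes g: "g \<in> carrier W"
  shows "bij_betw (\<lambda>s. g \<otimes>\<^bsub>W\<^esub> s \<otimes>\<^bsub>W\<^esub> inv\<^bsub>W\<^esub> g) S S"
proof (rule bij_betw_byWitness[where f' = "\<lambda>s. inv\<^bsub>W\<^esub> g \<otimes>\<^bsub>W\<^esub> s \<otimes>\<^bsub>W\<^esub> g"])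
  have e: "a \<otimes>\<^bsub>W\<^esub> (inv\<^bsub>W\<^esub> a \<otimes>\<^bsub>W\<^esub> b) = b" "inv\<^bsub>W\<^esub> a \<otimes>\<^bsub>W\<^esub> (a \<otimes>\<^bsub>W\<^esub> b) = b"
    if "a \<in> carrier W" "b \<in> carrier W" for a b
    using that by (simp_all add: W.m_assoc[symmetric])
  show "\<forall>s\<in>S. inv\<^bsub>W\<^esub> g \<otimes>\<^bsub>W\<^esub> (g \<otimes>\<^bsub>W\<^esub> s \<otimes>\<^bsub>W\<^esub> inv\<^bsub>W\<^esub> g) \<otimes>\<^bsub>W\<^esub> g = s"
    "\<forall>s\<in>S. g \<otimes>\<^bsub>W\<^esub> (inv\<^bsub>W\<^esub> g \<otimes>\<^bsub>W\<^esub> s \<otimes>\<^bsub>W\<^esub> g) \<otimes>\<^bsub>W\<^esub> inv\<^bsub>W\<^esub> g = s"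
    using g by (auto simp: W.m_assoc e)
  show "(\<lambda>s. g \<otimes>\<^bsub>W\<^esub> s \<otimes>\<^bsub>W\<^esub> inv\<^bsub>W\<^esub> g) ` S \<subseteq> S" using S_conj g by auto
  show "(\<lambda>s. inv\<^bsub>W\<^esub> g \<otimes>\<^bsub>W\<^esub> s \<otimes>\<^bsub>W\<^esub> g) ` S \<subseteq> S" using S_conj[of "inv\<^bsub>W\<^esub> g"] g by auto
qed

text \<open>Conjugation by \<open>g\<close> permutes \<open>S\<close> and preserves
  \<open>c\<close>. The transported pair of root and coroot need not be the pair chosen for the
  conjugate reflection, but it defines the same rank-one map, so \<open>diff_quot_rank_one\<close>
  identifies the two terms.\<close>

lemma GG_YY:
  assumes g: "g \<in> carrier W" and m: "m \<in> U"
  shows "GG g (YY y m) = YY (rep \<rho> g *v y) (GG g m)"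
proof (intro ext)
  fix h v
  show "GG g (YY y m) h v = YY (rep \<rho> g *v y) (GG g m) h v"
  proof (cases "h \<in> carrier W")
    case False
    then show ?thesis by (simp add: GG_def YY_def JJ_def diff_quot_const)
  next
    case h: True
    let ?h = "inv\<^bsub>W\<^esub> g \<otimes>\<^bsub>W\<^esub> h"
    have Gm: "GG g m h = (\<lambda>v. m ?h (point_act g v))" using h by (simp add: GG_def)
    have 1: "diff_quot 0 y (m ?h) (point_act g v) = diff_quot 0 (rep \<rho> g *v y) (GG g m h) v"
      unfolding Gm by (simp add: diff_quot_point_act[OF g])
    have 2: "pairing y (snd (point_act g v)) = pairing (rep \<rho> g *v y) (snd v)"
      using g by (simp add: point_act_def pairing_rep)
    have 3: "c s * pairing y (\<alpha> s) * diff_quot (\<alpha> s) (\<alpha>v s) (JJ s m ?h) (point_act g v)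
      = c (g \<otimes>\<^bsub>W\<^esub> s \<otimes>\<^bsub>W\<^esub> inv\<^bsub>W\<^esub> g) * pairing (rep \<rho> g *v y) (\<alpha> (g \<otimes>\<^bsub>W\<^esub> s \<otimes>\<^bsub>W\<^esub> inv\<^bsub>W\<^esub> g))
        * diff_quot (\<alpha> (g \<otimes>\<^bsub>W\<^esub> s \<otimes>\<^bsub>W\<^esub> inv\<^bsub>W\<^esub> g)) (\<alpha>v (g \<otimes>\<^bsub>W\<^esub> s \<otimes>\<^bsub>W\<^esub> inv\<^bsub>W\<^esub> g))
            (JJ (g \<otimes>\<^bsub>W\<^esub> s \<otimes>\<^bsub>W\<^esub> inv\<^bsub>W\<^esub> g) (GG g m) h) v" if s: "s \<in> S" for s
    proof -
      let ?s = "g \<otimes>\<^bsub>W\<^esub> s \<otimes>\<^bsub>W\<^esub> inv\<^bsub>W\<^esub> g"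
      have s': "?s \<in> S" using S_conj g s by simp
      have inv: "inv\<^bsub>W\<^esub> ?s = g \<otimes>\<^bsub>W\<^esub> (inv\<^bsub>W\<^esub> s \<otimes>\<^bsub>W\<^esub> inv\<^bsub>W\<^esub> g)"
        using g s by (simp add: W.inv_mult_group W.m_assoc)
      have J: "(\<lambda>v. JJ s m ?h (point_act g v)) = JJ ?s (GG g m) h"
      proof
        fix v
        have "inv\<^bsub>W\<^esub> g \<otimes>\<^bsub>W\<^esub> (inv\<^bsub>W\<^esub> ?s \<otimes>\<^bsub>W\<^esub> h) = inv\<^bsub>W\<^esub> s \<otimes>\<^bsub>W\<^esub> ?h"
          unfolding inv using g s h by (simp add: W.m_assoc) (simp flip: W.m_assoc)
        moreover have "dual_rep W \<rho> (inv\<^bsub>W\<^esub> s) *v (dual_rep W \<rho> (inv\<^bsub>W\<^esub> g) *v q)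
          = dual_rep W \<rho> (inv\<^bsub>W\<^esub> g) *v (dual_rep W \<rho> (inv\<^bsub>W\<^esub> ?s) *v q)" for q
          unfolding inv using g s by (simp add: dual_rep_mult dual_rep_inv flip: matrix_vector_mul_assoc)
        ultimately show "JJ s m ?h (point_act g v) = JJ ?s (GG g m) h v"
          using g s h s' by (simp add: JJ_def GG_def point_act_def)
      qed
      have "pairing v (dual_rep W \<rho> g *v \<alpha> s) *s (rep \<rho> g *v \<alpha>v s) = pairing v (\<alpha> ?s) *s \<alpha>v ?s" for v
      proof -
        \<comment> \<open>The action of the inverse of \<open>?s\<close>, written once through its
          own roots and once as a conjugate of the inverse of \<open>s\<close>; cancelling
          \<open>v\<close> leaves equal rank-one maps.\<close>
        have "v - pairing v (\<alpha> ?s) *s \<alpha>v ?s = rep \<rho> g *v (rep \<rho> (inv\<^bsub>W\<^esub> s) *v (rep \<rho> (inv\<^bsub>W\<^esub> g) *v v))"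
          unfolding reflection(2)[OF s', symmetric] inv using g s by (simp add: rep_mult flip: matrix_vector_mul_assoc)
        also have "\<dots> = v - pairing v (dual_rep W \<rho> g *v \<alpha> s) *s (rep \<rho> g *v \<alpha>v s)"
          using g s by (simp add: reflection matrix_vector_mult_diff_distrib vector_scalar_commute rep_inv pairing_rep)
        finally show ?thesis by simp
      qed
      moreover have "dual_rep W \<rho> g *v \<alpha> s \<noteq> 0" "rep \<rho> g *v \<alpha>v s \<noteq> 0"
        using roots_nonzero[OF s] dual_rep_inv(1)[OF g, of "\<alpha> s"] rep_inv(1)[OF g, of "\<alpha>v s"] by auto
      ultimately have "pairing (rep \<rho> g *v y) (dual_rep W \<rho> g *v \<alpha> s)
          * diff_quot (dual_rep W \<rho> g *v \<alpha> s) (rep \<rho> g *v \<alpha>v s) (JJ ?s (GG g m) h) v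
        = pairing (rep \<rho> g *v y) (\<alpha> ?s) * diff_quot (\<alpha> ?s) (\<alpha>v ?s) (JJ ?s (GG g m) h) v"
        using s' roots_nonzero[OF s'] g m by (intro diff_quot_rank_one U_polyfun JJ_closed GG_closed) auto
      moreover have "pairing (rep \<rho> g *v y) (dual_rep W \<rho> g *v \<alpha> s) = pairing y (\<alpha> s)"
        using g by (simp add: pairing_rep[symmetric] rep_inv)
      ultimately show ?thesis
        using diff_quot_point_act[OF g, of "\<alpha> s" "\<alpha>v s" "JJ s m ?h" v] c_conj[OF g s] by (simp add: J)
    qed
    have "(\<Sum>s\<in>S. c s * pairing y (\<alpha> s) * diff_quot (\<alpha> s) (\<alpha>v s) (JJ s m ?h) (point_act g v))
      = (\<Sum>s\<in>S. c s * pairing (rep \<rho> g *v y) (\<alpha> s) * diff_quot (\<alpha> s) (\<alpha>v s) (JJ s (GG g m) h) v)"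
      by (subst (2) sum.reindex_bij_betw[OF conj_bij[OF g], symmetric]) (intro sum.cong HOL.refl 3)
    moreover have "GG g (YY y m) h v = YY y m ?h (point_act g v)" using h by (simp add: GG_def)
    ultimately show ?thesis by (simp add: YY_def 1 2) (simp add: Gm)
  qed
qed

lemma YY_shift: "m \<in> U \<Longrightarrow> YY (y - k *s b) m h v = YY y m h v - k * YY b m h v"
  by (simp add: YY_def diff_quot_zero_linear U_polyfun pairing_linear algebra_simps sum_subtractf sum_distrib_left)

text \<open>Everything after the first term on the right is symmetric in \<open>y\<close> and
  \<open>y'\<close>. Exchanging the two therefore shows that the commutator of \<open>YY y\<close>
  and \<open>YY y'\<close> commutes with \<open>XX x\<close>; this is the Jacobi identity in
  disguise.\<close>

lemma YY_YY_XX: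
  assumes m: "m \<in> U"
  shows "YY y (YY y' (XX x m)) h v = XX x (YY y (YY y' m)) h v
    + (z * pairing y x * YY y' m h v + z * pairing y' x * YY y m h v)
    - (\<Sum>s\<in>S. c s * pairing (\<alpha>v s) x * (pairing y (\<alpha> s) * YY y' (GG s m) h v + pairing y' (\<alpha> s) * YY y (GG s m) h v
        - pairing y (\<alpha> s) * pairing y' (\<alpha> s) * YY (\<alpha>v s) (GG s m) h v))"
proof -
  define k where "k s = - (c s * pairing y' (\<alpha> s) * pairing (\<alpha>v s) x)" for s
  have G: "s \<in> S \<Longrightarrow> GG s m \<in> U" for s using m by (simp add: GG_closed)
  have Ym: "YY y' m \<in> U" using m by (rule YY_closed)
  have "YY y' (XX x m) = (\<lambda>h v. (XX x (YY y' m) h v + (z * pairing y' x) * m h v) + (\<Sum>s\<in>S. k s * GG s m h v))"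
    using m by (simp add: YY_XX fun_eq_iff sum_negf k_def)
  moreover have "YY y (\<lambda>h v. (XX x (YY y' m) h v + (z * pairing y' x) * m h v) + (\<Sum>s\<in>S. k s * GG s m h v))
    = (\<lambda>h v. (YY y (XX x (YY y' m)) h v + (z * pairing y' x) * YY y m h v) + (\<Sum>s\<in>S. k s * YY y (GG s m) h v))"
    using m G Ym linear_opD(1)[OF linear_op_XX Ym]
    by (subst linear_opD(2)[OF linear_op_YY]; (intro U_add U_scale U_sum)?)
      (simp_all add: linear_opD(2)[OF linear_op_YY] linear_opD(3)[OF linear_op_YY] linear_op_sum[OF linear_op_YY] U_scale)
  ultimately have "YY y (YY y' (XX x m)) h v = XX x (YY y (YY y' m)) h v
      + (z * pairing y x * YY y' m h v + z * pairing y' x * YY y m h v)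
      - ((\<Sum>s\<in>S. c s * pairing y (\<alpha> s) * pairing (\<alpha>v s) x * GG s (YY y' m) h v)
         + (\<Sum>s\<in>S. c s * pairing y' (\<alpha> s) * pairing (\<alpha>v s) x * YY y (GG s m) h v))"
    by (simp add: YY_XX[OF Ym] sum_negf k_def)
  also have "(\<Sum>s\<in>S. c s * pairing y (\<alpha> s) * pairing (\<alpha>v s) x * GG s (YY y' m) h v)
         + (\<Sum>s\<in>S. c s * pairing y' (\<alpha> s) * pairing (\<alpha>v s) x * YY y (GG s m) h v)
    = (\<Sum>s\<in>S. c s * pairing (\<alpha>v s) x * (pairing y (\<alpha> s) * YY y' (GG s m) h v + pairing y' (\<alpha> s) * YY y (GG s m) h v
        - pairing y (\<alpha> s) * pairing y' (\<alpha> s) * YY (\<alpha>v s) (GG s m) h v))"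
    unfolding sum.distrib[symmetric]
  proof (rule sum.cong[OF HOL.refl])
    fix s assume s: "s \<in> S"
    \<comment> \<open>Covariance moves \<open>GG s\<close> past \<open>YY y'\<close> at the cost of
      reflecting \<open>y'\<close> into \<open>y' - (y', \<alpha> s) \<alpha>v s\<close>; the
      correction is the third, symmetric term.\<close>
    have GY: "GG s (YY y' m) h v = YY y' (GG s m) h v - pairing y' (\<alpha> s) * YY (\<alpha>v s) (GG s m) h v"
      using s m G by (simp add: GG_YY reflection(1) YY_shift)
    show "c s * pairing y (\<alpha> s) * pairing (\<alpha>v s) x * GG s (YY y' m) h v
         + c s * pairing y' (\<alpha> s) * pairing (\<alpha>v s) x * YY y (GG s m) h v
      = c s * pairing (\<alpha>v s) x * (pairing y (\<alpha> s) * YY y' (GG s m) h v + pairing y' (\<alpha> s) * YY y (GG s m) h v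
        - pairing y (\<alpha> s) * pairing y' (\<alpha> s) * YY (\<alpha>v s) (GG s m) h v)"
      unfolding GY by (simp only: algebra_simps)
  qed
  finally show ?thesis .
qed

text \<open>The induction principle behind \<open>YY_commute\<close>: functions of \<open>q\<close>
  alone generate \<open>U\<close> under sums and the operators \<open>XX x\<close>.\<close>

inductive x_generated :: "('g, 'i) twisted_fun \<Rightarrow> bool" where
  indep: "m \<in> U \<Longrightarrow> (\<And>h p p' q. m h (p, q) = m h (p', q)) \<Longrightarrow> x_generated m"
| add: "x_generated m \<Longrightarrow> x_generated n \<Longrightarrow> x_generated (\<lambda>h v. m h v + n h v)"
| XX: "x_generated m \<Longrightarrow> x_generated (XX x m)"

lemma x_generated_closed: "x_generated m \<Longrightarrow> m \<in> U"
  by (induction rule: x_generated.induct) (simp_all add: U_add linear_opD(1)[OF linear_op_XX])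

lemma x_generated_scale:
  assumes "x_generated m" and f: "f \<in> polyfuns" "\<And>p p' q. f (p, q) = f (p', q)"
  shows "x_generated (\<lambda>h v. f v * m h v)"
  using assms(1)
proof induction
  case (indep m)
  have "(\<lambda>h v. f v * m h v) \<in> U" using indep(1) f(1) by (simp add: U_def polyfuns.mult)
  moreover have "f (p, q) * m h (p, q) = f (p', q) * m h (p', q)" for h p p' q
    using indep(2)[of h p q p'] f(2)[of p q p'] by simp
  ultimately show ?case by (rule x_generated.indep)
next
  case (add m n)
  then show ?case using x_generated.add by (simp add: distrib_left)
next
  case (XX m x)
  then show ?case using x_generated.XX[of "\<lambda>h v. f v * m h v" x] by (simp add: XX_def mult.left_commute)
qed

lemma x_generated_polyfun:
  assumes "f \<in> polyfuns" "x_generated m"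
  shows "x_generated (\<lambda>h v. f v * m h v)"
  using assms
proof (induction arbitrary: m)
  case (const k)
  then show ?case by (intro x_generated_scale polyfuns.const) simp_all
next
  case (x x)
  then show ?case using x_generated.XX[of m x] by (simp add: XX_def case_prod_unfold)
next
  case (y y)
  then show ?case using polyfuns.y[of y] by (intro x_generated_scale) auto
next
  case (add f f')
  then show ?case using x_generated.add by (simp add: distrib_right)
next
  case (mult f f')
  then show ?case by (simp add: mult.assoc)
qed

text \<open>The group element \<open>g\<close> with coefficient 1. Symbols are read off from the
  action on \<open>unit_at\<close> of the identity, which \<open>g\<close> carries to
  \<open>unit_at g\<close>.\<close>

definition unit_at :: "'g \<Rightarrow> ('g, 'i) twisted_fun" where
  "unit_at g = (\<lambda>h v. if h = g then 1 else 0)"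

lemma unit_at_closed: "g \<in> carrier W \<Longrightarrow> unit_at g \<in> U"
  by (auto simp: unit_at_def U_def polyfuns.const)

lemma x_generated_all:
  assumes m: "m \<in> U"
  shows "x_generated m"
proof -
  have "x_generated (\<lambda>h v. \<Sum>k\<in>A. m k v * unit_at k h v)" if "finite A" "A \<subseteq> carrier W" for A
    using that
  proof (induction A)
    case empty
    show ?case by (rule x_generated.indep) (simp_all add: U_zero)
  next
    case (insert k A)
    have "x_generated (unit_at k)"
      using insert.prems by (intro x_generated.indep unit_at_closed) (auto simp: unit_at_def)
    then have "x_generated (\<lambda>h v. m k v * unit_at k h v)"
      using x_generated_polyfun[OF U_polyfun[OF m, of k]] by blast
    then show ?case using insert x_generated.add by simp
  qed
  from this[OF finite_W] have "x_generated (\<lambda>h v. \<Sum>k\<in>carrier W. m k v * unit_at k h v)" by simp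
  moreover have "(\<lambda>h v. \<Sum>k\<in>carrier W. m k v * unit_at k h v) = m"
  proof (intro ext)
    fix h v
    have "(\<Sum>k\<in>carrier W. m k v * unit_at k h v) = (\<Sum>k\<in>carrier W. if h = k then m k v else 0)"
      by (intro sum.cong HOL.refl) (simp add: unit_at_def)
    also have "\<dots> = m h v" using m finite_W by (simp add: U_def)
    finally show "(\<Sum>k\<in>carrier W. m k v * unit_at k h v) = m h v" .
  qed
  ultimately show ?thesis by simp
qed

lemma YY_indep:
  assumes "\<And>h p p' q. m h (p, q) = m h (p', q)"
  shows "YY y m = (\<lambda>h v. pairing y (snd v) * m h v)"
proof -
  have "diff_quot a b (m h) = (\<lambda>_. 0)" "diff_quot a b (JJ g m h) = (\<lambda>_. 0)" for a b g h
    using assms by (auto intro!: diff_quot_indep simp: JJ_def)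
  then show ?thesis by (simp add: YY_def)
qed

text \<open>The commutator of two Dunkl operators commutes with all \<open>XX x\<close>, by the Jacobi identity and
  covariance, and it vanishes on functions that do not depend on \<open>p\<close>; under the operators \<open>XX x\<close>
  these generate \<^term>\<open>U\<close>.\<close>

theorem YY_commute:
  assumes "m \<in> U"
  shows "YY y (YY y' m) = YY y' (YY y m)"
  using x_generated_all[OF assms]
proof induction
  case (indep m)
  have "YY a (YY b m) = (\<lambda>h v. pairing a (snd v) * (pairing b (snd v) * m h v))" for a b
    unfolding YY_indep[of m, OF indep(2)]
    by (rule YY_indep) (simp, use indep(2) in blast)
  then show ?case by (simp add: mult.left_commute)
next
  case (add m n)
  then show ?case
    by (simp add: linear_opD(2)[OF linear_op_YY] x_generated_closed YY_closed)
next
  case (XX m x)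
  show ?case
    using x_generated_closed[OF XX.hyps] XX.IH
    by (intro ext) (simp add: YY_YY_XX algebra_simps)
qed

end

section \<open>The Dunkl representation\<close>

lemma vec_decomp: "x = (\<Sum>i\<in>UNIV. x $ i *s axis i 1)" for x :: "complex ^ 'i::finite"
  by (simp add: basis_expansion)

lemma matrix_axis: "A *v axis i 1 = (\<Sum>k\<in>UNIV. A $ k $ i *s axis k 1)" for A :: "complex ^ 'i ^ 'i::finite"
proof -
  have "(A *v axis i 1) $ k = A $ k $ i" for k
    by (simp add: matrix_vector_mult_def axis_def if_distrib[of "(*) _"] cong: if_cong)
  then show ?thesis using vec_decomp[of "A *v axis i 1"] by simp
qed

lemma pairing_sum: "pairing (\<Sum>i\<in>I. k i *s y i) x = (\<Sum>i\<in>I. k i * pairing (y i) x)"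
  "pairing w (\<Sum>i\<in>I. k i *s u i) = (\<Sum>i\<in>I. k i * pairing w (u i))"
  by (induction I rule: infinite_finite_induct) (simp_all add: pairing_linear)

context dunkl
begin

definition letter_op :: "'i + 'i \<Rightarrow> ('g, 'i) twisted_fun \<Rightarrow> ('g, 'i) twisted_fun" where
  "letter_op l = (case l of Inl i \<Rightarrow> YY (axis i 1) | Inr i \<Rightarrow> XX (axis i 1))"

definition word_op :: "('i + 'i) list \<Rightarrow> ('g, 'i) twisted_fun \<Rightarrow> ('g, 'i) twisted_fun" where
  "word_op w m = foldr letter_op w m"

lemma word_op_simps: "word_op [] m = m" "word_op (l # w) m = letter_op l (word_op w m)"
  "word_op (u @ w) m = word_op u (word_op w m)"
  by (simp_all add: word_op_def)

lemma linear_op_letter: "linear_op (letter_op l)"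
  by (simp add: letter_op_def linear_op_XX linear_op_YY split: sum.splits)

lemma linear_op_compose: "linear_op T \<Longrightarrow> linear_op T' \<Longrightarrow> linear_op (\<lambda>m. T (T' m))"
  by (simp add: linear_op_def)

lemma linear_op_word: "linear_op (word_op w)"
proof (induction w)
  case Nil
  show ?case by (simp add: linear_op_def word_op_simps)
next
  case (Cons l w)
  show ?case unfolding word_op_simps(2) by (rule linear_op_compose[OF linear_op_letter Cons.IH])
qed

definition tensor_op :: "(('i + 'i) list \<Rightarrow> complex) \<Rightarrow> ('g, 'i) twisted_fun \<Rightarrow> ('g, 'i) twisted_fun" where
  "tensor_op t m = (\<lambda>h v. word_sum t (\<lambda>w. word_op w m h v))"

lemma linear_op_tensor: "linear_op (tensor_op t)"
proof -
  have "tensor_op t m \<in> U" if "m \<in> U" for m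
    unfolding tensor_op_def word_sum_def
    by (intro U_sum U_scale linear_opD(1)[OF linear_op_word that])
  then show ?thesis
    using linear_opD[OF linear_op_word]
    by (simp add: linear_op_def) (simp add: tensor_op_def word_sum_func_add word_sum_func_scale)
qed

lemma tensor_op_add: "t \<in> carrier tensor_algebra \<Longrightarrow> t' \<in> carrier tensor_algebra
    \<Longrightarrow> tensor_op (t \<oplus>\<^bsub>tensor_algebra\<^esub> t') m h v = tensor_op t m h v + tensor_op t' m h v"
  by (simp add: tensor_op_def tensor_add word_sum_add)

lemma tensor_op_zero: "tensor_op \<zero>\<^bsub>tensor_algebra\<^esub> m h v = 0"
  by (simp add: tensor_op_def tensor_zero)

lemma tensor_op_mult:
  assumes "t \<in> carrier tensor_algebra" "t' \<in> carrier tensor_algebra" "m \<in> U"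
  shows "tensor_op (t \<otimes>\<^bsub>tensor_algebra\<^esub> t') m = tensor_op t (tensor_op t' m)"
proof -
  have "word_op u (tensor_op t' m) = (\<lambda>h v. word_sum t' (\<lambda>u'. word_op u (word_op u' m) h v))" for u
    unfolding tensor_op_def word_sum_def
    by (rule linear_op_sum[OF linear_op_word linear_opD(1)[OF linear_op_word assms(3)]])
  then show ?thesis
    using assms by (simp add: tensor_op_def[of t] tensor_op_def[of "t \<otimes>\<^bsub>tensor_algebra\<^esub> t'"] word_sum_mult word_op_simps)
qed

lemma XX_sum: "XX (\<Sum>i\<in>I. k i *s x i) m = (\<lambda>h v. \<Sum>i\<in>I. k i * XX (x i) m h v)"
  by (simp add: XX_def pairing_sum sum_distrib_right mult.assoc)

lemma YY_sum:
  assumes "m \<in> U" shows "YY (\<Sum>i\<in>I. k i *s y i) m = (\<lambda>h v. \<Sum>i\<in>I. k i * YY (y i) m h v)"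
proof (intro ext)
  fix h v
  have z: "YY 0 m h v = 0" using YY_shift[OF assms, of 0 1 0 h v] by simp
  show "YY (\<Sum>i\<in>I. k i *s y i) m h v = (\<Sum>i\<in>I. k i * YY (y i) m h v)"
  proof (induction I rule: infinite_finite_induct)
    case (insert i I)
    then show ?case using YY_shift[OF assms, of "\<Sum>i\<in>I. k i *s y i" "- k i" "y i" h v]
      by (simp add: add.commute)
  qed (simp_all add: z)
qed

lemma tensor_op_x: "tensor_op (tensor_x x) m = XX x m"
proof -
  have "XX x m = XX (\<Sum>i\<in>UNIV. x $ i *s axis i 1) m" by (simp add: basis_expansion)
  then show ?thesis by (simp add: XX_sum tensor_op_def word_sum_tensor_x word_op_simps letter_op_def)
qed

lemma tensor_op_y:
  assumes "m \<in> U" shows "tensor_op (tensor_y y) m = YY y m"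
proof -
  have "YY y m = YY (\<Sum>i\<in>UNIV. y $ i *s axis i 1) m" by (simp add: basis_expansion)
  then show ?thesis using assms by (simp add: YY_sum tensor_op_def word_sum_tensor_y word_op_simps letter_op_def)
qed

section \<open>Covariance of words and tensors\<close>

lemma GG_letter:
  assumes g: "g \<in> carrier W" and m: "m \<in> U"
  shows "GG g (letter_op l m) = (\<lambda>h v. \<Sum>k\<in>UNIV. double_matrix W \<rho> g k l * letter_op k (GG g m) h v)"
proof (cases l)
  case (Inl i)
  have "rep \<rho> g *v axis i 1 = (\<Sum>k\<in>UNIV. rep \<rho> g $ k $ i *s axis k 1)"
    by (rule matrix_axis)
  then show ?thesis using g m Inl
    by (simp add: letter_op_def GG_YY YY_sum GG_closed sum_UNIV_Plus double_matrix_def)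
next
  case (Inr i)
  have "dual_rep W \<rho> g *v axis i 1 = (\<Sum>k\<in>UNIV. dual_rep W \<rho> g $ k $ i *s axis k 1)"
    by (rule matrix_axis)
  then show ?thesis using g m Inr
    by (simp add: letter_op_def GG_XX XX_sum sum_UNIV_Plus double_matrix_def)
qed

text \<open>Closure and commutation share one induction: pulling a letter through the sum uses
  linearity of \<open>letter_op\<close>, which is available only on \<open>U\<close>.\<close>

lemma word_map_closed_letter:
  fixes F :: "('i + 'i) list \<Rightarrow> ('g, 'i) twisted_fun"
  assumes "\<And>w. F w \<in> U"
  shows "(\<lambda>h v. word_map M (\<lambda>w. F w h v) u) \<in> U
    \<and> letter_op l (\<lambda>h v. word_map M (\<lambda>w. F w h v) u) = (\<lambda>h v. word_map M (\<lambda>w. letter_op l (F w) h v) u)"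
  using assms
proof (induction u arbitrary: F)
  case (Cons b u)
  have IH: "(\<lambda>h v. word_map M (\<lambda>w. F (k # w) h v) u) \<in> U"
    "letter_op l (\<lambda>h v. word_map M (\<lambda>w. F (k # w) h v) u) = (\<lambda>h v. word_map M (\<lambda>w. letter_op l (F (k # w)) h v) u)" for k
    using Cons.IH[of "\<lambda>w. F (k # w)"] Cons.prems by auto
  show ?case
    using linear_op_sum[OF linear_op_letter, of UNIV "\<lambda>k h v. word_map M (\<lambda>w. F (k # w) h v) u" l "\<lambda>k. M k b"]
    by (simp add: IH U_sum U_scale)
qed (simp add: linear_opD(1)[OF linear_op_letter])

lemma GG_word:
  assumes g: "g \<in> carrier W" and m: "m \<in> U"
  shows "GG g (word_op w m) h v = word_map (double_matrix W \<rho> g) (\<lambda>w. word_op w (GG g m) h v) w"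
proof (induction w arbitrary: h v)
  case (Cons l w)
  have wm: "word_op w m \<in> U" "word_op w (GG g m) \<in> U" for w
    using g m by (auto intro!: linear_opD(1)[OF linear_op_word] GG_closed)
  have IH: "GG g (word_op w m) = (\<lambda>h v. word_map (double_matrix W \<rho> g) (\<lambda>w. word_op w (GG g m) h v) w)"
    using Cons.IH by blast
  show ?case
    unfolding word_op_simps(2) GG_letter[OF g wm(1)] IH
    using word_map_closed_letter[of "\<lambda>w. word_op w (GG g m)", OF wm(2)]
    by (simp add: word_op_simps)
qed (simp add: word_op_simps)

lemma GG_tensor:
  assumes g: "g \<in> carrier W" and t: "t \<in> carrier tensor_algebra" and m: "m \<in> U"
  shows "GG g (tensor_op t m) = tensor_op (tensor_act W \<rho> g t) (GG g m)"
proof -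
  have "GG g (tensor_op t m) = (\<lambda>h v. word_sum t (\<lambda>w. GG g (word_op w m) h v))"
    unfolding tensor_op_def word_sum_def
    by (rule linear_op_sum[OF linear_op_GG[OF g] linear_opD(1)[OF linear_op_word m]])
  then show ?thesis
    using t g m by (simp add: tensor_op_def tensor_act_def word_sum_tensor_map GG_word)
qed

interpretation P: skew_group_ring W "tensor_act W \<rho>" "tensor_algebra :: (('i + 'i) list \<Rightarrow> complex) ring"
  by (rule tensor_skew)

abbreviation "PP \<equiv> UP (tensor_smash W \<rho>)"

definition smash_op :: "('g \<Rightarrow> ('i + 'i) list \<Rightarrow> complex) \<Rightarrow> ('g, 'i) twisted_fun \<Rightarrow> ('g, 'i) twisted_fun" where
  "smash_op f m = (\<lambda>h v. \<Sum>g\<in>carrier W. tensor_op (f g) (GG g m) h v)"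

text \<open>The action with hbar specialised to \<open>z\<close>. The index set is the support of
  \<open>p\<close>; \<open>P_op_bound\<close> replaces it by any sufficiently long initial
  segment.\<close>

definition P_op :: "(nat \<Rightarrow> 'g \<Rightarrow> ('i + 'i) list \<Rightarrow> complex) \<Rightarrow> ('g, 'i) twisted_fun \<Rightarrow> ('g, 'i) twisted_fun" where
  "P_op p m = (\<lambda>h v. \<Sum>k | p k \<noteq> \<zero>\<^bsub>tensor_smash W \<rho>\<^esub>. z ^ k * smash_op (p k) m h v)"

lemma smash_op_closed: "m \<in> U \<Longrightarrow> smash_op f m \<in> U"
  unfolding smash_op_def by (intro U_sum linear_opD(1)[OF linear_op_tensor] GG_closed)

lemma P_op_closed: "m \<in> U \<Longrightarrow> P_op p m \<in> U"
  unfolding P_op_def by (intro U_sum U_scale smash_op_closed)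

lemma smash_op_zero: "smash_op \<zero>\<^bsub>tensor_smash W \<rho>\<^esub> m h v = 0"
  by (simp add: smash_op_def P.smash_zero tensor_op_zero)

lemma P_bound: "p \<in> carrier PP \<Longrightarrow> \<exists>N. \<forall>k>N. p k = \<zero>\<^bsub>tensor_smash W \<rho>\<^esub>"
  by (auto simp: UP_def up_def bound_def)

lemma P_op_bound:
  assumes "\<And>k. k > N \<Longrightarrow> p k = \<zero>\<^bsub>tensor_smash W \<rho>\<^esub>"
  shows "P_op p m h v = (\<Sum>k\<le>N. z ^ k * smash_op (p k) m h v)"
proof -
  have "{k. p k \<noteq> \<zero>\<^bsub>tensor_smash W \<rho>\<^esub>} \<subseteq> {..N}" using assms by (auto simp: not_less[symmetric])
  then show ?thesis
    unfolding P_op_def by (intro sum.mono_neutral_left) (auto simp: smash_op_zero)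
qed

lemma P_op_add:
  assumes p: "p \<in> carrier PP" "q \<in> carrier PP"
  shows "P_op (p \<oplus>\<^bsub>PP\<^esub> q) m h v = P_op p m h v + P_op q m h v"
proof -
  obtain N M where N: "\<And>k. k > N \<Longrightarrow> p k = \<zero>\<^bsub>tensor_smash W \<rho>\<^esub>" and M: "\<And>k. k > M \<Longrightarrow> q k = \<zero>\<^bsub>tensor_smash W \<rho>\<^esub>"
    using P_bound p by blast
  have c: "p k \<in> carrier P.SG" "q k \<in> carrier P.SG" for k using p P.UP_carrier_coeff by auto
  have add: "(p \<oplus>\<^bsub>PP\<^esub> q) k = p k \<oplus>\<^bsub>P.SG\<^esub> q k" for k
    using p by (simp add: UP_def)
  have "smash_op (p k \<oplus>\<^bsub>P.SG\<^esub> q k) m h v = smash_op (p k) m h v + smash_op (q k) m h v" for k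
    using P.smash_closed[OF c(1)] P.smash_closed[OF c(2)]
    by (simp add: smash_op_def P.smash_add tensor_op_add sum.distrib)
  moreover have "P_op (p \<oplus>\<^bsub>PP\<^esub> q) m h v = (\<Sum>k\<le>max N M. z ^ k * smash_op ((p \<oplus>\<^bsub>PP\<^esub> q) k) m h v)"
    by (rule P_op_bound) (simp add: add N M)
  moreover have "P_op p m h v = (\<Sum>k\<le>max N M. z ^ k * smash_op (p k) m h v)"
    "P_op q m h v = (\<Sum>k\<le>max N M. z ^ k * smash_op (q k) m h v)"
    by (rule P_op_bound, simp add: N M)+
  ultimately show ?thesis by (simp add: add distrib_left sum.distrib)
qed

lemma P_op_zero: "P_op \<zero>\<^bsub>PP\<^esub> m h v = 0"
  by (simp add: P_op_def UP_def)

lemma linear_op_P: "linear_op (P_op p)"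
proof -
  have s: "linear_op (\<lambda>m. tensor_op (f g) (GG g m))" if "g \<in> carrier W" for f :: "'g \<Rightarrow> _" and g
    using linear_op_compose[OF linear_op_tensor linear_op_GG[OF that]] .
  have "smash_op f (\<lambda>h v. m h v + n h v) = (\<lambda>h v. smash_op f m h v + smash_op f n h v)" if "m \<in> U" "n \<in> U" for f m n
    using linear_opD(2)[OF s that] by (simp add: smash_op_def sum.distrib)
  moreover have "smash_op f (\<lambda>h v. k * m h v) = (\<lambda>h v. k * smash_op f m h v)" if "m \<in> U" for f m k
    using linear_opD(3)[OF s that] by (simp add: smash_op_def sum_distrib_left)
  ultimately show ?thesis
    by (simp add: linear_op_def P_op_closed) (simp add: P_op_def distrib_left sum.distrib sum_distrib_left mult.left_commute)
qed

lemma elt_times: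
  assumes a: "a \<in> carrier tensor_algebra" and g: "g \<in> carrier W" and p: "p \<in> carrier PP"
  shows "(P.elt a g n \<otimes>\<^bsub>PP\<^esub> p) j = (if j < n then \<zero>\<^bsub>P.SG\<^esub> else smash_single W tensor_algebra a g \<otimes>\<^bsub>P.SG\<^esub> p (j - n))"
proof -
  let ?s = "smash_single W tensor_algebra a g"
  have c: "p k \<in> carrier P.SG" for k using p P.UP_carrier_coeff by auto
  have s: "?s \<in> carrier P.SG" using a by simp
  have "P.elt a g n \<in> carrier PP" using a by simp
  then have "(P.elt a g n \<otimes>\<^bsub>PP\<^esub> p) j = (\<Oplus>\<^bsub>P.SG\<^esub>i\<in>{..j}. P.elt a g n i \<otimes>\<^bsub>P.SG\<^esub> p (j - i))"
    using p by (simp add: UP_def)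
  also have "\<dots> = (\<Oplus>\<^bsub>P.SG\<^esub>i\<in>{..j}. if n = i then ?s \<otimes>\<^bsub>P.SG\<^esub> p (j - i) else \<zero>\<^bsub>P.SG\<^esub>)"
    using c s by (intro P.S.finsum_cong') (auto simp: P.elt_apply[OF a])
  also have "\<dots> = (if j < n then \<zero>\<^bsub>P.SG\<^esub> else ?s \<otimes>\<^bsub>P.SG\<^esub> p (j - n))"
  proof (cases "j < n")
    case True
    then show ?thesis by (auto intro!: P.S.add.finprod_one_eqI)
  next
    case False
    then show ?thesis using c s by (subst P.S.finsum_singleton) auto
  qed
  finally show ?thesis .
qed

text \<open>Multiplicativity for a one-term left factor. Moving \<open>g\<close> past a tensor
  replaces the tensor by its image under \<open>tensor_act\<close>, which is exactly the twist in
  the skew product; the general case follows by additivity.\<close>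

lemma P_op_elt_times:
  assumes a: "a \<in> carrier tensor_algebra" and g: "g \<in> carrier W" and p: "p \<in> carrier PP" and m: "m \<in> U"
  shows "P_op (P.elt a g n \<otimes>\<^bsub>PP\<^esub> p) m = (\<lambda>h v. z ^ n * tensor_op a (GG g (P_op p m)) h v)"
proof (intro ext)
  fix h v
  obtain N where N: "\<And>k. k > N \<Longrightarrow> p k = \<zero>\<^bsub>P.SG\<^esub>" using P_bound p by blast
  have c: "p k \<in> carrier P.SG" for k using p P.UP_carrier_coeff by auto
  have s: "smash_single W tensor_algebra a g \<in> carrier P.SG" using a by simp
  have op: "smash_op (smash_single W tensor_algebra a g \<otimes>\<^bsub>P.SG\<^esub> f) m = tensor_op a (GG g (smash_op f m))"
    if f: "f \<in> carrier P.SG" for f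
  proof -
    have fc: "f k \<in> carrier tensor_algebra" if "k \<in> carrier W" for k using f that P.smash_closed by auto
    have Um: "tensor_op (f k) (GG k m) \<in> U" if "k \<in> carrier W" for k
      using m that by (intro linear_opD(1)[OF linear_op_tensor] GG_closed)
    have "smash_op (smash_single W tensor_algebra a g \<otimes>\<^bsub>P.SG\<^esub> f) m
      = (\<lambda>h v. \<Sum>k\<in>carrier W. tensor_op (a \<otimes>\<^bsub>tensor_algebra\<^esub> tensor_act W \<rho> g (f (inv\<^bsub>W\<^esub> g \<otimes>\<^bsub>W\<^esub> k))) (GG k m) h v)"
      using a g f by (simp add: smash_op_def P.smash_single_mult)
    also have "\<dots> = (\<lambda>h v. \<Sum>k\<in>carrier W. tensor_op (a \<otimes>\<^bsub>tensor_algebra\<^esub> tensor_act W \<rho> g (f k)) (GG (g \<otimes>\<^bsub>W\<^esub> k) m) h v)"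
    proof -
      have "bij_betw (\<lambda>k. g \<otimes>\<^bsub>W\<^esub> k) (carrier W) (carrier W)"
        using g by (simp add: bij_betw_def inj_on_def W.surj_const_mult)
      moreover have "inv\<^bsub>W\<^esub> g \<otimes>\<^bsub>W\<^esub> (g \<otimes>\<^bsub>W\<^esub> k) = k" if "k \<in> carrier W" for k
        using g that by (simp flip: W.m_assoc)
      ultimately show ?thesis
        by (subst sum.reindex_bij_betw[symmetric, of "\<lambda>k. g \<otimes>\<^bsub>W\<^esub> k" "carrier W" "carrier W"]) (simp_all cong: sum.cong)
    qed
    also have "\<dots> = (\<lambda>h v. \<Sum>k\<in>carrier W. 1 * tensor_op a (GG g (tensor_op (f k) (GG k m))) h v)"
      using g a m by (simp add: GG_mult tensor_op_mult fc GG_closed GG_tensor cong: sum.cong)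
    also have "\<dots> = tensor_op a (GG g (\<lambda>h v. \<Sum>k\<in>carrier W. 1 * tensor_op (f k) (GG k m) h v))"
      using linear_op_sum[OF linear_op_compose[OF linear_op_tensor[of a] linear_op_GG[OF g]], of "carrier W" "\<lambda>k. tensor_op (f k) (GG k m)" "\<lambda>_. 1"] Um
      by simp
    finally show ?thesis by (simp add: smash_op_def)
  qed
  have "P_op (P.elt a g n \<otimes>\<^bsub>PP\<^esub> p) m h v = (\<Sum>j\<le>n + N. z ^ j * smash_op ((P.elt a g n \<otimes>\<^bsub>PP\<^esub> p) j) m h v)"
    by (rule P_op_bound) (use s in \<open>auto simp: elt_times[OF a g p] N\<close>)
  also have "\<dots> = (\<Sum>j\<in>{n..n + N}. z ^ j * smash_op ((P.elt a g n \<otimes>\<^bsub>PP\<^esub> p) j) m h v)"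
    by (rule sum.mono_neutral_right) (auto simp: elt_times[OF a g p] smash_op_zero)
  also have "\<dots> = (\<Sum>k\<le>N. z ^ (n + k) * tensor_op a (GG g (smash_op (p k) m)) h v)"
    by (rule sum.reindex_bij_witness[of _ "\<lambda>k. n + k" "\<lambda>j. j - n"]) (auto simp: elt_times[OF a g p] op[OF c])
  also have "\<dots> = z ^ n * (\<Sum>k\<le>N. z ^ k * tensor_op a (GG g (smash_op (p k) m)) h v)"
    by (simp add: sum_distrib_left power_add mult.assoc)
  also have "(\<Sum>k\<le>N. z ^ k * tensor_op a (GG g (smash_op (p k) m)) h v) = tensor_op a (GG g (P_op p m)) h v"
  proof -
    have "P_op p m = (\<lambda>h v. \<Sum>k\<le>N. z ^ k * smash_op (p k) m h v)"
      using P_op_bound[of N p m, OF N] by (intro ext)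
    then show ?thesis
      using linear_op_sum[OF linear_op_compose[OF linear_op_tensor[of a] linear_op_GG[OF g]], of "{..N}" "\<lambda>k. smash_op (p k) m" "\<lambda>k. z ^ k"]
      by (simp add: smash_op_closed m)
  qed
  finally show "P_op (P.elt a g n \<otimes>\<^bsub>PP\<^esub> p) m h v = z ^ n * tensor_op a (GG g (P_op p m)) h v" .
qed

lemma P_op_one: "m \<in> U \<Longrightarrow> P_op \<one>\<^bsub>PP\<^esub> m = m"
proof -
  assume m: "m \<in> U"
  have "GG \<one>\<^bsub>W\<^esub> m = m"
    using m by (auto simp: GG_def point_act_def rep_one dual_rep_one U_def fun_eq_iff)
  then have "smash_op \<one>\<^bsub>P.SG\<^esub> m h v = (\<Sum>g\<in>carrier W. if g = \<one>\<^bsub>W\<^esub> then m h v else 0)" for h v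
    unfolding smash_op_def
    by (intro sum.cong) (auto simp: P.smash_one smash_single_def tensor_op_zero, auto simp: tensor_op_def tensor_one word_op_simps)
  then have s: "smash_op \<one>\<^bsub>P.SG\<^esub> m h v = m h v" for h v using finite_W by simp
  have "P_op \<one>\<^bsub>PP\<^esub> m h v = (\<Sum>k\<le>0. z ^ k * smash_op (\<one>\<^bsub>PP\<^esub> k) m h v)" for h v
    by (rule P_op_bound) (simp add: UP_def)
  moreover have "\<one>\<^bsub>PP\<^esub> 0 = \<one>\<^bsub>P.SG\<^esub>" by (simp add: UP_def)
  ultimately show ?thesis by (intro ext) (simp add: s)
qed

lemma P_op_elt:
  assumes "a \<in> carrier tensor_algebra" "g \<in> carrier W" "m \<in> U"
  shows "P_op (P.elt a g n) m = (\<lambda>h v. z ^ n * tensor_op a (GG g m) h v)"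
  using P_op_elt_times[OF assms(1,2) P.P.one_closed assms(3), of n] assms by (simp add: P_op_one)

theorem P_op_mult:
  assumes x: "x \<in> carrier PP" and p: "p \<in> carrier PP" and m: "m \<in> U"
  shows "P_op (x \<otimes>\<^bsub>PP\<^esub> p) m h v = P_op x (P_op p m) h v"
proof (rule P.smash_UP_induct[OF x, where X = "carrier tensor_algebra" and Q = "\<lambda>x. P_op (x \<otimes>\<^bsub>PP\<^esub> p) m h v = P_op x (P_op p m) h v"])
  show "x k g \<in> carrier tensor_algebra" if "g \<in> carrier W" for k g
    using P.smash_closed[OF P.UP_carrier_coeff[OF x] that] .
  show "P_op (\<zero>\<^bsub>PP\<^esub> \<otimes>\<^bsub>PP\<^esub> p) m h v = P_op \<zero>\<^bsub>PP\<^esub> (P_op p m) h v"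
    using p by (simp add: P_op_zero)
  show "P_op ((a \<oplus>\<^bsub>PP\<^esub> b) \<otimes>\<^bsub>PP\<^esub> p) m h v = P_op (a \<oplus>\<^bsub>PP\<^esub> b) (P_op p m) h v"
    if "a \<in> carrier PP" "b \<in> carrier PP" "P_op (a \<otimes>\<^bsub>PP\<^esub> p) m h v = P_op a (P_op p m) h v"
      "P_op (b \<otimes>\<^bsub>PP\<^esub> p) m h v = P_op b (P_op p m) h v" for a b
    using that p by (simp add: P.P.l_distr P_op_add)
  show "P_op (P.elt a g n \<otimes>\<^bsub>PP\<^esub> p) m h v = P_op (P.elt a g n) (P_op p m) h v"
    if "a \<in> carrier tensor_algebra" "g \<in> carrier W" for a g n
    using that p m by (simp add: P_op_elt_times P_op_elt P_op_closed)
qed simp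

lemma P_op_minus:
  assumes "p \<in> carrier PP" "q \<in> carrier PP"
  shows "P_op (p \<ominus>\<^bsub>PP\<^esub> q) m h v = P_op p m h v - P_op q m h v"
proof -
  have "(p \<ominus>\<^bsub>PP\<^esub> q) \<oplus>\<^bsub>PP\<^esub> q = p" using assms by (simp add: P.P.minus_eq P.P.a_assoc P.P.l_neg)
  then show ?thesis using P_op_add[of "p \<ominus>\<^bsub>PP\<^esub> q" q m h v] assms by simp
qed

text \<open>Reduces the statement that the defining ideal acts by zero to its relators. Absorption
  from the right uses that \<open>U\<close> is stable under every \<open>P_op\<close>.\<close>

lemma annihilator_ideal: "ideal {p \<in> carrier PP. \<forall>m\<in>U. P_op p m = (\<lambda>h v. 0)} PP"
proof (rule idealI[OF P.P.ring_axioms])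
  let ?I = "{p \<in> carrier PP. \<forall>m\<in>U. P_op p m = (\<lambda>h v. 0)}"
  have z: "P_op p (\<lambda>h v. 0) = (\<lambda>h v. 0)" for p
    using linear_opD(3)[OF linear_op_P U_zero, of p 0] by simp
  show "subgroup ?I (add_monoid PP)"
  proof (rule P.P.add.subgroupI)
    show "?I \<noteq> {}" using P_op_zero by (auto intro!: exI[of _ "\<zero>\<^bsub>PP\<^esub>"] simp: fun_eq_iff)
    show "\<ominus>\<^bsub>PP\<^esub> p \<in> ?I" if "p \<in> ?I" for p
      using that P_op_minus[of "\<zero>\<^bsub>PP\<^esub>" p] by (auto simp: P.P.minus_eq P_op_zero fun_eq_iff)
    show "p \<oplus>\<^bsub>PP\<^esub> q \<in> ?I" if "p \<in> ?I" "q \<in> ?I" for p q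
      using that by (auto simp: P_op_add fun_eq_iff)
  qed auto
  show "x \<otimes>\<^bsub>PP\<^esub> p \<in> ?I" if p: "p \<in> ?I" and x: "x \<in> carrier PP" for p x
  proof -
    have "P_op (x \<otimes>\<^bsub>PP\<^esub> p) m = (\<lambda>h v. 0)" if "m \<in> U" for m
    proof -
      have "P_op (x \<otimes>\<^bsub>PP\<^esub> p) m = P_op x (P_op p m)" using p x that by (intro ext P_op_mult) auto
      also have "P_op p m = (\<lambda>h v. 0)" using p that by blast
      finally show ?thesis by (simp only: z)
    qed
    then show ?thesis using p x by auto
  qed
  show "p \<otimes>\<^bsub>PP\<^esub> x \<in> ?I" if p: "p \<in> ?I" and x: "x \<in> carrier PP" for p x
  proof -
    have "P_op (p \<otimes>\<^bsub>PP\<^esub> x) m = (\<lambda>h v. 0)" if "m \<in> U" for m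
    proof -
      have "P_op (p \<otimes>\<^bsub>PP\<^esub> x) m = P_op p (P_op x m)" using p x that by (intro ext P_op_mult) auto
      also have "\<dots> = (\<lambda>h v. 0)" using p P_op_closed[OF that] by blast
      finally show ?thesis .
    qed
    then show ?thesis using p x by auto
  qed
qed

text \<open>Each letter acts as multiplication by its coordinate up to lower degree, so the product
  of coordinates emerges by induction and no lower term has to be computed.\<close>

lemma word_op_top:
  assumes "g \<in> carrier W"
  shows "degree_less (length w) (\<lambda>v. word_op w (unit_at g) h v - monomial (coord v) w * unit_at g h v)"
proof (induction w arbitrary: h)
  case Nil
  show ?case by (simp add: word_op_simps degree_less_zero)
next
  case (Cons l w)
  let ?m = "word_op w (unit_at g)"
  have m: "?m \<in> U" by (rule linear_opD(1)[OF linear_op_word unit_at_closed[OF assms]])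
  have dl: "degree_le 1 (\<lambda>v. coord v l)" using monomial_degree[of "[l]"] by (simp add: monomial_Cons)
  \<comment> \<open>The difference from the monomial has degree below \<open>length w\<close> and
    the monomial has degree at most \<open>length w\<close>; this bound on the whole function is
    what the derivative and the difference quotients are estimated from.\<close>
  have le: "degree_le (length w) (?m h)" for h
  proof -
    have u: "degree_le 0 (unit_at g h)"
      using degree_le.const[of "if h = g then 1 else 0"] by (simp add: unit_at_def)
    have "degree_le (length w + 0) (\<lambda>v. monomial (coord v) w * unit_at g h v)"
      by (rule degree_le.mult[OF monomial_degree u])
    from degree_le.add[OF degree_less_imp_le[OF Cons.IH[of h]] this[simplified]] show ?thesis by simp
  qed
  have 1: "degree_less (Suc (length w)) (\<lambda>v. coord v l * (?m h v - monomial (coord v) w * unit_at g h v))"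
    using degree_less_mult[OF dl Cons.IH] by simp
  \<comment> \<open>An \<open>x\<close> letter is exact. A \<open>y\<close> letter differs from
    multiplication by its coordinate only by derivatives and difference quotients, all of smaller
    degree.\<close>
  have low: "degree_less (Suc (length w)) (\<lambda>v. letter_op l ?m h v - coord v l * ?m h v)"
  proof (cases l)
    case (Inl i)
    have d: "degree_less (Suc (length w)) (\<lambda>v. k * diff_quot a b f v)" if "degree_le (length w) f" for k a b f
      using degree_less_scale[OF degree_less_mono[OF _ degree_less_diff_quot[OF that]]] by simp
    have "degree_less (Suc (length w)) (\<lambda>v. z * diff_quot 0 (axis i 1) (?m h) v
      - (\<Sum>s\<in>S. c s * pairing (axis i 1) (\<alpha> s) * diff_quot (\<alpha> s) (\<alpha>v s) (JJ s ?m h) v))"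
      by (intro degree_less_diff degree_less_sum d degree_le_JJ le) simp
    then show ?thesis using Inl by (simp add: letter_op_def YY_def coord_def pairing_axis)
  next
    case (Inr i)
    then show ?thesis by (simp add: letter_op_def XX_def coord_def pairing_axis degree_less_zero)
  qed
  from degree_less_add[OF low 1] show ?case
    by (simp add: word_op_simps monomial_Cons algebra_simps)
qed

end

lemma tensor_const_word: "tensor_const k = tensor_word k []"
  by (simp add: tensor_const_def tensor_word_def)

section \<open>The defining ideal acts by zero and has vanishing symbols\<close>

context dunkl
begin

interpretation P: skew_group_ring W "tensor_act W \<rho>" "tensor_algebra :: (('i + 'i) list \<Rightarrow> complex) ring"
  by (rule tensor_skew)

lemma GG_one: "m \<in> U \<Longrightarrow> GG \<one>\<^bsub>W\<^esub> m = m"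
  by (auto simp: GG_def point_act_def rep_one dual_rep_one U_def fun_eq_iff)

lemma GG_unit_at: "g \<in> carrier W \<Longrightarrow> GG g (unit_at \<one>\<^bsub>W\<^esub>) = unit_at g"
proof (intro ext)
  fix h v assume g: "g \<in> carrier W"
  have "h \<in> carrier W \<Longrightarrow> inv\<^bsub>W\<^esub> g \<otimes>\<^bsub>W\<^esub> h = \<one>\<^bsub>W\<^esub> \<longleftrightarrow> h = g"
    using g by (metis W.inv_equality W.inv_inv W.l_inv W.inv_closed)
  then show "GG g (unit_at \<one>\<^bsub>W\<^esub>) h v = unit_at g h v" using g by (auto simp: GG_def unit_at_def)
qed

lemma P_op_finsum:
  assumes "finite I" "\<And>i. i \<in> I \<Longrightarrow> f i \<in> carrier PP"
  shows "P_op (finsum PP f I) m h v = (\<Sum>i\<in>I. P_op (f i) m h v)"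
  using assms
proof (induction I)
  case (insert i I)
  then show ?case by (subst P.P.finsum_insert) (auto simp: P_op_add P.P.finsum_closed)
qed (simp add: P_op_zero)

lemma tensor_op_word: "tensor_op (tensor_word k w) m = (\<lambda>h v. k * word_op w m h v)"
  by (simp add: tensor_op_def)

text \<open>The three families of relators are annihilated by commutativity of multiplication, by
  \<open>YY_commute\<close> and by \<open>YY_XX\<close>, respectively.\<close>

lemma ideal_annihilates:
  assumes "p \<in> cherednik_ideal W \<rho> S \<alpha> \<alpha>v c" "m \<in> U"
  shows "P_op p m = (\<lambda>h v. 0)"
proof -
  let ?A = "{p \<in> carrier PP. \<forall>m\<in>U. P_op p m = (\<lambda>h v. 0)}"
  define X Y where "X = (\<lambda>x. P.elt (tensor_x x) \<one>\<^bsub>W\<^esub> 0)" and "Y = (\<lambda>y. P.elt (tensor_y y) \<one>\<^bsub>W\<^esub> 0)"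
  have X: "X x \<in> carrier PP" "m \<in> U \<Longrightarrow> P_op (X x) m = XX x m" for x m
    by (simp_all add: tensor_xy_closed X_def P_op_elt GG_one tensor_op_x)
  have Y: "Y y \<in> carrier PP" "m \<in> U \<Longrightarrow> P_op (Y y) m = YY y m" for y m
    by (simp_all add: tensor_xy_closed Y_def P_op_elt GG_one tensor_op_y)
  have com: "commutator PP a b \<in> carrier PP"
    "m \<in> U \<Longrightarrow> P_op (commutator PP a b) m h v = P_op a (P_op b m) h v - P_op b (P_op a m) h v"
    if "a \<in> carrier PP" "b \<in> carrier PP" for a b m h v
    using that by (simp_all add: commutator_def P_op_minus P_op_mult)
  have 1: "commutator PP (X x) (X x') \<in> ?A" for x x'
  proof -
    have "P_op (commutator PP (X x) (X x')) m h v = 0" if "m \<in> U" for m h v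
      using that by (simp add: com X linear_opD(1)[OF linear_op_XX]) (simp add: XX_def mult.left_commute)
    then show ?thesis using com(1)[OF X(1) X(1)] by (simp add: fun_eq_iff)
  qed
  have 2: "commutator PP (Y y) (Y y') \<in> ?A" for y y'
  proof -
    have "P_op (commutator PP (Y y) (Y y')) m h v = 0" if "m \<in> U" for m h v
      using that by (simp add: com Y YY_closed YY_commute[of m y y'])
    then show ?thesis using com(1)[OF Y(1) Y(1)] by (simp add: fun_eq_iff)
  qed
  have 3: "commutator PP (Y y) (X x) \<ominus>\<^bsub>PP\<^esub> (P.elt (tensor_const (pairing y x)) \<one>\<^bsub>W\<^esub> 1 \<ominus>\<^bsub>PP\<^esub>
     (\<Oplus>\<^bsub>PP\<^esub>s\<in>S. P.elt (tensor_const (c s * pairing y (\<alpha> s) * pairing (\<alpha>v s) x)) s 0)) \<in> ?A" for x y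
  proof -
    let ?e = "\<lambda>s. P.elt (tensor_const (c s * pairing y (\<alpha> s) * pairing (\<alpha>v s) x)) s 0"
    let ?d = "P.elt (tensor_const (pairing y x)) \<one>\<^bsub>W\<^esub> 1"
    have fin: "finite S" using S_subset finite_W finite_subset by auto
    have e: "?e s \<in> carrier PP" "?d \<in> carrier PP" for s by (simp_all add: tensor_const_word)
    have s: "(\<Oplus>\<^bsub>PP\<^esub>s\<in>S. ?e s) \<in> carrier PP" using e by (intro P.P.finsum_closed) auto
    have cm: "commutator PP (Y y) (X x) \<in> carrier PP" by (rule com(1)[OF Y(1) X(1)])
    have "P_op (commutator PP (Y y) (X x) \<ominus>\<^bsub>PP\<^esub> (?d \<ominus>\<^bsub>PP\<^esub> (\<Oplus>\<^bsub>PP\<^esub>s\<in>S. ?e s))) m h v = 0" if m: "m \<in> U" for m h v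
    proof -
      have "P_op (commutator PP (Y y) (X x) \<ominus>\<^bsub>PP\<^esub> (?d \<ominus>\<^bsub>PP\<^esub> (\<Oplus>\<^bsub>PP\<^esub>s\<in>S. ?e s))) m h v
        = (YY y (XX x m) h v - XX x (YY y m) h v) - (P_op ?d m h v - (\<Sum>s\<in>S. P_op (?e s) m h v))"
        using m cm s e fin by (simp add: P_op_minus P_op_finsum com X Y YY_closed linear_opD(1)[OF linear_op_XX])
      also have "(\<Sum>s\<in>S. P_op (?e s) m h v) = (\<Sum>s\<in>S. c s * pairing y (\<alpha> s) * pairing (\<alpha>v s) x * GG s m h v)"
        using m by (intro sum.cong HOL.refl) (simp add: P_op_elt tensor_const_word tensor_op_word word_op_simps)
      also have "P_op ?d m h v = z * pairing y x * m h v"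
        using m by (simp add: P_op_elt tensor_const_word tensor_op_word word_op_simps GG_one)
      finally show ?thesis using m by (simp add: YY_XX)
    qed
    moreover have "commutator PP (Y y) (X x) \<ominus>\<^bsub>PP\<^esub> (?d \<ominus>\<^bsub>PP\<^esub> (\<Oplus>\<^bsub>PP\<^esub>s\<in>S. ?e s)) \<in> carrier PP"
      using cm s e by (intro P.P.minus_closed)
    ultimately show ?thesis by (simp add: fun_eq_iff)
  qed
  have "cherednik_relators W \<rho> S \<alpha> \<alpha>v c \<subseteq> ?A"
    using 1 2 3 unfolding cherednik_relators_def Let_def tensor_elt_def X_def Y_def by blast
  then have "cherednik_ideal W \<rho> S \<alpha> \<alpha>v c \<subseteq> ?A"
    unfolding cherednik_ideal_def by (rule P.P.genideal_minimal[OF annihilator_ideal])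
  then show ?thesis using assms by blast
qed

lemma tensor_op_top:
  assumes g: "g \<in> carrier W" and t: "t \<in> tensor_filt n"
  shows "degree_less n (\<lambda>v. tensor_op t (unit_at g) h v - tensor_symbol n t v * unit_at g h v)"
proof -
  let ?r = "\<lambda>w v. word_op w (unit_at g) h v - (if length w = n then monomial (coord v) w else 0) * unit_at g h v"
  have "degree_less n (?r w)" if "t w \<noteq> 0" for w
  proof (cases "length w = n")
    case True
    then show ?thesis using word_op_top[OF g, of w h] by simp
  next
    case False
    then have l: "Suc (length w) \<le> n" using t that by (auto simp: tensor_filt_def Suc_le_eq le_neq_implies_less)
    have u: "degree_le 0 (unit_at g h)"
      using degree_le.const[of "if h = g then 1 else 0"] by (simp add: unit_at_def)
    have "degree_le (length w + 0) (\<lambda>v. monomial (coord v) w * unit_at g h v)"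
      by (rule degree_le.mult[OF monomial_degree u])
    from degree_le.add[OF degree_less_imp_le[OF word_op_top[OF g, of w h]] this[simplified]]
    have "degree_less (Suc (length w)) (word_op w (unit_at g) h)" by (simp add: degree_less_def)
    then show ?thesis using degree_less_mono[OF l] False by simp
  qed
  then have "degree_less n (\<lambda>v. \<Sum>w | t w \<noteq> 0. t w * ?r w v)"
    by (intro degree_less_sum degree_less_scale) simp
  then show ?thesis
    by (simp add: tensor_op_def tensor_symbol_def word_sum_def sum_distrib_right right_diff_distrib sum_subtractf mult.assoc)
qed

text \<open>An element of the ideal sends \<open>unit_at \<one>\<close> to zero, while to leading
  order the result is its symbol with hbar set to \<open>z\<close>. The symbol is thus of degree
  less than \<open>n\<close> and homogeneous of degree \<open>n\<close> at once, hence zero.\<close>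

lemma symbol_at_parameter_zero:
  assumes p: "p \<in> carrier PP" "\<And>k g. g \<in> carrier W \<Longrightarrow> p k g \<in> tensor_filt n"
    and I: "p \<in> cherednik_ideal W \<rho> S \<alpha> \<alpha>v c" and N: "\<And>k. k > N \<Longrightarrow> p k = \<zero>\<^bsub>tensor_smash W \<rho>\<^esub>"
    and h: "h \<in> carrier W"
  shows "(\<Sum>k\<le>N. tensor_symbol n (p k h) v * z ^ k) = 0"
proof -
  let ?f = "\<lambda>v. \<Sum>k\<le>N. tensor_symbol n (p k h) v * z ^ k"
  have u: "unit_at \<one>\<^bsub>W\<^esub> \<in> U" by (simp add: unit_at_closed)
  have "0 = (\<Sum>k\<le>N. z ^ k * (\<Sum>g\<in>carrier W. tensor_op (p k g) (unit_at g) h v))" for v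
    using fun_cong[OF fun_cong[OF ideal_annihilates[OF I u], of h], of v] P_op_bound[of N p, OF N]
    by (simp add: smash_op_def GG_unit_at)
  moreover have "degree_less n (\<lambda>v. \<Sum>k\<le>N. z ^ k * (\<Sum>g\<in>carrier W. tensor_op (p k g) (unit_at g) h v - tensor_symbol n (p k g) v * unit_at g h v))"
    using p by (intro degree_less_sum degree_less_scale tensor_op_top) auto
  moreover have "(\<Sum>k\<le>N. z ^ k * (\<Sum>g\<in>carrier W. tensor_op (p k g) (unit_at g) h v - tensor_symbol n (p k g) v * unit_at g h v))
    = (\<Sum>k\<le>N. z ^ k * (\<Sum>g\<in>carrier W. tensor_op (p k g) (unit_at g) h v)) - ?f v" for v
  proof -
    \<comment> \<open>Group elements are told apart here: the vectors \<open>unit_at g\<close> have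
      disjoint supports, so evaluation at \<open>h\<close> isolates the coefficient of
      \<open>h\<close>.\<close>
    have "(\<Sum>g\<in>carrier W. tensor_symbol n (p k g) v * unit_at g h v) = tensor_symbol n (p k h) v" for k
    proof -
      have "(\<Sum>g\<in>carrier W. tensor_symbol n (p k g) v * unit_at g h v) = (\<Sum>g\<in>carrier W. if h = g then tensor_symbol n (p k g) v else 0)"
        by (intro sum.cong HOL.refl) (simp add: unit_at_def)
      then show ?thesis using h finite_W by simp
    qed
    then show ?thesis by (simp add: sum_subtractf right_diff_distrib mult.commute)
  qed
  ultimately have "degree_less n (\<lambda>v. - ?f v)" by simp
  from degree_less_scale[OF this, of "-1"] have "degree_less n ?f" by simp
  then show ?thesis
    by (rule degree_less_homogeneous) (simp add: tensor_symbol_homogeneous sum_distrib_left mult.assoc)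
qed

end

section \<open>The associated graded ring of the Cherednik algebra\<close>

lemma tensor_symbol_const: "tensor_symbol 0 (tensor_const k) = (\<lambda>_. k)"
  by (simp add: tensor_const_word tensor_symbol_word)

lemma tensor_symbol_x: "tensor_symbol 1 (tensor_x x) = (\<lambda>(p, q). pairing p x)"
  by (auto simp: tensor_symbol_def word_sum_tensor_x monomial_Cons coord_def pairing_def fun_eq_iff mult.commute)

lemma tensor_symbol_y: "tensor_symbol 1 (tensor_y y) = (\<lambda>(p, q). pairing y q)"
  by (auto simp: tensor_symbol_def word_sum_tensor_y monomial_Cons coord_def pairing_def fun_eq_iff)

lemma tensor_x_axis: "tensor_x (axis i 1) = tensor_word 1 [Inr i]"
  by (rule tensor_eqI) (use tensor_x_filt in \<open>auto simp: tensor_filt_def word_sum_tensor_x axis_def if_distrib[of "\<lambda>c. c * _"] cong: if_cong\<close>)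

lemma tensor_y_axis: "tensor_y (axis i 1) = tensor_word 1 [Inl i]"
  by (rule tensor_eqI) (use tensor_y_filt in \<open>auto simp: tensor_filt_def word_sum_tensor_y axis_def if_distrib[of "\<lambda>c. c * _"] cong: if_cong\<close>)

text \<open>The parameter \<open>z\<close> occurs in no assumption of \<open>dunkl\<close> and hence
  is not an argument of its predicate; one instance of the predicate gives the facts for all values
  of hbar.\<close>

locale cherednik = real_rep W \<rho>
  for W :: "('g, 'z) monoid_scheme" and \<rho> :: "'g \<Rightarrow> real ^ 'i ^ 'i::finite" +
  fixes S :: "'g set" and \<alpha> \<alpha>v :: "'g \<Rightarrow> complex ^ 'i" and c :: "'g \<Rightarrow> complex"
  assumes dunkl_all: "dunkl W \<rho> S \<alpha> \<alpha>v c"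
begin

section \<open>The symbol on the Cherednik algebra\<close>

sublocale TT: skew_group_ring W "tensor_act W \<rho>" "tensor_algebra :: (('i + 'i) list \<Rightarrow> complex) ring"
  by (rule tensor_skew)

sublocale FF: skew_group_ring W "polyfun_act W \<rho>" "polyfun_ring :: ((complex ^ 'i) \<times> (complex ^ 'i) \<Rightarrow> complex) ring"
  by (rule polyfun_skew)

abbreviation "PA \<equiv> UP (tensor_smash W \<rho>)"
abbreviation "AA \<equiv> UP (poly_smash W \<rho>)"
abbreviation "II \<equiv> cherednik_ideal W \<rho> S \<alpha> \<alpha>v c"
abbreviation "HH \<equiv> cherednik_algebra W \<rho> S \<alpha> \<alpha>v c"
abbreviation "PF \<equiv> (\<lambda>n. {p \<in> carrier PA. \<forall>k. p k \<in> carrier W \<rightarrow>\<^sub>E tensor_filt n})"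
abbreviation "PS \<equiv> (\<lambda>n p k. \<lambda>g\<in>carrier W. tensor_symbol n (p k g))"
abbreviation "HF \<equiv> (\<lambda>n. (+>\<^bsub>PA\<^esub>) II ` PF n)"
abbreviation "HS \<equiv> quotient_symbol PA II PF PS"

sublocale PSF: symbol_family PA PF AA PS
  by (rule symbol_family_UP[OF symbol_family_smash[OF tensor_skew polyfun_skew tensor_symbol_family]])
    (simp_all add: tensor_symbol_equivariant)

lemma S_facts: "finite S" "s \<in> S \<Longrightarrow> s \<in> carrier W"
  using dunkl.S_subset[OF dunkl_all] finite_subset[OF _ finite_W] by auto

lemma elt_filt:
  assumes "t \<in> tensor_filt d" "g \<in> carrier W"
  shows "TT.elt t g n \<in> PF d"
proof -
  interpret T: symbol_family tensor_algebra tensor_filt polyfun_ring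
    "tensor_symbol :: nat \<Rightarrow> (('i + 'i) list \<Rightarrow> complex) \<Rightarrow> _"
    by (rule tensor_symbol_family)
  have t: "t \<in> carrier tensor_algebra" using assms(1) by (simp add: tensor_filt_def)
  have "TT.elt t g n k h \<in> tensor_filt d" if "h \<in> carrier W" for k h
    using assms(1) that T.F_zero[of d] unfolding TT.elt_apply[OF t] by (auto simp: smash_single_def TT.smash_zero)
  moreover have "TT.elt t g n k \<in> extensional (carrier W)" for k
    unfolding TT.elt_apply[OF t] by (auto simp: smash_single_def TT.smash_zero)
  ultimately show ?thesis using t by (auto simp: PiE_def)
qed

lemma elt_symbol:
  assumes "t \<in> tensor_filt d" "g \<in> carrier W"
  shows "PS d (TT.elt t g n) = FF.elt (tensor_symbol d t) g n"
proof -
  interpret T: symbol_family tensor_algebra tensor_filt polyfun_ring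
    "tensor_symbol :: nat \<Rightarrow> (('i + 'i) list \<Rightarrow> complex) \<Rightarrow> _"
    by (rule tensor_symbol_family)
  have t: "t \<in> carrier tensor_algebra" "tensor_symbol d t \<in> carrier polyfun_ring"
    using assms(1) T.sym_closed by (auto simp: tensor_filt_def)
  show ?thesis using T.sym_zero[of d]
    by (intro ext, simp only: TT.elt_apply[OF t(1)] FF.elt_apply[OF t(2)])
      (auto simp: smash_single_def TT.smash_zero FF.smash_zero)
qed

lemma word_elt_filt: "g \<in> carrier W \<Longrightarrow> TT.elt (tensor_word k w) g n \<in> PF (length w)"
  by (intro elt_filt word_tensor_filt) auto

lemma relators_closed: "cherednik_relators W \<rho> S \<alpha> \<alpha>v c \<subseteq> carrier PA"
proof -
  have com: "a \<in> carrier PA \<Longrightarrow> b \<in> carrier PA \<Longrightarrow> commutator PA a b \<in> carrier PA" for a b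
    by (simp add: commutator_def)
  have "(\<Oplus>\<^bsub>PA\<^esub>s\<in>S. TT.elt (tensor_const (k s)) s 0) \<in> carrier PA" for k
    by (intro TT.P.finsum_closed) (simp add: tensor_const_word)
  then show ?thesis
    by (auto simp: tensor_xy_closed cherednik_relators_def Let_def tensor_elt_def tensor_const_word intro!: com TT.P.minus_closed)
qed

lemma ideal_II: "ideal II PA"
  unfolding cherednik_ideal_def by (rule TT.P.genideal_ideal[OF relators_closed])

lemma relators_in_II: "r \<in> cherednik_relators W \<rho> S \<alpha> \<alpha>v c \<Longrightarrow> r \<in> II"
  unfolding cherednik_ideal_def using TT.P.genideal_self[OF relators_closed] by blast

text \<open>For each point the specialised symbol is a polynomial in \<open>z\<close> whose
  coefficients are the symbols of the powers of hbar. It vanishes for every complex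
  \<open>z\<close>, so all its coefficients do.\<close>

lemma symbol_zero_on_ideal:
  assumes "p \<in> PF n" "p \<in> II"
  shows "PS n p = \<zero>\<^bsub>AA\<^esub>"
proof -
  have p: "p \<in> carrier PA" "\<And>k g. g \<in> carrier W \<Longrightarrow> p k g \<in> tensor_filt n" using assms(1) by auto
  obtain N where N: "\<And>k. k > N \<Longrightarrow> p k = \<zero>\<^bsub>TT.SG\<^esub>"
    using p(1) by (auto simp: UP_def up_def bound_def)
  have "tensor_symbol n (p k h) v = 0" if h: "h \<in> carrier W" for k h v
  proof (cases "k \<le> N")
    case True
    have "(\<Sum>k\<le>N. tensor_symbol n (p k h) v * z ^ k) = 0" for z
      by (rule dunkl.symbol_at_parameter_zero[OF dunkl_all p assms(2) N h])
    then show ?thesis using True polyfun_eq_0[of "\<lambda>k. tensor_symbol n (p k h) v" N] by blast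
  next
    case False
    then show ?thesis using N[of k] h by (simp add: TT.smash_zero tensor_symbol_def tensor_zero)
  qed
  then show ?thesis by (auto simp: UP_def FF.smash_zero polyfun_ops fun_eq_iff)
qed

lemma HH_def: "HH = PA Quot II"
  by (simp add: cherednik_algebra_def)

sublocale HSF: symbol_family HH HF AA HS
  unfolding HH_def by (rule PSF.quotient_symbol(1)[OF ideal_II symbol_zero_on_ideal])

lemma HS_coset: "p \<in> PF n \<Longrightarrow> HS n (II +>\<^bsub>PA\<^esub> p) = PS n p"
  by (rule PSF.quotient_symbol(2)[OF ideal_II symbol_zero_on_ideal])

lemma proj_hom: "ring_hom_ring PA HH ((+>\<^bsub>PA\<^esub>) II)"
  unfolding HH_def by (rule ideal.rcos_ring_hom_ring[OF ideal_II])

sublocale pr: ring_hom_ring PA HH "(+>\<^bsub>PA\<^esub>) II" by (rule proj_hom)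

abbreviation proj where "proj \<equiv> (\<lambda>p. II +>\<^bsub>PA\<^esub> p)"

lemma proj_minus: "a \<in> carrier PA \<Longrightarrow> b \<in> carrier PA \<Longrightarrow> proj (a \<ominus>\<^bsub>PA\<^esub> b) = proj a \<ominus>\<^bsub>HH\<^esub> proj b"
  by (simp add: a_minus_def)

lemma proj_ideal_zero: "a \<in> II \<Longrightarrow> proj a = \<zero>\<^bsub>HH\<^esub>"
  using ring.a_rcos_zero[OF TT.P.ring_axioms ideal_II] pr.hom_zero ideal.Icarr[OF ideal_II]
  by (metis HH_def FactRing_def ring_record_simps(11))

subsection \<open>The filtration\<close>

text \<open>The image of the length filtration satisfies the closure rules and contains the
  generators; conversely every tensor of bounded length is a sum of products of generators. The
  identification makes the symbol family on \<open>HF\<close> apply to the filtration in the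
  theorem.\<close>

lemma filtration_eq: "cherednik_filtration W \<rho> S \<alpha> \<alpha>v c n = HF n"
proof -
  define E where "E = (\<lambda>t g n. proj (TT.elt t g n))"
  define D where "D = {(E (tensor_const k) \<one>\<^bsub>W\<^esub> 0, 0) | k. True} \<union> {(E (tensor_const 1) \<one>\<^bsub>W\<^esub> 1, 0)}
     \<union> {(E (tensor_const 1) g 0, 0) | g. g \<in> carrier W}
     \<union> {(E (tensor_x x) \<one>\<^bsub>W\<^esub> 0, 1) | x. True} \<union> {(E (tensor_y y) \<one>\<^bsub>W\<^esub> 0, 1::nat) | y. True}"
  define Hf where "Hf = HF"
  let ?G = "generated_filtration HH D"
  have sub: "a \<in> HF n" if "?G n a" for n a
    using that
  proof induction
    case (generator a d)
    have 0: "E (tensor_const k) g j \<in> Hf 0" if "g \<in> carrier W" for k g j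
      using word_elt_filt[OF that, of k "[]" j] unfolding Hf_def E_def tensor_const_word by (intro imageI) simp
    have 1: "E (tensor_x x) \<one>\<^bsub>W\<^esub> 0 \<in> Hf 1" "E (tensor_y y) \<one>\<^bsub>W\<^esub> 0 \<in> Hf 1" for x y
      unfolding Hf_def E_def by (intro imageI elt_filt tensor_x_filt tensor_y_filt W.one_closed)+
    have "a \<in> Hf d" using generator 0 1 unfolding D_def by auto
    then show ?case by (simp only: Hf_def)
  next
    case zero
    show ?case by (rule HSF.F_zero)
  next
    case one
    show ?case by (rule HSF.F_one)
  next
    case (diff n a b)
    then show ?case by (intro HSF.F_minus)
  next
    case (mult k a n b)
    then show ?case by (intro HSF.F_mult)
  next
    case (mono n a)
    then show ?case by (intro HSF.F_Suc)
  qed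
  have sup: "?G n (proj p)" if p: "p \<in> PF n" for n p
  proof -
    have zero: "?G n \<zero>\<^bsub>HH\<^esub>" for n
      by (induction n) (auto intro: generated_filtration.intros)
    \<comment> \<open>The rules close the filtration under differences, so a sum is reached as
      \<open>a - (0 - b)\<close>.\<close>
    have add: "?G n (a \<oplus>\<^bsub>HH\<^esub> b)" if "?G n a" "?G n b" "a \<in> carrier HH" "b \<in> carrier HH" for n a b
    proof -
      have "?G n (a \<ominus>\<^bsub>HH\<^esub> (\<zero>\<^bsub>HH\<^esub> \<ominus>\<^bsub>HH\<^esub> b))"
        using that zero by (intro generated_filtration.diff)
      moreover have "a \<ominus>\<^bsub>HH\<^esub> (\<zero>\<^bsub>HH\<^esub> \<ominus>\<^bsub>HH\<^esub> b) = a \<oplus>\<^bsub>HH\<^esub> b"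
        using that by (simp add: HSF.R.minus_eq)
      ultimately show ?thesis by simp
    qed
    have mono: "?G n a \<Longrightarrow> m \<ge> n \<Longrightarrow> ?G m a" for n m a
      by (rotate_tac, induction m rule: dec_induct) (auto intro: generated_filtration.mono)
    have gens1: "?G 0 (E (tensor_const k) \<one>\<^bsub>W\<^esub> 0)" for k
      unfolding D_def
      by (intro generated_filtration.generator UnI1 CollectI exI[of _ k] conjI TrueI HOL.refl)
    have gens2: "?G 0 (E (tensor_const 1) \<one>\<^bsub>W\<^esub> 1)"
      unfolding D_def
      by (rule generated_filtration.generator, rule UnI1, rule UnI1, rule UnI1, rule UnI2, rule insertI1)
    have gens3: "?G 0 (E (tensor_const 1) g 0)" if "g \<in> carrier W" for g
      unfolding D_def
      by (rule generated_filtration.generator, rule UnI1, rule UnI1, rule UnI2)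
        (intro CollectI exI[of _ g] conjI HOL.refl that)
    have gens4: "?G 1 (E (tensor_x x) \<one>\<^bsub>W\<^esub> 0)" for x
      unfolding D_def
      by (rule generated_filtration.generator, rule UnI1, rule UnI2)
        (intro CollectI exI[of _ x] conjI TrueI HOL.refl)
    have gens5: "?G 1 (E (tensor_y y) \<one>\<^bsub>W\<^esub> 0)" for y
      unfolding D_def
      by (rule generated_filtration.generator, rule UnI2)
        (intro CollectI exI[of _ y] conjI TrueI HOL.refl)
    have word: "?G (length w) (E (tensor_word k w) \<one>\<^bsub>W\<^esub> 0)" for k w
    proof (induction w)
      case Nil
      show ?case using gens1[of k] by (simp only: tensor_const_word list.size(3))
    next
      case (Cons l w)
      have "?G 1 (E (tensor_word 1 [l]) \<one>\<^bsub>W\<^esub> 0)"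
        using gens4[of "axis _ 1"] gens5[of "axis _ 1"] by (cases l) (simp_all add: tensor_x_axis tensor_y_axis)
      from generated_filtration.mult[OF this Cons.IH] show ?case
        using TT.elt_mult[of "tensor_word 1 [l]" "tensor_word k w" "\<one>\<^bsub>W\<^esub>" "\<one>\<^bsub>W\<^esub>" 0 0]
        by (simp add: E_def TT.act_one tensor_word_mult flip: pr.hom_mult)
    qed
    have hbar: "?G 0 (E (tensor_word 1 []) \<one>\<^bsub>W\<^esub> n)" for n
    proof (induction n)
      case 0
      show ?case using gens1[of 1] by (simp add: tensor_const_word)
    next
      case (Suc n)
      from generated_filtration.mult[OF gens2 Suc] show ?case
        using TT.elt_mult[of "tensor_word 1 []" "tensor_word 1 []" "\<one>\<^bsub>W\<^esub>" "\<one>\<^bsub>W\<^esub>" 1 n]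
        by (simp add: E_def TT.act_one tensor_word_mult tensor_const_word flip: pr.hom_mult)
    qed
    \<comment> \<open>Group elements and hbar are generators of degree 0, so the factorisation of
      \<open>elt_factor\<close> keeps the degree at \<open>length w\<close>.\<close>
    have word': "?G (length w) (E (tensor_word k w) g j)" if g: "g \<in> carrier W" for k w g j
    proof -
      have "?G (length w + 0 + 0) (E (tensor_word k w) \<one>\<^bsub>W\<^esub> 0 \<otimes>\<^bsub>HH\<^esub> E (tensor_const 1) g 0 \<otimes>\<^bsub>HH\<^esub> E (tensor_word 1 []) \<one>\<^bsub>W\<^esub> j)"
        by (intro generated_filtration.mult word hbar gens3 g)
      moreover have "E (tensor_word k w) \<one>\<^bsub>W\<^esub> 0 \<otimes>\<^bsub>HH\<^esub> E (tensor_const 1) g 0 \<otimes>\<^bsub>HH\<^esub> E (tensor_word 1 []) \<one>\<^bsub>W\<^esub> j = E (tensor_word k w) g j"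
        using TT.elt_factor[of "tensor_word k w" g j] g
        by (simp add: E_def tensor_const_word tensor_one flip: pr.hom_mult)
      ultimately show ?thesis by simp
    qed
    show ?thesis
    proof (rule TT.smash_UP_induct[of p "tensor_filt n" "\<lambda>p. ?G n (proj p)"])
      show "p \<in> carrier PA" "\<And>k g. g \<in> carrier W \<Longrightarrow> p k g \<in> tensor_filt n" using p by auto
      show "tensor_filt n \<subseteq> carrier tensor_algebra" by (auto simp: tensor_filt_def)
      show "?G n (proj \<zero>\<^bsub>PA\<^esub>)" using zero by simp
      show "?G n (proj (x \<oplus>\<^bsub>PA\<^esub> y))" if "x \<in> carrier PA" "y \<in> carrier PA" "?G n (proj x)" "?G n (proj y)" for x y
      proof -
        have "?G n (proj x \<oplus>\<^bsub>HH\<^esub> proj y)" by (rule add[OF that(3,4)]) (simp_all add: that(1,2))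
        then show ?thesis using that(1,2) by (simp only: pr.hom_add)
      qed
      fix a :: "('i + 'i) list \<Rightarrow> complex" and g j assume a: "a \<in> tensor_filt n" and g: "g \<in> carrier W"
      have ac: "a \<in> carrier tensor_algebra" using a by (simp add: tensor_filt_def)
      have "?G n (E a g j)"
      proof (rule tensor_induct[OF ac, where Q = "\<lambda>a. ?G n (E a g j)"])
        have "smash_single W tensor_algebra (\<lambda>w. 0) g = \<zero>\<^bsub>TT.SG\<^esub>"
          by (auto simp: smash_single_def TT.smash_zero tensor_zero)
        then show "?G n (E (\<lambda>w. 0) g j)" using zero by (simp add: E_def)
        show "?G n (E (\<lambda>w. t w + t' w) g j)"
          if "t \<in> carrier tensor_algebra" "t' \<in> carrier tensor_algebra" "?G n (E t g j)" "?G n (E t' g j)" for t t'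
        proof -
          have "E (\<lambda>w. t w + t' w) g j = E t g j \<oplus>\<^bsub>HH\<^esub> E t' g j"
            using that(1,2) TT.elt_add[of t t' g j, symmetric] by (simp add: E_def tensor_add)
          moreover have "?G n (E t g j \<oplus>\<^bsub>HH\<^esub> E t' g j)"
            by (rule add[OF that(3,4)]) (simp_all add: E_def that(1,2))
          ultimately show ?thesis by (simp only:)
        qed
        \<comment> \<open>Words in the support of \<open>a\<close> may be shorter than
          \<open>n\<close>, hence the appeal to monotonicity.\<close>
        show "?G n (E (tensor_word (a w) w) g j)" if "a w \<noteq> 0" for w
          by (rule mono[OF word'[OF g]]) (use a that in \<open>simp add: tensor_filt_def\<close>)
      qed
      then show "?G n (proj (TT.elt a g j))" by (simp only: E_def)
    qed
  qed
  have eq: "cherednik_filtration W \<rho> S \<alpha> \<alpha>v c n = Collect (?G n)"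
    by (simp only: cherednik_filtration_def Let_def cherednik_elt_def tensor_elt_def D_def E_def)
  show ?thesis
    unfolding eq
  proof (intro equalityI subsetI)
    fix a assume "a \<in> Collect (?G n)"
    then show "a \<in> HF n" using sub[of n a] by (simp only: mem_Collect_eq)
  next
    fix a assume "a \<in> HF n"
    then obtain p where p: "p \<in> PF n" "a = proj p" by (rule imageE)
    show "a \<in> Collect (?G n)" unfolding p(2) mem_Collect_eq by (rule sup[OF p(1)])
  qed
qed

subsection \<open>Rearranging words\<close>

abbreviation "HP \<equiv> filt_pred HH HF"

definition word_class :: "('i + 'i) list \<Rightarrow> (nat \<Rightarrow> 'g \<Rightarrow> ('i + 'i) list \<Rightarrow> complex) set" where
  "word_class w = proj (TT.elt (tensor_word 1 w) \<one>\<^bsub>W\<^esub> 0)"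

lemma word_class_filt: "word_class w \<in> HF (length w)"
  unfolding word_class_def by (intro imageI word_elt_filt W.one_closed)

lemma word_class_closed [simp]: "word_class w \<in> carrier HH"
  by (rule HSF.F_carrier[OF word_class_filt])

lemma word_class_append: "word_class (u @ w) = word_class u \<otimes>\<^bsub>HH\<^esub> word_class w"
  unfolding word_class_def by (subst pr.hom_mult[symmetric]) (simp_all add: TT.elt_mult TT.act_one tensor_word_mult)

lemma word_class_Cons: "word_class (a # w) = word_class [a] \<otimes>\<^bsub>HH\<^esub> word_class w"
  using word_class_append[of "[a]" w] by simp

text \<open>The relations make commutators of generators have degree at most 0. Degree at most 1,
  one below the degree of a product of two letters, is all that rearranging words requires.\<close>

lemma commutator_filt: "word_class [a] \<otimes>\<^bsub>HH\<^esub> word_class [b] \<ominus>\<^bsub>HH\<^esub> word_class [b] \<otimes>\<^bsub>HH\<^esub> word_class [a] \<in> HF 1"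
proof -
  define X Y where "X = (\<lambda>x. TT.elt (tensor_x x) \<one>\<^bsub>W\<^esub> 0)" and "Y = (\<lambda>y. TT.elt (tensor_y y) \<one>\<^bsub>W\<^esub> 0)"
  have X: "X x \<in> carrier PA" and Y: "Y y \<in> carrier PA" for x y
    by (simp_all add: X_def Y_def tensor_xy_closed)
  have pc: "proj (commutator PA a b) = proj a \<otimes>\<^bsub>HH\<^esub> proj b \<ominus>\<^bsub>HH\<^esub> proj b \<otimes>\<^bsub>HH\<^esub> proj a"
    if "a \<in> carrier PA" "b \<in> carrier PA" for a b
    unfolding commutator_def using that by (subst proj_minus) simp_all
  have ox: "word_class [Inr i] = proj (X (axis i 1))" and oy: "word_class [Inl i] = proj (Y (axis i 1))" for i
    by (simp_all add: word_class_def X_def Y_def tensor_x_axis tensor_y_axis)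
  have XX: "proj (X x) \<otimes>\<^bsub>HH\<^esub> proj (X x') \<ominus>\<^bsub>HH\<^esub> proj (X x') \<otimes>\<^bsub>HH\<^esub> proj (X x) = \<zero>\<^bsub>HH\<^esub>" for x x'
  proof -
    have "commutator PA (X x) (X x') \<in> II"
      unfolding X_def
      by (rule relators_in_II, unfold cherednik_relators_def Let_def tensor_elt_def)
        (intro UnI1 CollectI exI[of _ x] exI[of _ x'] conjI TrueI HOL.refl)
    then show ?thesis unfolding pc[OF X X, symmetric] by (rule proj_ideal_zero)
  qed
  have YY: "proj (Y x) \<otimes>\<^bsub>HH\<^esub> proj (Y x') \<ominus>\<^bsub>HH\<^esub> proj (Y x') \<otimes>\<^bsub>HH\<^esub> proj (Y x) = \<zero>\<^bsub>HH\<^esub>" for x x'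
  proof -
    have "commutator PA (Y x) (Y x') \<in> II"
      unfolding Y_def
      by (rule relators_in_II, unfold cherednik_relators_def Let_def tensor_elt_def, rule UnI1, rule UnI2)
        (intro CollectI exI[of _ x] exI[of _ x'] conjI TrueI HOL.refl)
    then show ?thesis unfolding pc[OF Y Y, symmetric] by (rule proj_ideal_zero)
  qed
  have YX: "proj (Y y) \<otimes>\<^bsub>HH\<^esub> proj (X x) \<ominus>\<^bsub>HH\<^esub> proj (X x) \<otimes>\<^bsub>HH\<^esub> proj (Y y) \<in> HF 1" for x y
  proof -
    define d where "d = TT.elt (tensor_const (pairing y x)) \<one>\<^bsub>W\<^esub> 1 \<ominus>\<^bsub>PA\<^esub>
     (\<Oplus>\<^bsub>PA\<^esub>s\<in>S. TT.elt (tensor_const (c s * pairing y (\<alpha> s) * pairing (\<alpha>v s) x)) s 0)"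
    have e: "TT.elt (tensor_const k) g j \<in> PF 0" if "g \<in> carrier W" for k g j
      using word_elt_filt[OF that, of k "[]" j] by (simp only: tensor_const_word list.size)
    have d: "d \<in> PF 0"
      unfolding d_def by (intro PSF.F_minus PSF.F_finsum e W.one_closed S_facts)
    have dc: "d \<in> carrier PA" by (rule PSF.F_carrier[OF d])
    have cc: "commutator PA (Y y) (X x) \<in> carrier PA" using X Y by (simp add: commutator_def)
    have "commutator PA (Y y) (X x) \<ominus>\<^bsub>PA\<^esub> d \<in> II"
      unfolding X_def Y_def d_def
      by (rule relators_in_II, unfold cherednik_relators_def Let_def tensor_elt_def, rule UnI2)
        (intro CollectI exI[of _ y] exI[of _ x] conjI TrueI HOL.refl)
    then have "proj (commutator PA (Y y) (X x)) \<ominus>\<^bsub>HH\<^esub> proj d = \<zero>\<^bsub>HH\<^esub>"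
      unfolding proj_minus[OF cc dc, symmetric] by (rule proj_ideal_zero)
    then have "proj (commutator PA (Y y) (X x)) = proj d"
      using HSF.R.minus_eq_zero_iff[OF pr.hom_closed[OF cc] pr.hom_closed[OF dc]] by (simp only:)
    then have eq: "proj (Y y) \<otimes>\<^bsub>HH\<^esub> proj (X x) \<ominus>\<^bsub>HH\<^esub> proj (X x) \<otimes>\<^bsub>HH\<^esub> proj (Y y) = proj d"
      by (rule HOL.trans[OF pc[OF Y X, symmetric]])
    show ?thesis unfolding eq One_nat_def by (rule HSF.F_Suc[OF imageI[OF d]])
  qed
  have XY: "proj (X x) \<otimes>\<^bsub>HH\<^esub> proj (Y y) \<ominus>\<^bsub>HH\<^esub> proj (Y y) \<otimes>\<^bsub>HH\<^esub> proj (X x) \<in> HF 1" for x y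
  proof -
    have neg: "\<ominus>\<^bsub>HH\<^esub> (b \<ominus>\<^bsub>HH\<^esub> a) = a \<ominus>\<^bsub>HH\<^esub> b" if "a \<in> carrier HH" "b \<in> carrier HH" for a b
      using that by (simp add: a_minus_def HSF.R.minus_add HSF.R.a_comm[of b])
    have cl: "proj (X x) \<in> carrier HH" "proj (Y y) \<in> carrier HH" by (rule pr.hom_closed[OF X], rule pr.hom_closed[OF Y])
    have eq: "proj (X x) \<otimes>\<^bsub>HH\<^esub> proj (Y y) \<ominus>\<^bsub>HH\<^esub> proj (Y y) \<otimes>\<^bsub>HH\<^esub> proj (X x)
      = \<ominus>\<^bsub>HH\<^esub> (proj (Y y) \<otimes>\<^bsub>HH\<^esub> proj (X x) \<ominus>\<^bsub>HH\<^esub> proj (X x) \<otimes>\<^bsub>HH\<^esub> proj (Y y))"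
      by (rule neg[symmetric]) (intro HSF.R.m_closed cl)+
    show ?thesis unfolding eq by (rule HSF.F_neg[OF YX])
  qed
  have zero: "\<zero>\<^bsub>HH\<^esub> \<in> HF 1" by (rule HSF.F_zero)
  show ?thesis
  proof (cases a; cases b)
    fix i j assume "a = Inl i" "b = Inl j"
    then show ?thesis using zero by (simp only: oy YY)
  next
    fix i j assume "a = Inl i" "b = Inr j"
    then show ?thesis using YX[of "axis i 1" "axis j 1"] by (simp only: ox oy)
  next
    fix i j assume "a = Inr i" "b = Inl j"
    then show ?thesis using XY[of "axis i 1" "axis j 1"] by (simp only: ox oy)
  next
    fix i j assume "a = Inr i" "b = Inr j"
    then show ?thesis using zero by (simp only: ox XX)
  qed
qed

text \<open>The letter \<open>a\<close> travels to the front by single exchanges; each exchange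
  replaces two adjacent letters by an element of degree at most 1 and so costs a term of lower
  degree.\<close>

lemma word_class_move: "word_class (u @ a # v) \<ominus>\<^bsub>HH\<^esub> word_class (a # u @ v) \<in> HP (Suc (length u + length v))"
proof (induction u)
  case Nil
  show ?case using HSF.pred_zero by (simp add: HSF.R.minus_eq HSF.R.r_neg)
next
  case (Cons b u)
  let ?r = "word_class (u @ v)"
  have 1: "word_class [b] \<otimes>\<^bsub>HH\<^esub> (word_class (u @ a # v) \<ominus>\<^bsub>HH\<^esub> word_class (a # u @ v)) \<in> HP (Suc (length (b # u) + length v))"
    using HSF.pred_mult_left[OF word_class_filt[of "[b]"] Cons.IH] by simp
  have "(word_class [b] \<otimes>\<^bsub>HH\<^esub> word_class [a] \<ominus>\<^bsub>HH\<^esub> word_class [a] \<otimes>\<^bsub>HH\<^esub> word_class [b]) \<otimes>\<^bsub>HH\<^esub> ?r \<in> HP (Suc (1 + length (u @ v)))"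
    by (rule HSF.F_pred_Suc[OF HSF.F_mult[OF commutator_filt word_class_filt]])
  then have 2: "(word_class [b] \<otimes>\<^bsub>HH\<^esub> word_class [a] \<ominus>\<^bsub>HH\<^esub> word_class [a] \<otimes>\<^bsub>HH\<^esub> word_class [b]) \<otimes>\<^bsub>HH\<^esub> ?r \<in> HP (Suc (length (b # u) + length v))"
    by simp
  \<comment> \<open>The product \<open>B A R\<close> cancels between the error inherited from the
    induction and the error of exchanging \<open>B\<close> with \<open>A\<close>.\<close>
  have alg: "B \<otimes>\<^bsub>HH\<^esub> (X \<ominus>\<^bsub>HH\<^esub> A \<otimes>\<^bsub>HH\<^esub> R) \<oplus>\<^bsub>HH\<^esub> (B \<otimes>\<^bsub>HH\<^esub> A \<ominus>\<^bsub>HH\<^esub> A \<otimes>\<^bsub>HH\<^esub> B) \<otimes>\<^bsub>HH\<^esub> R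
    = B \<otimes>\<^bsub>HH\<^esub> X \<ominus>\<^bsub>HH\<^esub> A \<otimes>\<^bsub>HH\<^esub> (B \<otimes>\<^bsub>HH\<^esub> R)"
    if "A \<in> carrier HH" "B \<in> carrier HH" "X \<in> carrier HH" "R \<in> carrier HH" for A B X R
  proof -
    have "B \<otimes>\<^bsub>HH\<^esub> (X \<ominus>\<^bsub>HH\<^esub> A \<otimes>\<^bsub>HH\<^esub> R) \<oplus>\<^bsub>HH\<^esub> (B \<otimes>\<^bsub>HH\<^esub> A \<ominus>\<^bsub>HH\<^esub> A \<otimes>\<^bsub>HH\<^esub> B) \<otimes>\<^bsub>HH\<^esub> R
      = (B \<otimes>\<^bsub>HH\<^esub> X \<oplus>\<^bsub>HH\<^esub> \<ominus>\<^bsub>HH\<^esub> (B \<otimes>\<^bsub>HH\<^esub> (A \<otimes>\<^bsub>HH\<^esub> R))) \<oplus>\<^bsub>HH\<^esub> (B \<otimes>\<^bsub>HH\<^esub> (A \<otimes>\<^bsub>HH\<^esub> R) \<oplus>\<^bsub>HH\<^esub> \<ominus>\<^bsub>HH\<^esub> (A \<otimes>\<^bsub>HH\<^esub> (B \<otimes>\<^bsub>HH\<^esub> R)))"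
      using that by (simp add: HSF.R.minus_eq HSF.R.r_distr HSF.R.l_distr HSF.R.r_minus HSF.R.l_minus HSF.R.m_assoc)
    then show ?thesis
      using that by (simp add: HSF.R.minus_eq HSF.R.a_assoc HSF.R.r_neg1 HSF.R.r_neg2)
  qed
  have "word_class [b] \<otimes>\<^bsub>HH\<^esub> (word_class (u @ a # v) \<ominus>\<^bsub>HH\<^esub> word_class [a] \<otimes>\<^bsub>HH\<^esub> ?r)
      \<oplus>\<^bsub>HH\<^esub> (word_class [b] \<otimes>\<^bsub>HH\<^esub> word_class [a] \<ominus>\<^bsub>HH\<^esub> word_class [a] \<otimes>\<^bsub>HH\<^esub> word_class [b]) \<otimes>\<^bsub>HH\<^esub> ?r
    = word_class [b] \<otimes>\<^bsub>HH\<^esub> word_class (u @ a # v) \<ominus>\<^bsub>HH\<^esub> word_class [a] \<otimes>\<^bsub>HH\<^esub> (word_class [b] \<otimes>\<^bsub>HH\<^esub> ?r)"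
    by (rule alg) simp_all
  moreover have "word_class (a # u @ v) = word_class [a] \<otimes>\<^bsub>HH\<^esub> ?r" "word_class ((b # u) @ a # v) = word_class [b] \<otimes>\<^bsub>HH\<^esub> word_class (u @ a # v)"
    "word_class (a # (b # u) @ v) = word_class [a] \<otimes>\<^bsub>HH\<^esub> (word_class [b] \<otimes>\<^bsub>HH\<^esub> ?r)"
    using word_class_Cons[of a "u @ v"] word_class_Cons[of b "u @ a # v"] word_class_Cons[of a "b # u @ v"] word_class_Cons[of b "u @ v"] by simp_all
  ultimately show ?case using HSF.pred_add[OF 1 2] by simp
qed

text \<open>Insertion sort: the first letter of \<open>w\<close> is brought to the front of
  \<open>w'\<close>, and the induction hypothesis rearranges the remaining letters behind
  it.\<close>

lemma word_class_perm: "mset w = mset w' \<Longrightarrow> word_class w \<ominus>\<^bsub>HH\<^esub> word_class w' \<in> HP (length w)"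
proof (induction w arbitrary: w')
  case Nil
  then show ?case using HSF.pred_zero[of 0] by (simp add: HSF.R.minus_eq HSF.R.r_neg)
next
  case (Cons a w)
  then have "a \<in> set w'" by (metis list.set_intros(1) set_mset_mset)
  then obtain u v where w': "w' = u @ a # v" by (auto simp: in_set_conv_decomp)
  have ms: "mset w = mset (u @ v)" using Cons.prems by (simp add: w')
  have len: "length w = length u + length v" using arg_cong[OF ms, of size] by simp
  have 1: "word_class [a] \<otimes>\<^bsub>HH\<^esub> (word_class w \<ominus>\<^bsub>HH\<^esub> word_class (u @ v)) \<in> HP (length (a # w))"
    using HSF.pred_mult_left[OF word_class_filt[of "[a]"] Cons.IH[OF ms]] by simp
  have 2: "word_class (u @ a # v) \<ominus>\<^bsub>HH\<^esub> word_class (a # u @ v) \<in> HP (length (a # w))"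
    using word_class_move[of u a v] len by simp
  have "A \<otimes>\<^bsub>HH\<^esub> (X \<ominus>\<^bsub>HH\<^esub> Y) \<ominus>\<^bsub>HH\<^esub> (Z \<ominus>\<^bsub>HH\<^esub> A \<otimes>\<^bsub>HH\<^esub> Y) = A \<otimes>\<^bsub>HH\<^esub> X \<ominus>\<^bsub>HH\<^esub> Z"
    if "A \<in> carrier HH" "X \<in> carrier HH" "Y \<in> carrier HH" "Z \<in> carrier HH" for A X Y Z
  proof -
    have "A \<otimes>\<^bsub>HH\<^esub> (X \<ominus>\<^bsub>HH\<^esub> Y) \<ominus>\<^bsub>HH\<^esub> (Z \<ominus>\<^bsub>HH\<^esub> A \<otimes>\<^bsub>HH\<^esub> Y)
      = (A \<otimes>\<^bsub>HH\<^esub> X \<oplus>\<^bsub>HH\<^esub> \<ominus>\<^bsub>HH\<^esub> (A \<otimes>\<^bsub>HH\<^esub> Y)) \<oplus>\<^bsub>HH\<^esub> (A \<otimes>\<^bsub>HH\<^esub> Y \<oplus>\<^bsub>HH\<^esub> \<ominus>\<^bsub>HH\<^esub> Z)"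
      using that by (simp add: HSF.R.minus_eq HSF.R.r_distr HSF.R.r_minus HSF.R.minus_add HSF.R.a_comm)
    then show ?thesis using that by (simp add: HSF.R.minus_eq HSF.R.a_assoc HSF.R.r_neg1 HSF.R.r_neg2)
  qed
  then show ?case
    using HSF.pred_minus[OF 1 2] word_class_Cons[of a w] word_class_Cons[of a "u @ v"] by (simp add: w')
qed

end

section \<open>Kernel, span and independence of the symbols\<close>

context cherednik
begin

lemma elt_zero: "TT.elt (\<lambda>w. 0) g n = \<zero>\<^bsub>PA\<^esub>"
proof -
  have "smash_single W tensor_algebra (\<lambda>w. 0) g = \<zero>\<^bsub>TT.SG\<^esub>"
    by (auto simp: smash_single_def TT.smash_zero tensor_zero)
  then show ?thesis by simp
qed

lemma elt_tensor_add:
  "t \<in> carrier tensor_algebra \<Longrightarrow> t' \<in> carrier tensor_algebra \<Longrightarrow>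
    TT.elt (\<lambda>w. t w + t' w) g n = TT.elt t g n \<oplus>\<^bsub>PA\<^esub> TT.elt t' g n"
  using TT.elt_add[of t t' g n] by (simp add: tensor_add)

lemma word_elt_factor:
  assumes "g \<in> carrier W"
  shows "proj (TT.elt (tensor_word k w) g j) = word_class w \<otimes>\<^bsub>HH\<^esub> proj (TT.elt (tensor_word k []) g j)"
  unfolding word_class_def using assms
  by (subst pr.hom_mult[symmetric]) (simp_all add: TT.elt_mult TT.act_one tensor_word_mult)

text \<open>A coefficient with vanishing symbol is built from shorter words and from differences of
  rearranged words of length \<open>n\<close>; both kinds have classes in the previous filtration
  step.\<close>

lemma symbol_kernel:
  assumes p: "p \<in> PF n" "PS n p = \<zero>\<^bsub>AA\<^esub>"
  shows "proj p \<in> HP n"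
proof -
  define K where "K = HP n"
  have zero: "\<zero>\<^bsub>HH\<^esub> \<in> K" unfolding K_def by (rule HSF.pred_zero)
  have add: "a \<oplus>\<^bsub>HH\<^esub> b \<in> K" if "a \<in> K" "b \<in> K" for a b
    using that unfolding K_def by (rule HSF.pred_add)
  have "proj p \<in> K"
  proof (rule TT.smash_UP_induct[of p "{t \<in> tensor_filt n. tensor_symbol n t = (\<lambda>v. 0)}" "\<lambda>p. proj p \<in> K"])
    show pc: "p \<in> carrier PA" using p by auto
    show "p k g \<in> {t \<in> tensor_filt n. tensor_symbol n t = (\<lambda>v. 0)}" if "g \<in> carrier W" for k g
    proof -
      have "PS n p k g = \<zero>\<^bsub>AA\<^esub> k g" by (rule fun_cong[OF fun_cong[OF p(2)]])
      then have "tensor_symbol n (p k g) = (\<lambda>v. 0)"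
        using that by (simp add: UP_def FF.smash_zero polyfun_ops)
      then show ?thesis using p(1) that by auto
    qed
    show "{t \<in> tensor_filt n. tensor_symbol n t = (\<lambda>v. 0)} \<subseteq> carrier (tensor_algebra :: (('i + 'i) list \<Rightarrow> complex) ring)"
      by (auto simp: tensor_filt_def)
    show "proj \<zero>\<^bsub>PA\<^esub> \<in> K" using zero by (simp only: pr.hom_zero)
    show "proj (x \<oplus>\<^bsub>PA\<^esub> y) \<in> K" if "x \<in> carrier PA" "y \<in> carrier PA" "proj x \<in> K" "proj y \<in> K" for x y
      using that add by (simp only: pr.hom_add)
    fix t :: "('i + 'i) list \<Rightarrow> complex" and g j
    assume t: "t \<in> {t \<in> tensor_filt n. tensor_symbol n t = (\<lambda>v. 0)}" and g: "g \<in> carrier W"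
    show "proj (TT.elt t g j) \<in> K"
    proof (rule tensor_symbol_kernel_induct[of t n "\<lambda>t. proj (TT.elt t g j) \<in> K"])
      show "t \<in> tensor_filt n" "tensor_symbol n t = (\<lambda>v. 0)" using t by auto
      show "proj (TT.elt (\<lambda>w. 0) g j) \<in> K" unfolding elt_zero pr.hom_zero by (rule zero)
      show "proj (TT.elt (\<lambda>w. t w + t' w) g j) \<in> K"
        if "t \<in> carrier tensor_algebra" "t' \<in> carrier tensor_algebra" "proj (TT.elt t g j) \<in> K" "proj (TT.elt t' g j) \<in> K" for t t'
        using that add by (simp only: elt_tensor_add pr.hom_add TT.elt_closed)
      show "proj (TT.elt (tensor_word k w) g j) \<in> K" if "length w < n" for w k
      proof -
        obtain m where m: "n = Suc m" "length w \<le> m" using \<open>length w < n\<close> by (cases n) auto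
        have "proj (TT.elt (tensor_word k w) g j) \<in> HF m"
          by (intro imageI elt_filt word_tensor_filt m(2) g)
        then show ?thesis unfolding K_def m(1) by (rule HSF.F_pred_Suc)
      qed
      show "proj (TT.elt (\<lambda>u. tensor_word k w u - tensor_word k w' u) g j) \<in> K"
        if "length w = n" "mset w = mset w'" for w w' k
      proof -
        \<comment> \<open>Scalar, group element and power of hbar are split off as a right factor of
          degree 0, so that the rearrangement of plain words applies.\<close>
        let ?c = "proj (TT.elt (tensor_word k []) g j)"
        have c: "?c \<in> HF 0" by (intro imageI elt_filt word_tensor_filt g) simp
        have cc: "?c \<in> carrier HH" by (rule HSF.F_carrier[OF c])
        have "(word_class w \<ominus>\<^bsub>HH\<^esub> word_class w') \<otimes>\<^bsub>HH\<^esub> ?c \<in> HP (length w + 0)"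
          by (rule HSF.pred_mult_right[OF word_class_perm[OF that(2)] c])
        moreover have "(word_class w \<ominus>\<^bsub>HH\<^esub> word_class w') \<otimes>\<^bsub>HH\<^esub> ?c = word_class w \<otimes>\<^bsub>HH\<^esub> ?c \<ominus>\<^bsub>HH\<^esub> word_class w' \<otimes>\<^bsub>HH\<^esub> ?c"
          using cc by (simp add: a_minus_def HSF.R.l_distr HSF.R.l_minus)
        moreover have "\<dots> = proj (TT.elt (tensor_word k w) g j \<ominus>\<^bsub>PA\<^esub> TT.elt (tensor_word k w') g j)"
          unfolding word_elt_factor[OF g, symmetric] by (rule proj_minus[symmetric]) simp_all
        moreover have "TT.elt (tensor_word k w) g j \<ominus>\<^bsub>PA\<^esub> TT.elt (tensor_word k w') g j
          = TT.elt (\<lambda>u. tensor_word k w u - tensor_word k w' u) g j"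
        proof -
          have dc: "(\<lambda>u. tensor_word k w u - tensor_word k w' u) \<in> carrier tensor_algebra"
            by (subst tensor_minus[symmetric]) (simp_all add: ring.ring_simprules(4)[OF tensor_ring])
          have "TT.elt (\<lambda>u. tensor_word k w u - tensor_word k w' u) g j \<oplus>\<^bsub>PA\<^esub> TT.elt (tensor_word k w') g j
            = TT.elt (tensor_word k w) g j"
            using elt_tensor_add[OF dc tensor_word_closed, of k w' g j] by simp
          then have "TT.elt (tensor_word k w) g j \<ominus>\<^bsub>PA\<^esub> TT.elt (tensor_word k w') g j
            = (TT.elt (\<lambda>u. tensor_word k w u - tensor_word k w' u) g j \<oplus>\<^bsub>PA\<^esub> TT.elt (tensor_word k w') g j)
               \<ominus>\<^bsub>PA\<^esub> TT.elt (tensor_word k w') g j" by (simp only:)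
          then show ?thesis using dc by (simp add: a_minus_def TT.P.a_assoc TT.P.r_neg)
        qed
        ultimately show ?thesis using that(1) unfolding K_def by simp
      qed
    qed
  qed
  then show ?thesis unfolding K_def .
qed

text \<open>Monomials times a group element and a power of hbar are symbols of words, and polynomial
  functions are combinations of monomials.\<close>

lemma AA_span:
  assumes b: "b \<in> carrier AA"
  shows "b \<in> symbol_sums HF HH AA HS"
proof -
  define Q where "Q = symbol_sums HF HH AA HS"
  have add: "x \<oplus>\<^bsub>AA\<^esub> y \<in> Q" if "x \<in> Q" "y \<in> Q" for x y
    using that unfolding Q_def by (rule HSF.symbol_sums_add)
  have single: "FF.elt (tensor_symbol d t) g n \<in> Q" if "t \<in> tensor_filt d" "g \<in> carrier W" for d t g n
    using HSF.symbol_sums_single[OF imageI[OF elt_filt[OF that]]]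
    unfolding Q_def HS_coset[OF elt_filt[OF that]] elt_symbol[OF that] .
  have "FF.elt (\<lambda>v. 0) g n = \<zero>\<^bsub>AA\<^esub>" for g n
  proof -
    have "smash_single W polyfun_ring (\<lambda>v. 0) g = \<zero>\<^bsub>FF.SG\<^esub>"
      by (auto simp: smash_single_def FF.smash_zero polyfun_ops)
    then show ?thesis by simp
  qed
  moreover have "FF.elt (\<lambda>v. 0) \<one>\<^bsub>W\<^esub> 0 \<in> Q"
    using single[OF word_tensor_filt[of "[]" 0 0], of "\<one>\<^bsub>W\<^esub>" 0] by (simp add: tensor_symbol_word)
  ultimately have zero: "\<zero>\<^bsub>AA\<^esub> \<in> Q" "\<And>g n. FF.elt (\<lambda>v. 0) g n \<in> Q" by simp_all
  have "b \<in> Q"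
  proof (rule FF.smash_UP_induct[of b "polyfuns" "\<lambda>b. b \<in> Q"])
    show "b k g \<in> polyfuns" if "g \<in> carrier W" for k g
      using FF.smash_closed[OF FF.UP_carrier_coeff[OF b] that] by (simp add: polyfun_ops)
    show "polyfuns \<subseteq> carrier polyfun_ring" by (simp add: polyfun_ops)
    fix f :: "(complex ^ 'i) \<times> (complex ^ 'i) \<Rightarrow> complex" and g n
    assume f: "f \<in> polyfuns" and g: "g \<in> carrier W"
    obtain t where t: "t \<in> carrier tensor_algebra" "\<And>v. f v = word_sum t (monomial (coord v))"
      using polyfun_tensor[OF f] by blast
    have pf: "(\<lambda>v. word_sum t (monomial (coord v))) \<in> polyfuns" for t :: "('i + 'i) list \<Rightarrow> complex"
      unfolding word_sum_def by (intro polyfun_sum polyfuns.mult polyfuns.const monomial_polyfun)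
    have "FF.elt (\<lambda>v. word_sum t (monomial (coord v))) g n \<in> Q"
    proof (rule tensor_induct[OF t(1), where Q = "\<lambda>t. FF.elt (\<lambda>v. word_sum t (monomial (coord v))) g n \<in> Q"])
      show "FF.elt (\<lambda>v. word_sum (\<lambda>w. 0) (monomial (coord v))) g n \<in> Q" by (simp add: zero)
      show "FF.elt (\<lambda>v. word_sum (\<lambda>w. t w + t' w) (monomial (coord v))) g n \<in> Q"
        if "t \<in> carrier tensor_algebra" "t' \<in> carrier tensor_algebra"
          "FF.elt (\<lambda>v. word_sum t (monomial (coord v))) g n \<in> Q" "FF.elt (\<lambda>v. word_sum t' (monomial (coord v))) g n \<in> Q" for t t'
        using add[OF that(3,4)] FF.elt_add[of "\<lambda>v. word_sum t (monomial (coord v))" "\<lambda>v. word_sum t' (monomial (coord v))" g n]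
        by (simp add: polyfun_ops pf word_sum_add that(1,2))
      show "FF.elt (\<lambda>v. word_sum (tensor_word (t w) w) (monomial (coord v))) g n \<in> Q" for w
        using single[OF word_tensor_filt[of w "length w" "t w"] g, of n] by (simp add: tensor_symbol_word)
    qed
    moreover have "f = (\<lambda>v. word_sum t (monomial (coord v)))" by (rule ext) (rule t(2))
    ultimately show "FF.elt f g n \<in> Q" by (simp only:)
  qed (use b zero add in auto)
  then show ?thesis unfolding Q_def .
qed

text \<open>Replacing the point \<open>v\<close> by its multiple by \<open>u\<close> turns the
  vanishing sum into a polynomial in \<open>u\<close> whose coefficients are the individual
  symbols.\<close>

lemma AA_indep:
  assumes h: "\<And>n. h n \<in> HF n" and sum: "(\<Oplus>\<^bsub>AA\<^esub>n\<in>{..N}. HS n (h n)) = \<zero>\<^bsub>AA\<^esub>" and m: "m \<le> N"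
  shows "HS m (h m) = \<zero>\<^bsub>AA\<^esub>"
proof -
  have "\<exists>p. p \<in> PF n \<and> h n = proj p" for n
  proof -
    obtain p where "p \<in> PF n" "h n = proj p" using h[of n] by (rule imageE)
    then show ?thesis by (intro exI[of _ p] conjI)
  qed
  from choice[OF allI[OF this]] obtain p where ph: "\<forall>n. p n \<in> PF n \<and> h n = proj (p n)" by (rule exE)
  have p: "p n \<in> PF n" "h n = proj (p n)" for n
    by (rule conjunct1[OF spec[OF ph]], rule conjunct2[OF spec[OF ph]])
  have HSp: "HS n (h n) = PS n (p n)" for n unfolding p(2) by (rule HS_coset[OF p(1)])
  have cl: "PS n (p n) \<in> carrier AA" for n by (rule PSF.sym_closed[OF p(1)])
  have "(\<Sum>n\<le>N. tensor_symbol n (p n k g) v) = 0" if g: "g \<in> carrier W" for k g v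
  proof -
    have "up_ring.coeff AA (\<Oplus>\<^bsub>AA\<^esub>n\<in>{..N}. PS n (p n)) k = (\<Oplus>\<^bsub>FF.SG\<^esub>n\<in>{..N}. up_ring.coeff AA (PS n (p n)) k)"
      by (rule FF.P.coeff_finsum) (use cl in auto)
    moreover have "(\<Oplus>\<^bsub>AA\<^esub>n\<in>{..N}. PS n (p n)) = \<zero>\<^bsub>AA\<^esub>" using sum by (simp add: HSp)
    ultimately have "\<zero>\<^bsub>FF.SG\<^esub> = (\<Oplus>\<^bsub>FF.SG\<^esub>n\<in>{..N}. PS n (p n) k)"
      by (simp add: FF.UP_coeff[OF cl])
    moreover have "(\<Oplus>\<^bsub>FF.SG\<^esub>n\<in>{..N}. PS n (p n) k) g = (\<Oplus>\<^bsub>polyfun_ring\<^esub>n\<in>{..N}. PS n (p n) k g)"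
      by (rule FF.smash_finsum[OF _ _ g]) (use FF.UP_carrier_coeff[OF cl] in auto)
    moreover have "(\<Oplus>\<^bsub>polyfun_ring\<^esub>n\<in>{..N}. PS n (p n) k g) = (\<lambda>v. \<Sum>n\<le>N. tensor_symbol n (p n k g) v)"
      using g by (subst polyfun_finsum) (auto simp: tensor_symbol_polyfun)
    ultimately have "\<zero>\<^bsub>FF.SG\<^esub> g v = (\<Sum>n\<le>N. tensor_symbol n (p n k g) v)" by simp
    then show ?thesis using g by (simp add: FF.smash_zero polyfun_ops)
  qed
  note sum0 = this
  have "tensor_symbol m (p m k g) v = 0" if g: "g \<in> carrier W" for k g v
  proof -
    have "(\<Sum>n\<le>N. tensor_symbol n (p n k g) v * u ^ n) = 0" for u
      using sum0[OF g, of k "(u *s fst v, u *s snd v)"] by (simp add: tensor_symbol_homogeneous mult.commute)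
    then show ?thesis using m polyfun_eq_0[of "\<lambda>n. tensor_symbol n (p n k g) v" N] by blast
  qed
  then have "PS m (p m) = \<zero>\<^bsub>AA\<^esub>"
    by (auto simp: UP_def FF.smash_zero polyfun_ops fun_eq_iff)
  then show ?thesis by (simp only: HSp)
qed

sublocale GSF: graded_symbol_family HH HF AA HS
proof
  fix n x assume x: "x \<in> HF n" "HS n x = \<zero>\<^bsub>AA\<^esub>"
  obtain p where p: "p \<in> PF n" "x = proj p" using x(1) by (rule imageE)
  show "x \<in> HP n" unfolding p(2) using x(2) unfolding p(2) HS_coset[OF p(1)] by (rule symbol_kernel[OF p(1)])
next
  fix b assume "b \<in> carrier AA"
  from AA_span[OF this] show "\<exists>h N. (\<forall>n. h n \<in> HF n) \<and> (\<forall>n>N. h n = \<zero>\<^bsub>HH\<^esub>) \<and> b = (\<Oplus>\<^bsub>AA\<^esub>n\<in>{..N}. HS n (h n))"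
    unfolding symbol_sums_def by (rule CollectD)
next
  fix h N n assume "\<And>n. h n \<in> HF n" "(\<Oplus>\<^bsub>AA\<^esub>n\<in>{..N}. HS n (h n)) = \<zero>\<^bsub>AA\<^esub>" "n \<le> N"
  then show "HS n (h n) = \<zero>\<^bsub>AA\<^esub>" by (rule AA_indep)
qed

subsection \<open>The natural homomorphism\<close>

lemma gr_cherednik_eq: "gr_cherednik W \<rho> S \<alpha> \<alpha>v c = GSF.Gr"
proof -
  have "cherednik_filtration W \<rho> S \<alpha> \<alpha>v c = HF" by (rule ext) (rule filtration_eq)
  then show ?thesis by (simp only: gr_cherednik_def)
qed

definition symbol_class :: "nat \<Rightarrow> (('i + 'i) list \<Rightarrow> complex) \<Rightarrow> 'g \<Rightarrow> nat \<Rightarrow> nat \<Rightarrow> (nat \<Rightarrow> 'g \<Rightarrow> ('i + 'i) list \<Rightarrow> complex) set set" where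
  "symbol_class d t g n = graded_symbol HH HF d (proj (TT.elt t g n))"

lemma symbol_class_closed: "t \<in> tensor_filt d \<Longrightarrow> g \<in> carrier W \<Longrightarrow> symbol_class d t g n \<in> carrier GSF.Gr"
  unfolding symbol_class_def by (intro GSF.graded_symbol_closed imageI elt_filt)

lemma gr_symbol_symbol_class:
  assumes "t \<in> tensor_filt d" "g \<in> carrier W"
  shows "GSF.gr_symbol (symbol_class d t g n) = FF.elt (tensor_symbol d t) g n"
  unfolding symbol_class_def GSF.gr_symbol_graded_symbol[OF imageI[OF elt_filt[OF assms]]]
    HS_coset[OF elt_filt[OF assms]] elt_symbol[OF assms] ..

lemma natural_hom_iff: "natural_hom W \<rho> S \<alpha> \<alpha>v c \<xi> \<longleftrightarrow>
    \<xi> \<in> ring_hom AA GSF.Gr \<and>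
    (\<forall>k. \<xi> (FF.elt (\<lambda>_. k) \<one>\<^bsub>W\<^esub> 0) = symbol_class 0 (tensor_const k) \<one>\<^bsub>W\<^esub> 0) \<and>
    \<xi> (FF.elt (\<lambda>_. 1) \<one>\<^bsub>W\<^esub> 1) = symbol_class 0 (tensor_const 1) \<one>\<^bsub>W\<^esub> 1 \<and>
    (\<forall>g\<in>carrier W. \<xi> (FF.elt (\<lambda>_. 1) g 0) = symbol_class 0 (tensor_const 1) g 0) \<and>
    (\<forall>x. \<xi> (FF.elt (\<lambda>(p, q). pairing p x) \<one>\<^bsub>W\<^esub> 0) = symbol_class 1 (tensor_x x) \<one>\<^bsub>W\<^esub> 0) \<and>
    (\<forall>y. \<xi> (FF.elt (\<lambda>(p, q). pairing y q) \<one>\<^bsub>W\<^esub> 0) = symbol_class 1 (tensor_y y) \<one>\<^bsub>W\<^esub> 0)"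
proof -
  have "cherednik_filtration W \<rho> S \<alpha> \<alpha>v c = HF" by (rule ext) (rule filtration_eq)
  then show ?thesis
    by (simp only: natural_hom_def Let_def gr_cherednik_eq cherednik_elt_def tensor_elt_def poly_elt_def symbol_class_def)
qed

lemma tensor_const_filt: "tensor_const k \<in> tensor_filt 0"
  unfolding tensor_const_word by (rule word_tensor_filt) simp

text \<open>The inverse of the symbol isomorphism already takes the prescribed values, because the
  symbol of the class of each generator is the corresponding generator of \<open>AA\<close>.\<close>

lemma natural_hom_exists: "\<exists>\<xi>. natural_hom W \<rho> S \<alpha> \<alpha>v c \<xi>"
proof -
  let ?\<xi> = "inv_into (carrier GSF.Gr) GSF.gr_symbol"
  have bij: "bij_betw GSF.gr_symbol (carrier GSF.Gr) (carrier AA)"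
    using GSF.gr_symbol_iso by (simp add: ring_iso_def)
  have "?\<xi> (FF.elt (tensor_symbol d t) g n) = symbol_class d t g n" if "t \<in> tensor_filt d" "g \<in> carrier W" for d t g n
    using bij symbol_class_closed[OF that] unfolding gr_symbol_symbol_class[OF that, symmetric]
    by (intro inv_into_f_f) (simp_all only: bij_betw_def)
  note xi = this
  show ?thesis
    unfolding natural_hom_iff
    using GSF.inverse_gr_symbol_hom xi[OF tensor_const_filt] xi[OF tensor_x_filt W.one_closed] xi[OF tensor_y_filt W.one_closed]
    by (intro exI[of _ ?\<xi>] conjI allI ballI)
      (simp_all only: tensor_symbol_const tensor_symbol_x tensor_symbol_y W.one_closed)
qed

text \<open>The composite \<open>\<psi>\<close> is only a ring endomorphism of \<open>AA\<close>;
  its values on the constants are therefore part of what is checked, since a ring endomorphism could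
  move complex scalars. The fixed elements are closed under sums and products, so fixing the
  generators is enough.\<close>

lemma natural_hom_iso:
  assumes nat: "natural_hom W \<rho> S \<alpha> \<alpha>v c \<xi>"
  shows "\<xi> \<in> ring_iso AA (gr_cherednik W \<rho> S \<alpha> \<alpha>v c)"
  unfolding gr_cherednik_eq
proof (rule GSF.ring_iso_of_section)
  show hom: "\<xi> \<in> ring_hom AA GSF.Gr" using nat unfolding natural_hom_iff by (rule conjunct1)
  define \<psi> where "\<psi> = (\<lambda>b. GSF.gr_symbol (\<xi> b))"
  have gh: "GSF.gr_symbol \<in> ring_hom GSF.Gr AA" using GSF.gr_symbol_iso by (simp add: ring_iso_def)
  have psi: "\<psi> \<in> ring_hom AA AA"
    using ring_hom_trans[OF hom gh] by (simp add: \<psi>_def o_def)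
  have fix_add: "\<psi> (x \<oplus>\<^bsub>AA\<^esub> y) = x \<oplus>\<^bsub>AA\<^esub> y" if "x \<in> carrier AA" "y \<in> carrier AA" "\<psi> x = x" "\<psi> y = y" for x y
    using ring_hom_add[OF psi that(1,2)] that(3,4) by simp
  have fix_mult: "\<psi> (x \<otimes>\<^bsub>AA\<^esub> y) = x \<otimes>\<^bsub>AA\<^esub> y" if "x \<in> carrier AA" "y \<in> carrier AA" "\<psi> x = x" "\<psi> y = y" for x y
    using ring_hom_mult[OF psi that(1,2)] that(3,4) by simp
  have c: "\<psi> (FF.elt (\<lambda>_. k) \<one>\<^bsub>W\<^esub> 0) = FF.elt (\<lambda>_. k) \<one>\<^bsub>W\<^esub> 0" for k
    using nat gr_symbol_symbol_class[OF tensor_const_filt W.one_closed, of k 0] unfolding natural_hom_iff \<psi>_def by (simp add: tensor_symbol_const)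
  have hb: "\<psi> (FF.elt (\<lambda>_. 1) \<one>\<^bsub>W\<^esub> 1) = FF.elt (\<lambda>_. 1) \<one>\<^bsub>W\<^esub> 1"
    using nat gr_symbol_symbol_class[OF tensor_const_filt W.one_closed, of 1 1] unfolding natural_hom_iff \<psi>_def by (simp add: tensor_symbol_const)
  have gg: "\<psi> (FF.elt (\<lambda>_. 1) g 0) = FF.elt (\<lambda>_. 1) g 0" if "g \<in> carrier W" for g
    using nat gr_symbol_symbol_class[OF tensor_const_filt that, of 1 0] that unfolding natural_hom_iff \<psi>_def by (simp add: tensor_symbol_const)
  have xx: "\<psi> (FF.elt (\<lambda>(p, q). pairing p x) \<one>\<^bsub>W\<^esub> 0) = FF.elt (\<lambda>(p, q). pairing p x) \<one>\<^bsub>W\<^esub> 0" for x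
    using nat gr_symbol_symbol_class[OF tensor_x_filt W.one_closed, of x 0] unfolding natural_hom_iff \<psi>_def by (simp add: tensor_symbol_x[simplified])
  have yy: "\<psi> (FF.elt (\<lambda>(p, q). pairing y q) \<one>\<^bsub>W\<^esub> 0) = FF.elt (\<lambda>(p, q). pairing y q) \<one>\<^bsub>W\<^esub> 0" for y
    using nat gr_symbol_symbol_class[OF tensor_y_filt W.one_closed, of y 0] unfolding natural_hom_iff \<psi>_def by (simp add: tensor_symbol_y[simplified])
  have cl: "f \<in> polyfuns \<Longrightarrow> FF.elt f g n \<in> carrier AA" for f g n by (simp add: polyfun_ops)
  have poly: "\<psi> (FF.elt f \<one>\<^bsub>W\<^esub> 0) = FF.elt f \<one>\<^bsub>W\<^esub> 0" if "f \<in> polyfuns" for f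
    using that
  proof induction
    case (add f f')
    then show ?case
      using fix_add[OF cl[OF add.hyps(1)] cl[OF add.hyps(2)] add.IH] FF.elt_add[of f f' "\<one>\<^bsub>W\<^esub>" 0] by (simp add: polyfun_ops)
  next
    case (mult f f')
    then show ?case
      using fix_mult[OF cl[OF mult.hyps(1)] cl[OF mult.hyps(2)] mult.IH] FF.elt_mult[of f f' "\<one>\<^bsub>W\<^esub>" "\<one>\<^bsub>W\<^esub>" 0 0]
      by (simp add: polyfun_ops FF.act_one)
  qed (simp_all add: c xx yy)
  have hbar: "\<psi> (FF.elt (\<lambda>_. 1) \<one>\<^bsub>W\<^esub> n) = FF.elt (\<lambda>_. 1) \<one>\<^bsub>W\<^esub> n" for n
  proof (induction n)
    case (Suc n)
    then show ?case
      using fix_mult[OF cl cl hb Suc] FF.elt_mult[of "\<lambda>_. 1" "\<lambda>_. 1" "\<one>\<^bsub>W\<^esub>" "\<one>\<^bsub>W\<^esub>" 1 n]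
      by (simp add: polyfun_ops polyfuns.const FF.act_one)
  qed (rule c)
  fix b assume b: "b \<in> carrier AA"
  have "\<psi> b = b"
  proof (rule FF.smash_UP_induct[of b "polyfuns" "\<lambda>b. \<psi> b = b"])
    show "b k g \<in> polyfuns" if "g \<in> carrier W" for k g
      using FF.smash_closed[OF FF.UP_carrier_coeff[OF b] that] by (simp add: polyfun_ops)
    show "polyfuns \<subseteq> carrier polyfun_ring" by (simp add: polyfun_ops)
    show "\<psi> \<zero>\<^bsub>AA\<^esub> = \<zero>\<^bsub>AA\<^esub>" by (rule ring_hom_zero[OF psi FF.P.ring_axioms FF.P.ring_axioms])
    fix f :: "(complex ^ 'i) \<times> (complex ^ 'i) \<Rightarrow> complex" and g n
    assume f: "f \<in> polyfuns" and g: "g \<in> carrier W"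
    have "FF.elt f g n = FF.elt f \<one>\<^bsub>W\<^esub> 0 \<otimes>\<^bsub>AA\<^esub> FF.elt (\<lambda>_. 1) g 0 \<otimes>\<^bsub>AA\<^esub> FF.elt (\<lambda>_. 1) \<one>\<^bsub>W\<^esub> n"
      using FF.elt_factor[of f g n] f g by (simp add: polyfun_ops)
    moreover have "\<psi> \<dots> = \<dots>"
      by (intro fix_mult FF.P.m_closed cl polyfuns.const f poly gg g hbar)
    ultimately show "\<psi> (FF.elt f g n) = FF.elt f g n" by simp
  qed (use b fix_add in auto)
  then show "GSF.gr_symbol (\<xi> b) = b" by (simp add: \<psi>_def)
qed

end

section \<open>Reflections of a finite Coxeter group\<close>

text \<open>Once \<open>s\<close> is known to differ from the identity by a rank-one map, the
  eigenvector equations make \<open>\<alpha>\<close> and \<open>\<alpha>v\<close> proportional to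
  \<open>a\<close> and \<open>b\<close>, and the normalisation fixes the product of the two
  factors.\<close>

lemma (in real_rep) reflection_formula:
  assumes s: "s \<in> carrier W" and rank: "\<And>v. rep \<rho> s *v v = v - pairing v a *s b"
    and \<alpha>: "dual_rep W \<rho> s *v \<alpha> = - \<alpha>"
    and \<alpha>v: "rep \<rho> s *v \<alpha>v = - \<alpha>v" and norm: "pairing \<alpha>v \<alpha> = 2"
  shows "rep \<rho> s *v y = y - pairing y \<alpha> *s \<alpha>v"
    and "rep \<rho> (inv\<^bsub>W\<^esub> s) *v y = y - pairing y \<alpha> *s \<alpha>v"
proof -
  have 1: "2 * pairing y \<alpha> = pairing y a * pairing b \<alpha>" for y
  proof -
    have "pairing y \<alpha> = pairing (rep \<rho> (inv\<^bsub>W\<^esub> s) *v (rep \<rho> s *v y)) \<alpha>" using s by (simp add: rep_inv)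
    also have "\<dots> = pairing (rep \<rho> s *v y) (- \<alpha>)" using s by (simp only: pairing_rep \<alpha>)
    finally show ?thesis by (simp add: rank pairing_linear)
  qed
  have 2: "2 *s \<alpha>v = pairing \<alpha>v a *s b"
    using \<alpha>v unfolding rank by (simp add: vec_eq_iff)
  \<comment> \<open>By \<open>1\<close> and \<open>2\<close>, twice \<open>\<alpha>\<close> and
    twice \<open>\<alpha>v\<close> are multiples of \<open>a\<close> and \<open>b\<close>. The
    product of the two multipliers is 4, which cancels the two factors 2.\<close>
  have 3: "pairing \<alpha>v a * pairing b \<alpha> = 4" using 1[of \<alpha>v] norm by simp
  have key: "pairing v \<alpha> *s \<alpha>v = pairing v a *s b" for v
  proof -
    have "4 *s (pairing v \<alpha> *s \<alpha>v) = (2 * pairing v \<alpha>) *s (2 *s \<alpha>v)" by (simp add: vector_smult_assoc)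
    also have "\<dots> = (pairing v a * (pairing \<alpha>v a * pairing b \<alpha>)) *s b"
      unfolding 1 2 by (simp add: vector_smult_assoc mult_ac)
    also have "\<dots> = 4 *s (pairing v a *s b)" unfolding 3 by (simp add: vector_smult_assoc)
    finally show ?thesis by (simp add: vec_eq_iff)
  qed
  show A: "rep \<rho> s *v y = y - pairing y \<alpha> *s \<alpha>v" for y by (simp add: rank key)
  \<comment> \<open>Since \<open>\<alpha>v\<close> and \<open>\<alpha>\<close> pair to 2, the
    formula squares to the identity; the inverse of \<open>s\<close> therefore acts by the same
    formula.\<close>
  have "rep \<rho> s *v (y - pairing y \<alpha> *s \<alpha>v) = y"
    by (simp add: A pairing_linear norm vec_eq_iff algebra_simps)
  then show "rep \<rho> (inv\<^bsub>W\<^esub> s) *v y = y - pairing y \<alpha> *s \<alpha>v"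
    using rep_inv(1)[OF s, of "y - pairing y \<alpha> *s \<alpha>v"] by simp
qed

lemma rep_simple_reflection:
  assumes "\<rho> r = simple_reflection m i"
  shows "rep \<rho> r *v v = v - pairing v (\<chi> j. complex_of_real (2 * coxeter_form m i j)) *s axis i 1"
proof -
  have "(rep \<rho> r *v v) $ k = (v - pairing v (\<chi> j. complex_of_real (2 * coxeter_form m i j)) *s axis i 1) $ k" for k
  proof -
    have "(rep \<rho> r *v v) $ k = (\<Sum>j\<in>UNIV. (if k = j then v $ j else 0) - (if k = i then v $ j * complex_of_real (2 * coxeter_form m i j) else 0))"
      unfolding matrix_vector_mult_def
      by (simp add: rep_def assms simple_reflection_def map_matrix_def) (intro sum.cong HOL.refl, simp add: algebra_simps)
    also have "\<dots> = v $ k - (\<Sum>j\<in>UNIV. if k = i then v $ j * complex_of_real (2 * coxeter_form m i j) else 0)"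
      by (simp add: sum_subtractf)
    also have "\<dots> = (v - pairing v (\<chi> j. complex_of_real (2 * coxeter_form m i j)) *s axis i 1) $ k"
      by (simp add: pairing_def axis_def)
    finally show ?thesis .
  qed
  then show ?thesis by (simp add: vec_eq_iff)
qed

theorem proposition7p3:
  fixes W :: "('g, 'z) monoid_scheme"
    and m :: "'i::finite \<Rightarrow> 'i \<Rightarrow> nat"
    and r :: "'i \<Rightarrow> 'g"
    and \<rho> :: "'g \<Rightarrow> real ^ 'i ^ 'i"
    and S :: "'g set"
    and \<alpha> \<alpha>v :: "'g \<Rightarrow> complex ^ 'i"
    and c :: "'g \<Rightarrow> complex"
  assumes "coxeter_system W m r"
    and "finite (carrier W)"
    and "real_reflection_rep W m r \<rho>"
    and "S = reflections W r"
    and "\<forall>s\<in>S. \<forall>g\<in>carrier W. c (g \<otimes>\<^bsub>W\<^esub> s \<otimes>\<^bsub>W\<^esub> inv\<^bsub>W\<^esub> g) = c s"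
    and "\<forall>s\<in>S. \<alpha> s \<noteq> 0 \<and> dual_rep W \<rho> s *v \<alpha> s = - \<alpha> s"
    and "\<forall>s\<in>S. \<alpha>v s \<noteq> 0 \<and> rep \<rho> s *v \<alpha>v s = - \<alpha>v s \<and> pairing (\<alpha>v s) (\<alpha> s) = 2"
  shows "(\<exists>\<xi>. natural_hom W \<rho> S \<alpha> \<alpha>v c \<xi>) \<and>
         (\<forall>\<xi>. natural_hom W \<rho> S \<alpha> \<alpha>v c \<xi>
            \<longrightarrow> \<xi> \<in> ring_iso (UP (poly_smash W \<rho>)) (gr_cherednik W \<rho> S \<alpha> \<alpha>v c))"
proof -
  have W: "group W" and r: "\<And>i. r i \<in> carrier W" using assms(1) by (auto simp: coxeter_system_def)
  interpret real_rep W \<rho>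
    using W assms(2,3) by (simp add: real_rep_def real_rep_axioms_def real_reflection_rep_def)
  have S: "S \<subseteq> carrier W" using assms(4) r by (auto simp: reflections_def)
  have refl: "rep \<rho> s *v y = y - pairing y (\<alpha> s) *s \<alpha>v s"
    "rep \<rho> (inv\<^bsub>W\<^esub> s) *v y = y - pairing y (\<alpha> s) *s \<alpha>v s" if s: "s \<in> S" for s y
  proof -
    obtain g i where g: "g \<in> carrier W" "s = g \<otimes>\<^bsub>W\<^esub> r i \<otimes>\<^bsub>W\<^esub> inv\<^bsub>W\<^esub> g"
      using s assms(4) by (auto simp: reflections_def)
    let ?l = "\<chi> j. complex_of_real (2 * coxeter_form m i j)"
    have "\<rho> (r i) = simple_reflection m i" using assms(3) by (simp add: real_reflection_rep_def)
    note ri = rep_simple_reflection[where \<rho> = \<rho> and r = "r i" and m = m and i = i, OF this]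
    \<comment> \<open>Conjugation by \<open>g\<close> carries the rank-one form of the simple
      reflection to \<open>s\<close>, moving its covector by \<open>dual_rep\<close> and its vector
      by \<open>rep\<close>; the chosen eigenvectors of \<open>s\<close> enter only
      afterwards.\<close>
    have rank: "rep \<rho> s *v v = v - pairing v (dual_rep W \<rho> g *v ?l) *s (rep \<rho> g *v axis i 1)" for v
    proof -
      have "rep \<rho> s *v v = rep \<rho> g *v (rep \<rho> (r i) *v (rep \<rho> (inv\<^bsub>W\<^esub> g) *v v))"
        using g r by (simp add: rep_mult matrix_vector_mul_assoc matrix_mul_assoc)
      also have "\<dots> = v - pairing v (dual_rep W \<rho> g *v ?l) *s (rep \<rho> g *v axis i 1)"
        unfolding ri using g by (simp add: matrix_vector_mult_diff_distrib vector_scalar_commute rep_inv pairing_rep)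
      finally show ?thesis .
    qed
    have sc: "s \<in> carrier W" using s S by auto
    show "rep \<rho> s *v y = y - pairing y (\<alpha> s) *s \<alpha>v s" "rep \<rho> (inv\<^bsub>W\<^esub> s) *v y = y - pairing y (\<alpha> s) *s \<alpha>v s"
      using s assms(6,7) by (auto intro!: reflection_formula[OF sc rank])
  qed
  have "g \<otimes>\<^bsub>W\<^esub> s \<otimes>\<^bsub>W\<^esub> inv\<^bsub>W\<^esub> g \<in> S" if g: "g \<in> carrier W" and s: "s \<in> S" for g s
  proof -
    obtain h i where h: "h \<in> carrier W" "s = h \<otimes>\<^bsub>W\<^esub> r i \<otimes>\<^bsub>W\<^esub> inv\<^bsub>W\<^esub> h"
      using s assms(4) by (auto simp: reflections_def)
    have "g \<otimes>\<^bsub>W\<^esub> s \<otimes>\<^bsub>W\<^esub> inv\<^bsub>W\<^esub> g = (g \<otimes>\<^bsub>W\<^esub> h) \<otimes>\<^bsub>W\<^esub> r i \<otimes>\<^bsub>W\<^esub> inv\<^bsub>W\<^esub> (g \<otimes>\<^bsub>W\<^esub> h)"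
      using g h r by (simp add: W.inv_mult_group W.m_assoc)
    then show ?thesis using g h assms(4) unfolding reflections_def by blast
  qed
  then interpret cherednik W \<rho> S \<alpha> \<alpha>v c
    using S refl assms(5,6,7)
    by (intro cherednik.intro real_rep_axioms cherednik_axioms.intro dunkl.intro dunkl_axioms.intro) auto
  show ?thesis using natural_hom_exists natural_hom_iso by blast
qed

end
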